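(* The Hilbert space $\mathcal K^{(1)}$ is a Krein space and can be written as a direct sum, orthogonal for $(\cdot,\cdot)$, $$\mathcal K^{(1)}=\overline{\mathcal D_0^{\perp}/\mathcal I_h}^{\langle\cdot,\cdot\rangle}\oplus V_0\oplus H,$$ where $\mathcal D_0^\perp$ is the subspace of those $f\in\mathcal D_0$ that are orthogonal, with respect to $(\cdot,\cdot)$, to $v_0=-4\pi R^2\,\square h$ (it contains $\mathcal I_h$), the bar denotes completion with respect to $\langle\cdot,\cdot\rangle$, and $V_0=(\mathbb C v_0+\mathcal I_h)/\mathcal I_h$, $H=(\mathbb C h+\mathcal I_h)/\mathcal I_h$. The metric operator $\eta^{(1)}$ on $\mathcal K^{(1)}$, defined by $\langle\cdot,\cdot\rangle=(\cdot,\eta^{(1)}\,\cdot)$, is given by $$\eta^{(1)}\big|_{\overline{\mathcal D_0^\perp/\mathcal I_h}^{\langle\cdot,\cdot\rangle}}=\mathbf 1,\qquad \eta^{(1)}h=v_0,\qquad \eta^{(1)}v_0=h,$$ where $h$ and $v_0$ also denote the corresponding classes modulo $\mathcal I_h$.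
   Context: Fix $R>0$. On $\mathbb R^3$ (and bilinearly on $\mathbb C^3$) put $x\cdot y=x^{(0)}y^{(0)}-x^{(1)}y^{(1)}-x^{(2)}y^{(2)}$, $x^2=x\cdot x$. Two-dimensional de Sitter space is $X_2=\{x\in\mathbb R^3:x^2=-R^2\}$ with the induced metric of signature $(+,-)$, its $SO_0(1,2)$-invariant volume form $\mathrm d\sigma$, and Laplace–Beltrami (d'Alembert) operator $\square$ (sign such that the Klein–Gordon equation is $\square\phi+\mu^2\phi=0$). Let $X_2^{(c)}=\{z\in\mathbb C^3:z^2=-R^2\}$, $V^+=\{y\in\mathbb R^3:y^2>0,y^{(0)}>0\}$, $V^-=-V^+$, $\mathcal T^\pm=(\mathbb R^3+iV^\pm)\cap X_2^{(c)}$. The distribution $\mathcal W_0(x,x')$ on $X_2\times X_2$ is the boundary value, from $z\in\mathcal T^-$, $z'\in\mathcal T^+$, of $W_0(z,z')=-\frac1{4\pi}\ln\left[-\frac{(z-z')^2}{R^2}\right]$ (principal branch). It is $SO_0(1,2)$-invariant and satisfies $\square_x\mathcal W_0=\square_{x'}\mathcal W_0=-\frac1{4\pi R^2}$. $\mathcal D(X_2)$ is the space of complex-valued smooth compactly supported functions, $\langle f,g\rangle=\int_{X_2\times X_2}\mathcal W_0(x,x')\overline{f(x)}g(x')\,\mathrm d\sigma(x)\mathrm d\sigma(x')$, and $\mathcal D_0=\{f\in\mathcal D(X_2):\int_{X_2}f\,\mathrm d\sigma=0\}$, on which $\langle\cdot,\cdot\rangle$ is positive semidefinite. A real function $h\in\mathcal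 D(X_2)$ with $\int_{X_2}h\,\mathrm d\sigma=1$ and $\langle h,h\rangle=0$ is fixed. For $f\in\mathcal D(X_2)$ put $f_0=f-\left(\int_{X_2}f\,\mathrm d\sigma\right)h\in\mathcal D_0$. The Krein inner product on $\mathcal D(X_2)$ is $$(f,g)=\langle f_0,g_0\rangle+\langle f,h\rangle\langle h,g\rangle+\int_{X_2}\overline{f}\,\mathrm d\sigma\int_{X_2}g\,\mathrm d\sigma .$$ It is positive semidefinite with null space $\mathcal I_h=\{f\in\mathcal D_0:\langle f,f\rangle=0,\ \langle h,f\rangle=0\}$, and $\mathcal K^{(1)}$ is the Hilbert space completion of $\mathcal D(X_2)/\mathcal I_h$ for $(\cdot,\cdot)$. The form $\langle\cdot,\cdot\rangle$ descends to the quotient and extends by continuity to $\mathcal K^{(1)}$. Here "Krein space" means a Hilbert space with inner product $(\cdot,\cdot)$ together with an indefinite form $\langle\cdot,\cdot\rangle=(\cdot,\eta\,\cdot)$ for a bounded self-adjoint operator $\eta$ with $\eta^2=\mathbf 1$. *)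

theory Defs
  imports "HOL-Analysis.Analysis"
begin

section \<open>Complex Hilbert spaces\<close>

text \<open>The inner product is antilinear in the first argument. Completeness comes from
  \<^class>\<open>banach\<close>; positive definiteness of \<open>cinner\<close> follows from \<open>norm_eq_sqrt_cinner\<close>.\<close>

class chilbert_space = banach +
  fixes scaleC :: "complex \<Rightarrow> 'a \<Rightarrow> 'a"  (infixr "*\<^sub>C" 75)
    and cinner :: "'a \<Rightarrow> 'a \<Rightarrow> complex"
  assumes scaleC_add_right: "c *\<^sub>C (x + y) = c *\<^sub>C x + c *\<^sub>C y"
    and scaleC_add_left: "(c + d) *\<^sub>C x = c *\<^sub>C x + d *\<^sub>C x"
    and scaleC_scaleC: "c *\<^sub>C (d *\<^sub>C x) = (c * d) *\<^sub>C x"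
    and scaleR_scaleC: "r *\<^sub>R x = complex_of_real r *\<^sub>C x"
    and cinner_commute: "cinner x y = cnj (cinner y x)"
    and cinner_add_right: "cinner x (y + z) = cinner x y + cinner x z"
    and cinner_scaleC_right: "cinner x (c *\<^sub>C y) = c * cinner x y"
    and norm_eq_sqrt_cinner: "norm x = sqrt (Re (cinner x x))"

definition csubspace :: "'k::chilbert_space set \<Rightarrow> bool" where
  "csubspace S \<longleftrightarrow> 0 \<in> S \<and> (\<forall>x\<in>S. \<forall>y\<in>S. x + y \<in> S) \<and> (\<forall>c. \<forall>x\<in>S. c *\<^sub>C x \<in> S)"

definition inner_product_on :: "'k::chilbert_space set \<Rightarrow> ('k \<Rightarrow> 'k \<Rightarrow> complex) \<Rightarrow> bool" where
  "inner_product_on S b \<longleftrightarrow>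
     (\<forall>x\<in>S. \<forall>y\<in>S. b x y = cnj (b y x)) \<and>
     (\<forall>x\<in>S. \<forall>y\<in>S. \<forall>z\<in>S. b x (y + z) = b x y + b x z) \<and>
     (\<forall>c. \<forall>x\<in>S. \<forall>y\<in>S. b x (c *\<^sub>C y) = c * b x y) \<and>
     (\<forall>x\<in>S. x \<noteq> 0 \<longrightarrow> 0 < Re (b x x))"

definition complete_for :: "'k::chilbert_space set \<Rightarrow> ('k \<Rightarrow> 'k \<Rightarrow> complex) \<Rightarrow> bool" where
  "complete_for S b \<longleftrightarrow>
     (\<forall>X :: nat \<Rightarrow> 'k. (\<forall>n. X n \<in> S) \<and>
        (\<forall>e>0. \<exists>M. \<forall>m\<ge>M. \<forall>n\<ge>M. Re (b (X m - X n) (X m - X n)) < e) \<longrightarrow>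
        (\<exists>x\<in>S. (\<lambda>n. b (X n - x) (X n - x)) \<longlonglongrightarrow> 0))"

text \<open>\<open>hilbert_completion E q I S b cls\<close>: the subspace \<open>S\<close> with the inner product \<open>b\<close> is a
  Hilbert space completion of the quotient \<open>E / I\<close> of a space \<open>E\<close> of functions for the form
  induced by \<open>q\<close>; the linear map \<open>cls\<close> on \<open>E\<close> is the quotient map followed by the dense isometric
  inclusion of \<open>E / I\<close> into \<open>S\<close>, so \<open>cls f\<close> is the class of \<open>f\<close> modulo \<open>I\<close>.\<close>

definition hilbert_completion ::
  "('x \<Rightarrow> complex) set \<Rightarrow> (('x \<Rightarrow> complex) \<Rightarrow> ('x \<Rightarrow> complex) \<Rightarrow> complex) \<Rightarrow> ('x \<Rightarrow> complex) set
    \<Rightarrow> 'k::chilbert_space set \<Rightarrow> ('k \<Rightarrow> 'k \<Rightarrow> complex) \<Rightarrow> (('x \<Rightarrow> complex) \<Rightarrow> 'k) \<Rightarrow> bool" where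
  "hilbert_completion E q I S b cls \<longleftrightarrow>
     csubspace S \<and> inner_product_on S b \<and> complete_for S b \<and>
     (\<forall>f\<in>E. cls f \<in> S) \<and>
     (\<forall>f\<in>E. \<forall>g\<in>E. cls (\<lambda>x. f x + g x) = cls f + cls g) \<and>
     (\<forall>c. \<forall>f\<in>E. cls (\<lambda>x. c * f x) = c *\<^sub>C cls f) \<and>
     (\<forall>f\<in>E. cls f = 0 \<longleftrightarrow> f \<in> I) \<and>
     (\<forall>f\<in>E. \<forall>g\<in>E. b (cls f) (cls g) = q f g) \<and>
     (\<forall>y\<in>S. \<forall>e>0. \<exists>f\<in>E. Re (b (y - cls f) (y - cls f)) < e)"

definition bounded_sesquilinear :: "('k::chilbert_space \<Rightarrow> 'k \<Rightarrow> complex) \<Rightarrow> bool" where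
  "bounded_sesquilinear B \<longleftrightarrow> bounded_bilinear B \<and>
     (\<forall>c x y. B (c *\<^sub>C x) y = cnj c * B x y) \<and> (\<forall>c x y. B x (c *\<^sub>C y) = c * B x y)"

definition bounded_operator :: "('k::chilbert_space \<Rightarrow> 'k) \<Rightarrow> bool" where
  "bounded_operator T \<longleftrightarrow> bounded_linear T \<and> (\<forall>c x. T (c *\<^sub>C x) = c *\<^sub>C T x)"

definition krein_metric :: "('k::chilbert_space \<Rightarrow> 'k \<Rightarrow> complex) \<Rightarrow> ('k \<Rightarrow> 'k) \<Rightarrow> bool" where
  "krein_metric B T \<longleftrightarrow>
     bounded_operator T \<and> (\<forall>x y. cinner (T x) y = cinner x (T y)) \<and> (\<forall>x. T (T x) = x) \<and>
     (\<forall>x y. B x y = cinner x (T y)) \<and>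
     (\<exists>x. Re (B x x) < 0) \<and> (\<exists>x. Re (B x x) > 0)"

definition orthogonal_direct_sum3 ::
  "'k::chilbert_space set \<Rightarrow> 'k set \<Rightarrow> 'k set \<Rightarrow> bool" where
  "orthogonal_direct_sum3 A B C \<longleftrightarrow>
     csubspace A \<and> csubspace B \<and> csubspace C \<and>
     (\<forall>a\<in>A. \<forall>b\<in>B. cinner a b = 0) \<and> (\<forall>a\<in>A. \<forall>c\<in>C. cinner a c = 0) \<and>
     (\<forall>b\<in>B. \<forall>c\<in>C. cinner b c = 0) \<and>
     (\<forall>x. \<exists>a\<in>A. \<exists>b\<in>B. \<exists>c\<in>C. x = a + b + c)"


section \<open>De Sitter space\<close>

text \<open>The components with upper index 0, 1, 2 are \<open>x $ 1\<close>, \<open>x $ 2\<close>, \<open>x $ 3\<close>.\<close>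

definition mink :: "'a::comm_ring_1 ^ 3 \<Rightarrow> 'a ^ 3 \<Rightarrow> 'a" where
  "mink x y = x $ 1 * y $ 1 - x $ 2 * y $ 2 - x $ 3 * y $ 3"

definition dS :: "real \<Rightarrow> (real ^ 3) set" where
  "dS R = {x. mink x x = - R\<^sup>2}"

definition dS_complex :: "real \<Rightarrow> (complex ^ 3) set" where
  "dS_complex R = {z. mink z z = - (complex_of_real R)\<^sup>2}"

definition V_plus :: "(real ^ 3) set" where
  "V_plus = {y. 0 < mink y y \<and> 0 < y $ 1}"

definition V_minus :: "(real ^ 3) set" where
  "V_minus = uminus ` V_plus"

definition tuboid :: "real \<Rightarrow> (real ^ 3) set \<Rightarrow> (complex ^ 3) set" where
  "tuboid R V = {z. (\<chi> i. Im (z $ i)) \<in> V} \<inter> dS_complex R"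

text \<open>Global conformal coordinates \<open>(\<tau>, \<theta>)\<close>: on \<open>chart_dom\<close> the map \<open>param R\<close> is a covering of
  \<open>dS R\<close>, \<open>2\<pi>\<close>-periodic in \<open>\<theta>\<close>, and its restrictions to \<open>\<theta>\<close>-intervals of length at most \<open>2\<pi>\<close> are
  the charts. The same formula on complex arguments parametrizes points of \<open>dS_complex R\<close>.\<close>

definition param :: "'a::{real_normed_field,banach} \<Rightarrow> 'a \<times> 'a \<Rightarrow> 'a ^ 3" where
  "param r p = vector [r * tan (fst p), r * cos (snd p) / cos (fst p), r * sin (snd p) / cos (fst p)]"

definition chart_dom :: "(real \<times> real) set" where
  "chart_dom = {- (pi / 2) <..< pi / 2} \<times> UNIV"

lemma param_image: "param R ` chart_dom = dS R" if "R > 0" for R :: real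
proof
  show "param R ` chart_dom \<subseteq> dS R"
  proof
    fix x assume "x \<in> param R ` chart_dom"
    then obtain t s where ts: "- (pi / 2) < t" "t < pi / 2" "x = param R (t, s)"
      by (auto simp: chart_dom_def)
    have c: "cos t \<noteq> 0" using ts cos_gt_zero_pi[of t] by auto
    have "mink x x = R\<^sup>2 * (tan t)\<^sup>2 - R\<^sup>2 * ((cos s)\<^sup>2 + (sin s)\<^sup>2) / (cos t)\<^sup>2"
      unfolding ts(3) mink_def param_def vector_3 fst_conv snd_conv
      by (simp only: power2_eq_square) (simp del: sin_cos_squared_add3 add: distrib_left add_divide_distrib mult_ac)
    also have "\<dots> = R\<^sup>2 * ((tan t)\<^sup>2 - 1 / (cos t)\<^sup>2)"
      by (simp add: right_diff_distrib)
    also have "(tan t)\<^sup>2 - 1 / (cos t)\<^sup>2 = -1"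
      using tan_sec[OF c] by (simp add: inverse_eq_divide power_divide)
    finally show "x \<in> dS R" by (simp add: dS_def)
  qed
next
  show "dS R \<subseteq> param R ` chart_dom"
  proof
    fix x assume "x \<in> dS R"
    hence x: "(x $ 2)\<^sup>2 + (x $ 3)\<^sup>2 = R\<^sup>2 + (x $ 1)\<^sup>2"
      by (simp add: dS_def mink_def power2_eq_square)
    define t where "t = arctan (x $ 1 / R)"
    have t: "- (pi / 2) < t" "t < pi / 2" "tan t = x $ 1 / R"
      using arctan[of "x $ 1 / R"] by (auto simp: t_def)
    have c: "cos t > 0" using t cos_gt_zero_pi by blast
    have "R\<^sup>2 + (x $ 1)\<^sup>2 = R\<^sup>2 * (1 + (tan t)\<^sup>2)"
      using that by (simp add: t(3) power_divide field_simps)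
    also have "1 + (tan t)\<^sup>2 = 1 / (cos t)\<^sup>2"
      using c by (simp add: tan_sec inverse_eq_divide power_divide)
    finally have "(x $ 2 * cos t / R)\<^sup>2 + (x $ 3 * cos t / R)\<^sup>2 = 1"
      using x that c by (simp add: power_mult_distrib power_divide flip: distrib_right add_divide_distrib)
    then obtain s where s: "x $ 2 * cos t / R = cos s" "x $ 3 * cos t / R = sin s"
      using sincos_total_2pi by metis
    have "x = param R (t, s)"
      using that c by (simp add: param_def vec_eq_iff forall_3 t(3) flip: s)
    thus "x \<in> param R ` chart_dom" using t by (auto simp: chart_dom_def)
  qed
qed

definition unit_vec :: "2 \<Rightarrow> real \<times> real" where
  "unit_vec i = (if i = 1 then (1, 0) else (0, 1))"

definition pdiff :: "2 \<Rightarrow> (real \<times> real \<Rightarrow> 'b::real_normed_vector) \<Rightarrow> real \<times> real \<Rightarrow> 'b" where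
  "pdiff i F p = frechet_derivative F (at p) (unit_vec i)"

definition metric :: "real \<Rightarrow> real \<times> real \<Rightarrow> real ^ 2 ^ 2" where
  "metric R p = (\<chi> i j. mink (pdiff i (param R) p) (pdiff j (param R) p))"

definition vol_density :: "real \<Rightarrow> real \<times> real \<Rightarrow> real" where
  "vol_density R p = sqrt \<bar>det (metric R p)\<bar>"

text \<open>The volume measure \<open>d\<sigma>\<close>, expressed in coordinates on a fundamental domain of the covering.\<close>

definition dsigma :: "real \<Rightarrow> (real \<times> real) measure" where
  "dsigma R = density (restrict_space lborel ({- (pi / 2) <..< pi / 2} \<times> {0 ..< 2 * pi}))
                      (\<lambda>p. ennreal (vol_density R p))"

definition dS_integral :: "real \<Rightarrow> (real ^ 3 \<Rightarrow> complex) \<Rightarrow> complex" where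
  "dS_integral R f = (LINT p|dsigma R. f (param R p))"

text \<open>The Laplace-Beltrami operator of the induced metric,
  \<open>|g|\<^sup>-\<^sup>1\<^sup>/\<^sup>2 \<Sum>\<^sub>i\<^sub>j \<partial>\<^sub>i (|g|\<^sup>1\<^sup>/\<^sup>2 g\<^sup>i\<^sup>j \<partial>\<^sub>j)\<close>. By periodicity in \<open>\<theta>\<close> the value does not depend on the
  preimage of \<open>x\<close> that is chosen.\<close>

definition dAlembertian :: "real \<Rightarrow> (real ^ 3 \<Rightarrow> complex) \<Rightarrow> real ^ 3 \<Rightarrow> complex" where
  "dAlembertian R f x =
     (if x \<in> dS R then
        let p = inv_into chart_dom (param R) x; F = (\<lambda>q. f (param R q))
        in (\<Sum>i\<in>UNIV. \<Sum>j\<in>UNIV.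
              pdiff i (\<lambda>q. (vol_density R q * matrix_inv (metric R q) $ i $ j) *\<^sub>R pdiff j F q) p)
           /\<^sub>R vol_density R p
      else 0)"

primrec C_k_on :: "nat \<Rightarrow> 'a::real_normed_vector set \<Rightarrow> ('a \<Rightarrow> 'b::real_normed_vector) \<Rightarrow> bool" where
  "C_k_on 0 S F \<longleftrightarrow> continuous_on S F"
| "C_k_on (Suc k) S F \<longleftrightarrow> (\<forall>p\<in>S. F differentiable (at p)) \<and>
     (\<forall>v. C_k_on k S (\<lambda>p. frechet_derivative F (at p) v))"

text \<open>Functions on \<open>dS R\<close> are represented by their extension by zero to the ambient space.\<close>

definition test_functions :: "real \<Rightarrow> (real ^ 3 \<Rightarrow> complex) set" where
  "test_functions R =
     {f. (\<forall>k. C_k_on k chart_dom (\<lambda>p. f (param R p))) \<and>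
         (\<exists>K. compact K \<and> K \<subseteq> dS R \<and> (\<forall>x. x \<notin> K \<longrightarrow> f x = 0))}"


section \<open>The two-point function and its boundary value\<close>

definition W0 :: "real \<Rightarrow> complex ^ 3 \<Rightarrow> complex ^ 3 \<Rightarrow> complex" where
  "W0 R z z' = - (1 / (4 * complex_of_real pi)) *
     Ln (- (mink (z - z') (z - z') / (complex_of_real R)\<^sup>2))"

definition shifted_point :: "real \<Rightarrow> real \<times> real \<Rightarrow> real \<times> real \<Rightarrow> complex ^ 3" where
  "shifted_point R \<eta> p =
     param (complex_of_real R) (Complex (fst p) (fst \<eta>), Complex (snd p) (snd \<eta>))"

text \<open>The imaginary displacements of the coordinates that carry all of \<open>dS R\<close> into \<open>T\<close>; for the
  two tuboids these are the open cones \<open>\<plusminus>\<eta>\<^sub>\<tau> > |\<eta>\<^sub>\<theta>|\<close>.\<close>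

definition approach :: "real \<Rightarrow> (complex ^ 3) set \<Rightarrow> (real \<times> real) set" where
  "approach R T = {\<eta>. \<forall>p\<in>chart_dom. shifted_point R \<eta> p \<in> T}"

text \<open>The boundary value in the sense of distributions, from the backward tuboid in the first and
  the forward tuboid in the second variable, evaluated on the product of \<open>cnj f\<close> and \<open>g\<close>.\<close>

definition bracket :: "real \<Rightarrow> (real ^ 3 \<Rightarrow> complex) \<Rightarrow> (real ^ 3 \<Rightarrow> complex) \<Rightarrow> complex" where
  "bracket R f g =
     Lim (at 0 within (approach R (tuboid R V_minus) \<times> approach R (tuboid R V_plus)))
       (\<lambda>(\<eta>, \<eta>'). LINT (p, p')|(dsigma R \<Otimes>\<^sub>M dsigma R).
          W0 R (shifted_point R \<eta> p) (shifted_point R \<eta>' p') *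
            cnj (f (param R p)) * g (param R p'))"


section \<open>The Krein inner product\<close>

definition D0 :: "real \<Rightarrow> (real ^ 3 \<Rightarrow> complex) set" where
  "D0 R = {f \<in> test_functions R. dS_integral R f = 0}"

definition proj0 ::
  "real \<Rightarrow> (real ^ 3 \<Rightarrow> complex) \<Rightarrow> (real ^ 3 \<Rightarrow> complex) \<Rightarrow> (real ^ 3 \<Rightarrow> complex)" where
  "proj0 R h f = (\<lambda>x. f x - dS_integral R f * h x)"

definition krein_inner ::
  "real \<Rightarrow> (real ^ 3 \<Rightarrow> complex) \<Rightarrow> (real ^ 3 \<Rightarrow> complex) \<Rightarrow> (real ^ 3 \<Rightarrow> complex) \<Rightarrow> complex" where
  "krein_inner R h f g =
     bracket R (proj0 R h f) (proj0 R h g) + bracket R f h * bracket R h g +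
     dS_integral R (\<lambda>x. cnj (f x)) * dS_integral R g"

definition I_null :: "real \<Rightarrow> (real ^ 3 \<Rightarrow> complex) \<Rightarrow> (real ^ 3 \<Rightarrow> complex) set" where
  "I_null R h = {f \<in> D0 R. bracket R f f = 0 \<and> bracket R h f = 0}"

definition v0 :: "real \<Rightarrow> (real ^ 3 \<Rightarrow> complex) \<Rightarrow> real ^ 3 \<Rightarrow> complex" where
  "v0 R h = (\<lambda>x. - 4 * complex_of_real pi * (complex_of_real R)\<^sup>2 * dAlembertian R h x)"

definition D0_perp :: "real \<Rightarrow> (real ^ 3 \<Rightarrow> complex) \<Rightarrow> (real ^ 3 \<Rightarrow> complex) set" where
  "D0_perp R h = {f \<in> D0 R. krein_inner R h f (v0 R h) = 0}"

definition extends_bracket ::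
  "real \<Rightarrow> ((real ^ 3 \<Rightarrow> complex) \<Rightarrow> 'k::chilbert_space) \<Rightarrow> ('k \<Rightarrow> 'k \<Rightarrow> complex) \<Rightarrow> bool" where
  "extends_bracket R cls B \<longleftrightarrow> bounded_sesquilinear B \<and>
     (\<forall>f\<in>test_functions R. \<forall>g\<in>test_functions R. B (cls f) (cls g) = bracket R f g)"

definition line_plus ::
  "(real ^ 3 \<Rightarrow> complex) \<Rightarrow> (real ^ 3 \<Rightarrow> complex) set \<Rightarrow> (real ^ 3 \<Rightarrow> complex) set" where
  "line_plus v I = {\<lambda>x. c * v x + f x | c f. f \<in> I}"

end

theory Submission
  imports Defs
begin

text \<open>In the conformal coordinates \<open>(\<tau>, \<theta>)\<close> the argument of the logarithm in \<open>W0\<close> factorizes on the product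
  of the two tuboids as
  \<open>4 (1 - q\<^sub>+) (1 - q\<^sub>-) / ((1 + e\<^bsup>-2i\<tau>\<^esup>) (1 + e\<^bsup>2i\<tau>'\<^esup>))\<close> with
  \<open>q\<^sub>\<plusminus> = e\<^bsup>-i((\<tau> - \<tau>') \<plusminus> (\<theta> - \<theta>'))\<^esup>\<close>, and all exponentials lie in the open unit disc. Expanding
  \<open>Ln (1 - q\<^sub>\<plusminus>)\<close> into its power series and letting the imaginary parts tend to zero shows that \<open>\<langle>f, g\<rangle>\<close>
  is, up to terms containing \<open>\<integral>f\<close> or \<open>\<integral>g\<close>, the positive form
  \<open>(1 / 4\<pi>) \<Sum>\<^sub>n (cnj F\<^sub>n G\<^sub>n + cnj F'\<^sub>n G'\<^sub>n) / n\<close> in the coefficients of \<open>f\<close> and \<open>g\<close> with respect to the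
  plane waves \<open>e\<^bsup>in(\<tau> \<plusminus> \<theta>)\<^esup>\<close>. The plane waves solve the wave equation, whereas the d'Alembertian maps the
  remaining mode \<open>ln (2 cos \<tau>) + i\<tau>\<close> to the constant \<open>-1/R\<^sup>2\<close>; Green's formula then gives
  \<open>\<langle>v\<^sub>0, g\<rangle> = \<integral>g\<close>. Consequently the classes of \<open>v\<^sub>0\<close> and \<open>h\<close> are orthonormal for the Krein inner product,
  and \<open>\<eta>\<close> is the unitary that exchanges them and fixes their orthogonal complement.\<close>

subsection \<open>Complex Hilbert spaces\<close>

text \<open>Three difficulties shape the analytic side. The boundary value is a joint limit in four
  real displacements. Since every term of the expansion depends on them through a single positive
  number (a time shift or a light-cone gap), it reduces to one-sided limits at zero. At zero
  displacement the exponentials reach the unit circle and geometric convergence is lost; decay of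
  the plane-wave coefficients in n, obtained from smoothness in \<theta>, replaces it. The
  logarithmic terms are singular only at the edges \<tau> = pi/2 and \<tau> = -pi/2 of the chart,
  which the support of a test function avoids. The Hilbert space side uses no geometry and is
  carried out in a locale. Its essential inputs are positivity on functions of zero integral and the
  identity between the bracket with \<open>v0\<close> and the integral. They make the indefinite
  form a rank-two perturbation of the Krein form, so the metric operator can be written down at
  once, and the statements about the completion become algebra together with density.\<close>

lemma cinner_add_left: "cinner (x + y) z = cinner x z + cinner (y::'k::chilbert_space) z"
  by (metis cinner_add_right cinner_commute complex_cnj_add)

lemma cinner_scaleC_left: "cinner (c *\<^sub>C x) y = cnj c * cinner x (y::'k::chilbert_space)"
  by (metis cinner_scaleC_right cinner_commute complex_cnj_mult)

lemma scaleC_simps [simp]: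
  fixes x :: "'k::chilbert_space"
  shows "1 *\<^sub>C x = x" "0 *\<^sub>C x = 0" "c *\<^sub>C (0::'k) = 0" "c *\<^sub>C (- x) = - (c *\<^sub>C x)" "(- c) *\<^sub>C x = - (c *\<^sub>C x)"
proof -
  show "1 *\<^sub>C x = x" using scaleR_scaleC[of 1 x] by simp
  show z: "0 *\<^sub>C x = 0" using scaleR_scaleC[of 0 x] by simp
  show c0: "c *\<^sub>C (0::'k) = 0" using scaleC_add_right[of c 0 "0::'k"] by simp
  show "c *\<^sub>C (- x) = - (c *\<^sub>C x)"
    using scaleC_add_right[of c x "-x"] c0 by (simp add: eq_neg_iff_add_eq_0 add.commute)
  show "(- c) *\<^sub>C x = - (c *\<^sub>C x)"
    using scaleC_add_left[of c "-c" x] z by (simp add: eq_neg_iff_add_eq_0 add.commute)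
qed

lemma scaleC_diff_right: "c *\<^sub>C (x - y) = c *\<^sub>C x - c *\<^sub>C (y::'k::chilbert_space)"
  using scaleC_add_right[of c x "-y"] by simp

lemma cinner_minus_right: "cinner x (- y) = - cinner x (y::'k::chilbert_space)"
  using cinner_scaleC_right[of x "-1" y] by simp

lemma cinner_diff_right: "cinner x (y - z) = cinner x y - cinner x (z::'k::chilbert_space)"
  using cinner_add_right[of x y "-z"] by (simp add: cinner_minus_right)

lemma cinner_diff_left: "cinner (x - y) z = cinner x z - cinner y (z::'k::chilbert_space)"
  by (metis cinner_diff_right cinner_commute complex_cnj_diff)

lemma cinner_zero [simp]: "cinner x 0 = 0" "cinner 0 x = 0" for x :: "'k::chilbert_space"
  using cinner_diff_right[of x 0 0] cinner_diff_left[of 0 0 x] by auto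

lemma cinner_self: "cinner x x = complex_of_real ((norm x)\<^sup>2)" for x :: "'k::chilbert_space"
proof -
  \<comment> \<open>The real \<open>sqrt\<close> is odd, so a negative argument would give a
    negative norm. This is how the class axioms yield positivity.\<close>
  have "Re (cinner x x) \<ge> 0"
    by (metis norm_eq_sqrt_cinner norm_ge_zero real_sqrt_ge_0_iff)
  then have "Re (cinner x x) = (norm x)\<^sup>2"
    by (simp add: norm_eq_sqrt_cinner)
  moreover have "Im (cinner x x) = 0"
    using cinner_commute[of x x] by (metis complex_cnj_cancel_iff complex_eq_iff complex_cnj add.inverse_neutral cnj.sel(2) equal_neg_zero)
  ultimately show ?thesis by (simp add: complex_eq_iff)
qed

lemma norm_scaleC: "norm (c *\<^sub>C x) = norm c * norm (x::'k::chilbert_space)"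
proof -
  have "complex_of_real ((norm (c *\<^sub>C x))\<^sup>2) = complex_of_real ((norm c * norm x)\<^sup>2)"
    unfolding cinner_self[symmetric] cinner_scaleC_right cinner_scaleC_left
    using complex_norm_square[of c] by (simp add: cinner_self power_mult_distrib mult_ac)
  then show ?thesis by (simp only: of_real_eq_iff) (simp add: power2_eq_iff_nonneg)
qed

lemma cinner_Cauchy_Schwarz: "norm (cinner x y) \<le> norm x * norm (y::'k::chilbert_space)"
proof (cases "y = 0")
  case False
  \<comment> \<open>The coefficient of the orthogonal projection of \<open>x\<close> onto
    \<open>y\<close>; the inequality says that the remainder has nonnegative square.\<close>
  define c where "c = cinner y x / cinner y y"
  have ny: "norm y > 0" using False by simp
  have "0 \<le> Re (cinner (x - c *\<^sub>C y) (x - c *\<^sub>C y))" by (simp add: cinner_self)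
  also have "cinner (x - c *\<^sub>C y) (x - c *\<^sub>C y) =
      cinner x x - c * cinner x y - cnj c * (cinner y x - c * cinner y y)"
    by (simp add: cinner_diff_left cinner_diff_right cinner_scaleC_left cinner_scaleC_right algebra_simps)
  also have "c * cinner y y = cinner y x"
    using ny by (simp add: c_def cinner_self)
  also have "cinner x x - c * cinner x y - cnj c * (cinner y x - cinner y x) =
      cinner x x - cinner x y * cinner y x / cinner y y"
    by (simp add: c_def)
  also have "cinner x y * cinner y x = complex_of_real ((norm (cinner x y))\<^sup>2)"
    by (metis cinner_commute complex_norm_square)
  finally have "(norm (cinner x y))\<^sup>2 / (norm y)\<^sup>2 \<le> (norm x)\<^sup>2"
    by (simp add: cinner_self flip: of_real_power of_real_divide of_real_diff)
  then have "(norm (cinner x y))\<^sup>2 \<le> (norm x * norm y)\<^sup>2"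
    using ny by (simp add: field_simps power_mult_distrib)
  then show ?thesis by (simp add: power2_le_iff_abs_le)
qed simp

lemma bounded_sesquilinear_cinner: "bounded_sesquilinear (cinner :: 'k::chilbert_space \<Rightarrow> 'k \<Rightarrow> complex)"
  unfolding bounded_sesquilinear_def
proof (intro conjI allI)
  show "bounded_bilinear (cinner :: 'k \<Rightarrow> 'k \<Rightarrow> complex)"
    by (rule bounded_bilinear.intro)
      (auto simp: cinner_add_left cinner_add_right scaleR_scaleC cinner_scaleC_left
        cinner_scaleC_right scaleR_conv_of_real intro!: exI[of _ 1] cinner_Cauchy_Schwarz)
qed (simp_all add: cinner_scaleC_left cinner_scaleC_right)

lemmas bounded_bilinear_cinner = bounded_sesquilinear_cinner[unfolded bounded_sesquilinear_def, THEN conjunct1]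

lemmas tendsto_cinner [tendsto_intros] = bounded_bilinear.tendsto[OF bounded_bilinear_cinner]

text \<open>Rank-one operators: the metric operator and the projection in
  \<open>krein_completion\<close> are both the identity minus two of these.\<close>

lemma bounded_operator_scaleC_cinner: "bounded_operator (\<lambda>x. cinner u x *\<^sub>C (w::'k::chilbert_space))"
  unfolding bounded_operator_def
proof (intro conjI allI)
  show "bounded_linear (\<lambda>x. cinner u x *\<^sub>C w)"
  proof (rule bounded_linear_intro[where K = "norm u * norm w"])
    fix x show "norm (cinner u x *\<^sub>C w) \<le> norm x * (norm u * norm w)"
      using mult_right_mono[OF cinner_Cauchy_Schwarz[of u x] norm_ge_zero[of w]]
      by (simp add: norm_scaleC mult_ac)
  qed (simp_all add: cinner_add_right scaleC_add_left scaleR_scaleC cinner_scaleC_right scaleC_scaleC)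
qed (simp add: cinner_scaleC_right scaleC_scaleC)

lemma bounded_operator_id: "bounded_operator (\<lambda>x. x)"
  by (simp add: bounded_operator_def bounded_linear_ident)

lemma bounded_operator_diff:
  "bounded_operator S \<Longrightarrow> bounded_operator T \<Longrightarrow> bounded_operator (\<lambda>x. S x - T x)"
  by (simp add: bounded_operator_def bounded_linear_sub scaleC_diff_right)

lemma bounded_sesquilinear_comp_right:
  assumes "bounded_sesquilinear B" "bounded_operator T"
  shows "bounded_sesquilinear (\<lambda>x y. B x (T y))"
  using assms unfolding bounded_sesquilinear_def bounded_operator_def
  by (auto intro: bounded_bilinear.comp[OF _ bounded_linear_ident])

text \<open>Both forms are jointly continuous, so limits of sequences from \<open>S\<close> decide
  them. This gives uniqueness of the extended form.\<close>

lemma bounded_sesquilinear_eq_on_dense: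
  assumes "bounded_sesquilinear B" "bounded_sesquilinear B'" "closure S = UNIV"
    and eq: "\<And>x y. x \<in> S \<Longrightarrow> y \<in> S \<Longrightarrow> B x y = B' x y"
  shows "B = B'"
proof (intro ext)
  fix x y
  have "x \<in> closure S" "y \<in> closure S" using assms(3) by auto
  then obtain X Y where X: "\<And>n. X n \<in> S" "X \<longlonglongrightarrow> x" and Y: "\<And>n. Y n \<in> S" "Y \<longlonglongrightarrow> y"
    unfolding closure_sequential by auto
  have "(\<lambda>n. B (X n) (Y n)) \<longlonglongrightarrow> B x y" "(\<lambda>n. B' (X n) (Y n)) \<longlonglongrightarrow> B' x y"
    using assms(1,2) X(2) Y(2) by (auto simp: bounded_sesquilinear_def intro: bounded_bilinear.tendsto)
  then show "B x y = B' x y" using eq[OF X(1) Y(1)] by (simp add: LIMSEQ_unique)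
qed

subsection \<open>Spaces with one negative direction\<close>

text \<open>Below, \<open>E\<close>, \<open>br\<close>, \<open>\<sigma>\<close> and \<open>v\<close> are the test functions, the boundary value \<open>bracket\<close>, the integral
  over de Sitter space and \<open>v0\<close>.\<close>

locale krein_data =
  fixes E :: "('x \<Rightarrow> complex) set"
    and br :: "('x \<Rightarrow> complex) \<Rightarrow> ('x \<Rightarrow> complex) \<Rightarrow> complex"
    and \<sigma> :: "('x \<Rightarrow> complex) \<Rightarrow> complex"
    and h v :: "'x \<Rightarrow> complex"
  assumes E_add: "f \<in> E \<Longrightarrow> g \<in> E \<Longrightarrow> (\<lambda>x. f x + g x) \<in> E"
    and E_scale: "f \<in> E \<Longrightarrow> (\<lambda>x. c * f x) \<in> E"
    and \<sigma>_add: "f \<in> E \<Longrightarrow> g \<in> E \<Longrightarrow> \<sigma> (\<lambda>x. f x + g x) = \<sigma> f + \<sigma> g"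
    and \<sigma>_scale: "f \<in> E \<Longrightarrow> \<sigma> (\<lambda>x. c * f x) = c * \<sigma> f"
    and br_commute: "f \<in> E \<Longrightarrow> g \<in> E \<Longrightarrow> br f g = cnj (br g f)"
    and br_add: "f \<in> E \<Longrightarrow> g \<in> E \<Longrightarrow> k \<in> E \<Longrightarrow> br f (\<lambda>x. g x + k x) = br f g + br f k"
    and br_scale: "f \<in> E \<Longrightarrow> g \<in> E \<Longrightarrow> br f (\<lambda>x. c * g x) = c * br f g"
    and br_pos: "f \<in> E \<Longrightarrow> \<sigma> f = 0 \<Longrightarrow> 0 \<le> Re (br f f)"
    and h_E: "h \<in> E" and \<sigma>_h: "\<sigma> h = 1" and br_h_h: "br h h = 0"
    and v_E: "v \<in> E" and \<sigma>_v: "\<sigma> v = 0" and br_v: "g \<in> E \<Longrightarrow> br v g = \<sigma> g"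
begin

text \<open>\<open>pr\<close>, \<open>kr\<close>, \<open>null\<close> and \<open>perp\<close> are
  the abstract counterparts of \<open>proj0\<close>, \<open>krein_inner\<close>,
  \<open>I_null\<close> and \<open>D0_perp\<close>; the final theorem identifies them.\<close>

definition pr :: "('x \<Rightarrow> complex) \<Rightarrow> 'x \<Rightarrow> complex" where
  "pr f = (\<lambda>x. f x - \<sigma> f * h x)"

definition kr :: "('x \<Rightarrow> complex) \<Rightarrow> ('x \<Rightarrow> complex) \<Rightarrow> complex" where
  "kr f g = br (pr f) (pr g) + br f h * br h g + cnj (\<sigma> f) * \<sigma> g"

definition null :: "('x \<Rightarrow> complex) set" where
  "null = {f \<in> E. \<sigma> f = 0 \<and> br f f = 0 \<and> br h f = 0}"

definition perp :: "('x \<Rightarrow> complex) set" where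
  "perp = {f \<in> E. \<sigma> f = 0 \<and> kr f v = 0}"

lemma E_diff: "f \<in> E \<Longrightarrow> g \<in> E \<Longrightarrow> (\<lambda>x. f x - c * g x) \<in> E"
  using E_add[of f "\<lambda>x. (- c) * g x"] E_scale[of g "- c"] by simp

lemma \<sigma>_diff: "f \<in> E \<Longrightarrow> g \<in> E \<Longrightarrow> \<sigma> (\<lambda>x. f x - c * g x) = \<sigma> f - c * \<sigma> g"
  using \<sigma>_add[of f "\<lambda>x. (- c) * g x"] \<sigma>_scale[of g "- c"] E_scale[of g "- c"] by simp

lemma br_diff_right: "f \<in> E \<Longrightarrow> g \<in> E \<Longrightarrow> k \<in> E \<Longrightarrow> br f (\<lambda>x. g x - c * k x) = br f g - c * br f k"
  using br_add[of f g "\<lambda>x. (- c) * k x"] br_scale[of f k "- c"] E_scale[of k "- c"] by simp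

lemma br_diff_left:
  assumes "f \<in> E" "g \<in> E" "k \<in> E"
  shows "br (\<lambda>x. g x - c * k x) f = br g f - cnj c * br k f"
proof -
  have "br (\<lambda>x. g x - c * k x) f = cnj (br f (\<lambda>x. g x - c * k x))"
    using assms by (intro br_commute E_diff)
  then show ?thesis
    using assms by (simp add: br_diff_right br_commute[of g f] br_commute[of k f])
qed

lemma pr_E: "f \<in> E \<Longrightarrow> pr f \<in> E"
  unfolding pr_def by (intro E_diff h_E)

lemma \<sigma>_pr: "f \<in> E \<Longrightarrow> \<sigma> (pr f) = 0"
  unfolding pr_def by (simp add: \<sigma>_diff h_E \<sigma>_h)

lemma pr_id: "\<sigma> f = 0 \<Longrightarrow> pr f = f"
  by (simp add: pr_def)

lemma br_v_right: "g \<in> E \<Longrightarrow> br g v = cnj (\<sigma> g)"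
  using br_commute[of g v] br_v[of g] v_E by simp

lemma br_self_real: "f \<in> E \<Longrightarrow> Im (br f f) = 0"
  using br_commute[of f f] by (simp add: complex_eq_iff)

text \<open>By Hermitian symmetry the first summand is real and the other two are squared
  moduli.\<close>

lemma kr_self:
  assumes "f \<in> E"
  shows "kr f f = complex_of_real (Re (br (pr f) (pr f)) + (norm (br h f))\<^sup>2 + (norm (\<sigma> f))\<^sup>2)"
proof -
  have "br f h * br h f = complex_of_real ((norm (br h f))\<^sup>2)"
    unfolding br_commute[OF assms h_E] by (metis complex_norm_square mult.commute)
  moreover have "cnj (\<sigma> f) * \<sigma> f = complex_of_real ((norm (\<sigma> f))\<^sup>2)"
    by (metis complex_norm_square mult.commute)
  moreover have "br (pr f) (pr f) = complex_of_real (Re (br (pr f) (pr f)))"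
    using br_self_real[OF pr_E[OF assms]] by (simp add: complex_eq_iff)
  ultimately show ?thesis unfolding kr_def by simp
qed

text \<open>A sum of three nonnegative terms vanishes only termwise. Once \<open>\<sigma> f\<close>
  is zero, \<open>pr f\<close> is \<open>f\<close> itself, and the conditions become those of
  \<open>null\<close>.\<close>

lemma kr_properties:
  assumes f: "f \<in> E"
  shows "kr f f \<in> \<real>" "0 \<le> Re (kr f f)" "kr f f = 0 \<longleftrightarrow> f \<in> null"
proof -
  have p: "0 \<le> Re (br (pr f) (pr f))" by (intro br_pos pr_E \<sigma>_pr f)
  show "kr f f \<in> \<real>" "0 \<le> Re (kr f f)"
    using p by (simp_all add: kr_self[OF f])
  have "kr f f = 0 \<longleftrightarrow> Re (br (pr f) (pr f)) = 0 \<and> br h f = 0 \<and> \<sigma> f = 0"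
    unfolding kr_self[OF f] of_real_eq_0_iff
    using p by (smt (verit) norm_eq_zero zero_le_power2 zero_eq_power2)
  also have "\<dots> \<longleftrightarrow> f \<in> null"
    using f br_self_real[OF f] by (auto simp: null_def pr_id complex_eq_iff)
  finally show "kr f f = 0 \<longleftrightarrow> f \<in> null" .
qed

text \<open>A bracket with \<open>v\<close> is a conjugated integral, so the first summand dies on
  \<open>pr f\<close> and the factor \<open>br h v\<close> is 1; the last summand dies because
  \<open>v\<close> has integral zero. Only the middle one is left.\<close>

lemma kr_v:
  assumes "f \<in> E" shows "kr f v = br f h"
  using assms v_E \<sigma>_v
  by (simp add: kr_def pr_id br_v_right pr_E \<sigma>_pr h_E \<sigma>_h br_commute[of h v])

lemma v_kr: 
  assumes "f \<in> E" shows "kr v f = br h f"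
  using assms v_E \<sigma>_v
  by (simp add: kr_def pr_id br_v pr_E \<sigma>_pr h_E \<sigma>_h)

lemma br_zero: assumes "f \<in> E" shows "br (\<lambda>x. 0) f = 0"
proof -
  have "br f (\<lambda>x. 0) = 0" using br_scale[OF assms assms, of 0] by simp
  moreover have "(\<lambda>x. 0) \<in> E" using E_scale[OF assms, of 0] by simp
  ultimately show ?thesis using br_commute[OF _ assms] by simp
qed

text \<open>\<open>pr h\<close> is zero and \<open>h\<close> is neutral for the indefinite form,
  which removes the first two summands.\<close>

lemma h_kr: 
  assumes "f \<in> E" shows "kr h f = \<sigma> f"
proof -
  have "pr h = (\<lambda>x. 0)" by (simp add: pr_def \<sigma>_h)
  then show ?thesis
    using assms by (simp add: kr_def \<sigma>_h br_h_h br_zero pr_E)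
qed

lemma perp_eq: "perp = {f \<in> E. \<sigma> f = 0 \<and> br h f = 0}"
  unfolding perp_def by (auto simp: kr_v br_commute[of _ h] h_E)

lemma null_subset_perp: "null \<subseteq> perp"
  by (auto simp: null_def perp_eq)

text \<open>Expanding \<open>pr\<close> leaves no \<open>br h h\<close> term. The correction is of
  rank two in the functionals \<open>br h\<close> and \<open>\<sigma>\<close>, and these are the
  Krein products with \<open>v\<close> and \<open>h\<close>; the formula therefore dictates the
  metric operator.\<close>

lemma br_eq_kr:
  assumes "f \<in> E" "g \<in> E"
  shows "br f g = kr f g - br h g * (cnj (br h f) - cnj (\<sigma> f)) - \<sigma> g * (cnj (\<sigma> f) - cnj (br h f))"
proof -
  have "br (pr f) (pr g) = br f g - \<sigma> g * br f h - cnj (\<sigma> f) * br h g"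
    unfolding pr_def using assms by (simp add: br_diff_left br_diff_right E_diff h_E br_h_h algebra_simps)
  then show ?thesis
    unfolding kr_def br_commute[OF assms(1) h_E] by (simp add: algebra_simps)
qed

text \<open>The extended form is defined outright through the operator read off from
  \<open>br_eq_kr\<close>, so its existence is a computation and its uniqueness is density.
  \<open>N\<close> is the orthogonal complement of the classes of \<open>v\<close> and
  \<open>h\<close>. The operator is the identity there, so on \<open>N\<close> the indefinite form
  is the Hilbert inner product.\<close>

theorem krein_completion:
  fixes cls :: "('x \<Rightarrow> complex) \<Rightarrow> 'k::chilbert_space"
  assumes hc: "hilbert_completion E kr null UNIV cinner cls"
  defines "ext \<equiv> \<lambda>B. bounded_sesquilinear B \<and> (\<forall>f\<in>E. \<forall>g\<in>E. B (cls f) (cls g) = br f g)"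
  shows "\<exists>!B. ext B"
    and "ext B \<Longrightarrow> \<exists>N \<eta>.
               krein_metric B \<eta> \<and>
               hilbert_completion perp br null N B cls \<and>
               orthogonal_direct_sum3 N (cls ` {\<lambda>x. c * v x + f x | c f. f \<in> null})
                                        (cls ` {\<lambda>x. c * h x + f x | c f. f \<in> null}) \<and>
               (\<forall>x \<in> N. \<eta> x = x) \<and>
               \<eta> (cls h) = cls v \<and>
               \<eta> (cls v) = cls h"
proof -
  note hc' = hc[unfolded hilbert_completion_def]
  have cls_add: "cls (\<lambda>x. f x + g x) = cls f + cls g" if "f \<in> E" "g \<in> E" for f g
    using hc' that by blast
  have cls_scale: "cls (\<lambda>x. c * f x) = c *\<^sub>C cls f" if "f \<in> E" for c f
    using hc' that by blast
  have cls_null: "cls f = 0 \<longleftrightarrow> f \<in> null" if "f \<in> E" for f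
    using hc' that by blast
  have cls_kr: "cinner (cls f) (cls g) = kr f g" if "f \<in> E" "g \<in> E" for f g
    using hc' that by blast
  have cls_diff: "cls (\<lambda>x. f x - c * g x) = cls f - c *\<^sub>C cls g" if "f \<in> E" "g \<in> E" for f g c
    using cls_add[of f "\<lambda>x. (- c) * g x"] cls_scale[of g "- c"] E_scale[of g "- c"] that by simp
  have dense: "\<exists>f\<in>E. norm (y - cls f) < e" if "e > 0" for y e
  proof -
    have "\<exists>f\<in>E. Re (cinner (y - cls f) (y - cls f)) < e\<^sup>2"
      using hc' that zero_less_power[of e 2] by blast
    then obtain f where "f \<in> E" "(norm (y - cls f))\<^sup>2 < e\<^sup>2"
      by (auto simp: cinner_self)
    then show ?thesis
      using that power_less_imp_less_base[of "norm (y - cls f)" 2 e] by auto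
  qed
  have closure: "closure (cls ` E) = UNIV"
    unfolding closure_approachable dist_norm set_eq_iff
    using dense norm_minus_commute by (metis UNIV_I imageI)
  define V H where "V = cls v" and "H = cls h"
  have VV: "cinner V V = 1" unfolding V_def using br_commute[OF h_E v_E]
    by (simp add: cls_kr v_E kr_v br_v h_E \<sigma>_h)
  have HH: "cinner H H = 1" unfolding H_def by (simp add: cls_kr h_E h_kr \<sigma>_h)
  have HV: "cinner H V = 0" unfolding H_def V_def by (simp add: cls_kr h_E h_kr v_E \<sigma>_v)
  have VH: "cinner V H = 0" using HV cinner_commute[of V H] by simp
  have V_cls: "cinner V (cls f) = br h f" if "f \<in> E" for f
    unfolding V_def using that by (simp add: cls_kr v_E v_kr)
  have H_cls: "cinner H (cls f) = \<sigma> f" if "f \<in> E" for f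
    unfolding H_def using that by (simp add: cls_kr h_E h_kr)
  \<comment> \<open>The Householder reflection along \<open>V - H\<close>, a vector of squared norm
    2: it is \<open>x\<close> minus the product of \<open>V - H\<close> with \<open>x\<close>, times
    \<open>V - H\<close>. It exchanges \<open>V\<close> and \<open>H\<close> and fixes what is
    orthogonal to both.\<close>
  define \<eta> where "\<eta> x = x - cinner V x *\<^sub>C (V - H) - cinner H x *\<^sub>C (H - V)" for x
  define P where "P x = x - cinner V x *\<^sub>C V - cinner H x *\<^sub>C H" for x
  define N where "N = {x. cinner V x = 0 \<and> cinner H x = 0}"
  note cs = cinner_add_left cinner_add_right cinner_diff_left cinner_diff_right
    cinner_scaleC_left cinner_scaleC_right VV HH HV VH
  have bo: "bounded_operator \<eta>" "bounded_operator P"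
    unfolding \<eta>_def[abs_def] P_def[abs_def]
    by (intro bounded_operator_diff bounded_operator_id bounded_operator_scaleC_cinner)+
  define B0 where "B0 = (\<lambda>x y. cinner x (\<eta> y))"
  have ext_B0: "ext B0"
    unfolding ext_def B0_def
  proof (intro conjI ballI)
    show "bounded_sesquilinear (\<lambda>x y. cinner x (\<eta> y))"
      by (rule bounded_sesquilinear_comp_right[OF bounded_sesquilinear_cinner bo(1)])
    fix f g assume f: "f \<in> E" and g: "g \<in> E"
    have "cinner (cls f) V = cnj (br h f)" "cinner (cls f) H = cnj (\<sigma> f)"
      using V_cls[OF f] H_cls[OF f] cinner_commute[of "cls f" V] cinner_commute[of "cls f" H] by auto
    then show "cinner (cls f) (\<eta> (cls g)) = br f g"
      by (simp add: \<eta>_def cs V_cls H_cls f g cls_kr br_eq_kr[OF f g])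
  qed
  have uniq: "B = B0" if "ext B" for B
    using that ext_B0 unfolding ext_def by (intro bounded_sesquilinear_eq_on_dense[OF _ _ closure]) auto
  show "\<exists>!B. ext B" using ext_B0 uniq by blast
  assume "ext B"
  then have B: "B = (\<lambda>x y. cinner x (\<eta> y))" using uniq B0_def by simp
  have \<eta>N: "\<eta> x = x" if "x \<in> N" for x using that by (simp add: N_def \<eta>_def)
  have PN: "P x \<in> N" for x by (simp add: N_def P_def cs)
  have \<eta>H: "\<eta> H = V" and \<eta>V: "\<eta> V = H"
    by (simp_all add: \<eta>_def cs)
  have lin: "linear \<eta>" "linear P"
    using bo unfolding bounded_operator_def by (auto simp: bounded_linear.linear)
  have subN: "csubspace N" by (simp add: csubspace_def N_def cs)
  have diffN: "x - y \<in> N" if "x \<in> N" "y \<in> N" for x y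
    using that by (simp add: N_def cs)
  have BN: "B x y = cinner x y" if "y \<in> N" for x y
    using that by (simp add: B \<eta>N)
  \<comment> \<open>Pythagoras for the orthonormal pair \<open>V\<close>, \<open>H\<close>. It lets
    an approximation in the whole space be projected into \<open>N\<close> without loss.\<close>
  have norm_P: "norm (P x) \<le> norm x" for x
  proof -
    have "cinner x x = cinner (P x) (P x) + cnj (cinner V x) * cinner V x + cnj (cinner H x) * cinner H x"
      using cinner_commute[of x V] cinner_commute[of x H] by (simp add: P_def cs algebra_simps)
    also have "\<dots> = complex_of_real ((norm (P x))\<^sup>2 + (norm (cinner V x))\<^sup>2 + (norm (cinner H x))\<^sup>2)"
      by (simp only: cinner_self of_real_add complex_norm_square mult.commute)
    finally have "(norm x)\<^sup>2 = (norm (P x))\<^sup>2 + (norm (cinner V x))\<^sup>2 + (norm (cinner H x))\<^sup>2"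
      unfolding cinner_self of_real_eq_iff .
    then have "(norm (P x))\<^sup>2 \<le> (norm x)\<^sup>2" by simp
    then show ?thesis by (simp add: power2_le_iff_abs_le)
  qed
  have "krein_metric B \<eta>"
    unfolding krein_metric_def
  proof (intro conjI allI)
    show "cinner (\<eta> x) y = cinner x (\<eta> y)" for x y
      using cinner_commute[of x V] cinner_commute[of x H]
      by (simp add: \<eta>_def cs algebra_simps)
    show "\<eta> (\<eta> x) = x" for x
    proof -
      have "cinner V (\<eta> x) = cinner H x" "cinner H (\<eta> x) = cinner V x"
        by (simp_all add: \<eta>_def cs)
      then have "\<eta> (\<eta> x) = \<eta> x - cinner H x *\<^sub>C (V - H) - cinner V x *\<^sub>C (H - V)"
        by (simp add: \<eta>_def[of "\<eta> x"])
      then show ?thesis by (simp add: \<eta>_def scaleC_diff_right)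
    qed
    \<comment> \<open>\<open>H - V\<close> and \<open>H + V\<close> are eigenvectors of
      \<open>\<eta>\<close> for the eigenvalues -1 and 1.\<close>
    show "\<exists>x. Re (B x x) < 0"
      by (rule exI[of _ "H - V"]) (simp add: B linear_diff[OF lin(1)] \<eta>H \<eta>V cs)
    show "\<exists>x. Re (B x x) > 0"
      by (rule exI[of _ "H + V"]) (simp add: B linear_add[OF lin(1)] \<eta>H \<eta>V cs)
  qed (simp_all add: bo B)
  moreover have "hilbert_completion perp br null N B cls"
    unfolding hilbert_completion_def
  proof (intro conjI ballI allI impI)
    show "csubspace N" by (rule subN)
    show "inner_product_on N B"
      unfolding inner_product_on_def
    proof (intro conjI ballI allI impI)
      fix x y z c assume N: "x \<in> N" "y \<in> N" "z \<in> N"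
      show "B x y = cnj (B y x)" using N cinner_commute[of x y] by (simp add: BN)
      show "B x (y + z) = B x y + B x z" using N subN
        by (simp add: BN csubspace_def cs)
      show "B x (c *\<^sub>C y) = c * B x y" using N subN
        by (simp add: BN csubspace_def cs)
      show "0 < Re (B x x)" if "x \<noteq> 0" using N that by (simp add: BN cinner_self)
    qed
    show "complete_for N B"
      unfolding complete_for_def
    proof (intro allI impI, elim conjE)
      fix X :: "nat \<Rightarrow> 'k"
      assume XN: "\<forall>n. X n \<in> N"
        and Ca: "\<forall>e>0. \<exists>M. \<forall>m\<ge>M. \<forall>n\<ge>M. Re (B (X m - X n) (X m - X n)) < e"
      \<comment> \<open>On \<open>N\<close> the form \<open>B\<close> is the inner product, so this
        is norm convergence in a complete space; the limit stays in \<open>N\<close> because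
        \<open>N\<close> is cut out by two continuous functionals.\<close>
      have "Cauchy X"
        unfolding Cauchy_def dist_norm
      proof (intro allI impI)
        fix e :: real assume "e > 0"
        then obtain M where M: "\<forall>m\<ge>M. \<forall>n\<ge>M. Re (B (X m - X n) (X m - X n)) < e\<^sup>2"
          using Ca zero_less_power[of e 2] by blast
        then have "\<forall>m\<ge>M. \<forall>n\<ge>M. (norm (X m - X n))\<^sup>2 < e\<^sup>2"
          using XN by (simp add: BN diffN cinner_self)
        then show "\<exists>M. \<forall>m\<ge>M. \<forall>n\<ge>M. norm (X m - X n) < e"
          using power_less_imp_less_base[of "norm (_ - _)" 2 e] \<open>e > 0\<close> by (meson less_imp_le)
      qed
      then obtain x where x: "X \<longlonglongrightarrow> x" using convergent_eq_Cauchy by blast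
      have xN: "x \<in> N"
      proof -
        have "(\<lambda>n. cinner u (X n)) \<longlonglongrightarrow> cinner u x" for u by (intro tendsto_intros x)
        from this[of V] this[of H] show ?thesis
          using XN by (auto simp: N_def LIMSEQ_const_iff)
      qed
      have "(\<lambda>n. cinner (X n - x) (X n - x)) \<longlonglongrightarrow> cinner (x - x) (x - x)"
        by (intro tendsto_intros x)
      then show "\<exists>x\<in>N. (\<lambda>n. B (X n - x) (X n - x)) \<longlonglongrightarrow> 0"
        using xN XN by (intro bexI[of _ x]) (auto simp: BN diffN)
    qed
  next
    fix f assume f: "f \<in> perp"
    then show "cls f \<in> N" by (auto simp: N_def perp_eq V_cls H_cls)
    show "cls f = 0 \<longleftrightarrow> f \<in> null" using f by (auto simp: perp_eq cls_null)
    show "cls (\<lambda>x. c * f x) = c *\<^sub>C cls f" for c using f by (auto simp: perp_eq cls_scale)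
    fix g assume g: "g \<in> perp"
    show "cls (\<lambda>x. f x + g x) = cls f + cls g" using f g by (auto simp: perp_eq cls_add)
    show "B (cls f) (cls g) = br f g"
      using f g \<open>ext B\<close> by (auto simp: perp_eq ext_def)
  next
    fix y and e :: real assume y: "y \<in> N" and e: "e > 0"
    obtain f where f: "f \<in> E" "norm (y - cls f) < sqrt e"
      using dense[of "sqrt e" y] e by auto
    \<comment> \<open>This lifts the projection \<open>P\<close> to functions: the components along
      \<open>v\<close> and \<open>h\<close> are subtracted before passing to classes, so the result
      lies in \<open>perp\<close>.\<close>
    define g where "g = (\<lambda>x. (f x - br h f * v x) - \<sigma> f * h x)"
    have gE: "(\<lambda>x. f x - br h f * v x) \<in> E" "g \<in> E"
      unfolding g_def using f by (auto intro!: E_diff h_E v_E)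
    have cg: "cls g = P (cls f)"
      unfolding g_def using gE f
      by (simp add: cls_diff h_E v_E P_def V_cls H_cls flip: V_def H_def)
    have "g \<in> perp"
      using PN[of "cls f"] gE by (simp add: perp_eq N_def V_cls H_cls flip: cg)
    moreover have "norm (y - cls g) < sqrt e"
    proof -
      have "P y = y" using y by (simp add: P_def N_def)
      then have "norm (y - cls g) = norm (P (y - cls f))"
        by (simp add: cg linear_diff[OF lin(2)])
      then show ?thesis using norm_P[of "y - cls f"] f by simp
    qed
    then have "(norm (y - cls g))\<^sup>2 < e"
      using e by (metis norm_ge_zero real_less_rsqrt real_sqrt_less_iff real_sqrt_unique)
    moreover have "y - cls g \<in> N" using y PN cg diffN by simp
    ultimately show "\<exists>f\<in>perp. Re (B (y - cls f) (y - cls f)) < e"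
      by (intro bexI[of _ g]) (simp_all add: BN cinner_self)
  qed
  \<comment> \<open>Null functions have class zero, so each of these images is a complex
    line.\<close>
  moreover have line: "cls ` {\<lambda>x. c * u x + f x | c f. f \<in> null} = range (\<lambda>c. c *\<^sub>C cls u)" if "u \<in> E" for u
  proof -
    have "(\<lambda>x. 0) \<in> null"
    proof -
      have "(\<lambda>x. 0) \<in> E" using E_scale[OF h_E, of 0] by simp
      moreover have "cls (\<lambda>x. 0) = 0" using cls_scale[OF h_E, of 0] by simp
      ultimately show ?thesis using cls_null by blast
    qed
    moreover have "cls (\<lambda>x. c * u x + f x) = c *\<^sub>C cls u" if "f \<in> null" for c f
      using that \<open>u \<in> E\<close> cls_null[of f] by (simp add: cls_add cls_scale E_scale null_def)
    ultimately show ?thesis by (fastforce simp: image_iff)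
  qed
  have "orthogonal_direct_sum3 N (cls ` {\<lambda>x. c * v x + f x | c f. f \<in> null})
                                 (cls ` {\<lambda>x. c * h x + f x | c f. f \<in> null})"
    unfolding line[OF v_E] line[OF h_E] V_def[symmetric] H_def[symmetric] orthogonal_direct_sum3_def
  proof (intro conjI ballI allI)
    have sub: "csubspace (range (\<lambda>c. c *\<^sub>C u))" for u :: 'k
      unfolding csubspace_def
      by (auto simp: scaleC_scaleC simp flip: scaleC_add_left intro: range_eqI[of _ _ 0])
    then show "csubspace (range (\<lambda>c. c *\<^sub>C V))" "csubspace (range (\<lambda>c. c *\<^sub>C H))" by auto
    show "csubspace N" by (rule subN)
    fix a assume "a \<in> N"
    then have "cinner a V = 0" "cinner a H = 0"
      using cinner_commute[of a V] cinner_commute[of a H] by (auto simp: N_def)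
    then show "cinner a b = 0" if "b \<in> range (\<lambda>c. c *\<^sub>C V)" for b
      using that by (auto simp: cs)
    show "cinner a b = 0" if "b \<in> range (\<lambda>c. c *\<^sub>C H)" for b
      using that \<open>cinner a H = 0\<close> by (auto simp: cs)
  next
    fix a b assume "a \<in> range (\<lambda>c. c *\<^sub>C V)" "b \<in> range (\<lambda>c. c *\<^sub>C H)"
    then show "cinner a b = 0" by (auto simp: cs)
  next
    fix x
    have "x = P x + cinner V x *\<^sub>C V + cinner H x *\<^sub>C H" by (simp add: P_def)
    then show "\<exists>a\<in>N. \<exists>b\<in>range (\<lambda>c. c *\<^sub>C V). \<exists>c\<in>range (\<lambda>c. c *\<^sub>C H). x = a + b + c"
      using PN by blast
  qed
  ultimately show "\<exists>N \<eta>.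
               krein_metric B \<eta> \<and>
               hilbert_completion perp br null N B cls \<and>
               orthogonal_direct_sum3 N (cls ` {\<lambda>x. c * v x + f x | c f. f \<in> null})
                                        (cls ` {\<lambda>x. c * h x + f x | c f. f \<in> null}) \<and>
               (\<forall>x \<in> N. \<eta> x = x) \<and>
               \<eta> (cls h) = cls v \<and>
               \<eta> (cls v) = cls h"
    using \<eta>N \<eta>H \<eta>V unfolding V_def H_def by blast
qed

end

subsection \<open>Smooth functions\<close>

lemma has_derivative_cong_open:
  assumes "open S" "p \<in> S" "\<And>q. q \<in> S \<Longrightarrow> F q = G q"
  shows "(F has_derivative D) (at p) \<longleftrightarrow> (G has_derivative D) (at p)"
proof
  assume "(F has_derivative D) (at p)"
  from has_derivative_transform_within_open[OF this assms(1,2)] show "(G has_derivative D) (at p)"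
    using assms(3) by simp
next
  assume "(G has_derivative D) (at p)"
  from has_derivative_transform_within_open[OF this assms(1,2)] show "(F has_derivative D) (at p)"
    using assms(3) by simp
qed

lemma frechet_derivative_cong_open:
  assumes "open S" "p \<in> S" "\<And>q. q \<in> S \<Longrightarrow> F q = G q"
  shows "frechet_derivative F (at p) = frechet_derivative G (at p)"
  by (simp add: frechet_derivative_def has_derivative_cong_open[OF assms])

lemma frechet_derivative_eqI: "(F has_derivative D) (at p) \<Longrightarrow> frechet_derivative F (at p) = D"
  by (rule frechet_derivative_at[symmetric])

lemma C_k_on_SucD: "C_k_on (Suc k) S F \<Longrightarrow> p \<in> S \<Longrightarrow> (F has_derivative frechet_derivative F (at p)) (at p)"
  by (simp add: frechet_derivative_works)

text \<open>Derivatives at a point of an open set see only values on that set. This permits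
  replacing a function by a formula that is valid on the chart alone.\<close>

lemma C_k_on_cong:
  assumes "open S" "\<And>p. p \<in> S \<Longrightarrow> F p = G p" "C_k_on k S F"
  shows "C_k_on k S G"
  using assms(2,3)
proof (induction k arbitrary: F G)
  case 0
  then show ?case by (simp add: continuous_on_cong[of S S F G])
next
  case (Suc k)
  have "G differentiable (at p)" if "p \<in> S" for p
    using C_k_on_SucD[OF Suc.prems(2) that] has_derivative_cong_open[of S p F G, OF assms(1) that Suc.prems(1)]
    unfolding differentiable_def by blast
  moreover have "C_k_on k S (\<lambda>p. frechet_derivative G (at p) v)" for v
  proof (rule Suc.IH)
    show "frechet_derivative F (at p) v = frechet_derivative G (at p) v" if "p \<in> S" for p
      by (simp only: frechet_derivative_cong_open[OF assms(1) that Suc.prems(1)])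
    show "C_k_on k S (\<lambda>p. frechet_derivative F (at p) v)" using Suc.prems(2) by simp
  qed
  ultimately show ?case by simp
qed

lemma C_k_on_Suc_imp: "C_k_on (Suc k) S F \<Longrightarrow> C_k_on k S F"
proof (induction k arbitrary: F)
  case 0
  have "continuous (at p within S) F" if "p \<in> S" for p
    using has_derivative_continuous[OF C_k_on_SucD[OF 0 that]] by (rule continuous_at_imp_continuous_at_within)
  then show ?case by (simp add: continuous_on_eq_continuous_within)
next
  case (Suc k)
  have "\<forall>p\<in>S. F differentiable (at p)" "\<And>v. C_k_on (Suc k) S (\<lambda>p. frechet_derivative F (at p) v)"
    using Suc.prems unfolding C_k_on.simps(2)[of "Suc k"] by blast+
  then have "\<forall>p\<in>S. F differentiable (at p)" "\<And>v. C_k_on k S (\<lambda>p. frechet_derivative F (at p) v)"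
    using Suc.IH by blast+
  then show ?case unfolding C_k_on.simps(2) by blast
qed

lemma C_k_on_SucI:
  assumes "open S" "\<And>p. p \<in> S \<Longrightarrow> (F has_derivative D p) (at p)" "\<And>v. C_k_on k S (\<lambda>p. D p v)"
  shows "C_k_on (Suc k) S F"
  unfolding C_k_on.simps
proof (intro conjI ballI allI)
  show "F differentiable (at p)" if "p \<in> S" for p using assms(2)[OF that] by (auto simp: differentiable_def)
  show "C_k_on k S (\<lambda>p. frechet_derivative F (at p) v)" for v
    using assms(2) by (intro C_k_on_cong[OF assms(1) _ assms(3)[of v]]) (metis frechet_derivative_eqI)
qed

lemma C_k_on_const: "open S \<Longrightarrow> C_k_on k S (\<lambda>p. c)"
proof (induction k arbitrary: c)
  case (Suc k)
  then show ?case by (intro C_k_on_SucI[where D = "\<lambda>p v. 0"]) auto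
qed simp

lemma C_k_on_add:
  assumes "open S" shows "C_k_on k S F \<Longrightarrow> C_k_on k S G \<Longrightarrow> C_k_on k S (\<lambda>p. F p + G p)"
proof (induction k arbitrary: F G)
  case 0
  then show ?case by (auto intro: continuous_intros)
next
  case (Suc k)
  show ?case
    by (rule C_k_on_SucI[OF assms(1) has_derivative_add[OF C_k_on_SucD[OF Suc.prems(1)] C_k_on_SucD[OF Suc.prems(2)]]])
      (use Suc in auto)
qed

text \<open>Each term of the product rule keeps one factor undifferentiated, whose order must be
  lowered by \<open>C_k_on_Suc_imp\<close> before the induction hypothesis applies. Products and
  scalar multiples are both instances.\<close>

lemma C_k_on_bilinear:
  assumes "open S" "bounded_bilinear B"
  shows "C_k_on k S F \<Longrightarrow> C_k_on k S G \<Longrightarrow> C_k_on k S (\<lambda>p. B (F p) (G p))"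
proof (induction k arbitrary: F G)
  case 0
  then show ?case using assms(2) by (auto intro: bounded_bilinear.continuous_on)
next
  case (Suc k)
  note d = bounded_bilinear.FDERIV[OF assms(2) C_k_on_SucD[OF Suc.prems(1)] C_k_on_SucD[OF Suc.prems(2)]]
  show ?case
    by (rule C_k_on_SucI[OF assms(1) d])
      (use Suc in \<open>auto intro!: C_k_on_add[OF assms(1)] Suc.IH C_k_on_Suc_imp[of k S F] C_k_on_Suc_imp[of k S G]\<close>)
qed

text \<open>The two functions are each other's derivatives up to sign, hence the simultaneous
  induction. The cosine occurs in the conformal factor of the d'Alembertian.\<close>

lemma C_k_on_cos_sin:
  assumes "open S" shows "C_k_on k S (\<lambda>p. cos (fst p :: real)) \<and> C_k_on k S (\<lambda>p. sin (fst p :: real))"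
proof (induction k)
  case 0
  then show ?case by (auto intro!: continuous_intros)
next
  case (Suc k)
  note mult = C_k_on_bilinear[OF assms bounded_bilinear_mult]
  have *: "C_k_on k S (\<lambda>p. sin (fst p) * c)" "C_k_on k S (\<lambda>p. cos (fst p) * c)" for c :: real
    using Suc by (auto intro!: mult C_k_on_const[OF assms])
  have **: "C_k_on k S (\<lambda>p. - (sin (fst p) * c))" for c :: real
    using *(1)[of "- c"] by simp
  have "C_k_on (Suc k) S (\<lambda>p. cos (fst p))"
    by (rule C_k_on_SucI[OF assms, where D = "\<lambda>p v. sin (fst p) * (- fst v)"])
      (use ** in \<open>auto intro!: derivative_eq_intros\<close>)
  moreover have "C_k_on (Suc k) S (\<lambda>p. sin (fst p))"
    by (rule C_k_on_SucI[OF assms, where D = "\<lambda>p v. cos (fst p) * fst v"])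
      (use * in \<open>auto intro!: derivative_eq_intros\<close>)
  ultimately show ?case by blast
qed

definition smooth_on :: "'a::real_normed_vector set \<Rightarrow> ('a \<Rightarrow> 'b::real_normed_vector) \<Rightarrow> bool" where
  "smooth_on S F \<longleftrightarrow> (\<forall>k. C_k_on k S F)"

lemma smooth_on_continuous: "smooth_on S F \<Longrightarrow> continuous_on S F"
  unfolding smooth_on_def by (metis C_k_on.simps(1))

lemma smooth_on_has_derivative:
  "smooth_on S F \<Longrightarrow> p \<in> S \<Longrightarrow> (F has_derivative frechet_derivative F (at p)) (at p)"
  unfolding smooth_on_def using C_k_on_SucD by blast

lemma smooth_on_pdiff: "smooth_on S F \<Longrightarrow> smooth_on S (pdiff i F)"
  unfolding smooth_on_def pdiff_def by (metis C_k_on.simps(2))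

lemma smooth_on_add: "open S \<Longrightarrow> smooth_on S F \<Longrightarrow> smooth_on S G \<Longrightarrow> smooth_on S (\<lambda>p. F p + G p)"
  unfolding smooth_on_def by (simp add: C_k_on_add)

lemma smooth_on_bilinear:
  "open S \<Longrightarrow> bounded_bilinear B \<Longrightarrow> smooth_on S F \<Longrightarrow> smooth_on S G \<Longrightarrow> smooth_on S (\<lambda>p. B (F p) (G p))"
  unfolding smooth_on_def by (simp add: C_k_on_bilinear)

lemma smooth_on_const: "open S \<Longrightarrow> smooth_on S (\<lambda>p. c)"
  unfolding smooth_on_def by (simp add: C_k_on_const)

lemma smooth_on_cong: "open S \<Longrightarrow> (\<And>p. p \<in> S \<Longrightarrow> F p = G p) \<Longrightarrow> smooth_on S F \<Longrightarrow> smooth_on S G"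
  unfolding smooth_on_def using C_k_on_cong by blast

lemma pdiff_cong_open:
  "open S \<Longrightarrow> p \<in> S \<Longrightarrow> (\<And>q. q \<in> S \<Longrightarrow> F q = G q) \<Longrightarrow> pdiff i F p = pdiff i G p"
  unfolding pdiff_def using frechet_derivative_cong_open by metis

lemma pdiff_eqI: "(F has_derivative D) (at p) \<Longrightarrow> pdiff i F p = D (unit_vec i)"
  unfolding pdiff_def by (simp add: frechet_derivative_eqI)

subsection \<open>The conformal chart\<close>

lemma open_chart_dom: "open chart_dom"
  unfolding chart_dom_def by (intro open_Times) auto

lemma chart_dom_iff: "p \<in> chart_dom \<longleftrightarrow> \<bar>fst p\<bar> < pi / 2"
  by (cases p) (auto simp: chart_dom_def)

lemma cos_chart_dom: "p \<in> chart_dom \<Longrightarrow> cos (fst p) > 0"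
  by (auto simp: chart_dom_iff intro: cos_gt_zero_pi)

lemma param_has_derivative:
  fixes R :: real
  assumes "cos (fst p) \<noteq> 0"
  shows "(param R has_derivative (\<lambda>v. vector [R * fst v / (cos (fst p))\<^sup>2,
      R * cos (snd p) * sin (fst p) * fst v / (cos (fst p))\<^sup>2 - R * sin (snd p) * snd v / cos (fst p),
      R * sin (snd p) * sin (fst p) * fst v / (cos (fst p))\<^sup>2 + R * cos (snd p) * snd v / cos (fst p)])) (at p)"
proof -
  have 1: "((\<lambda>p. R * tan (fst p)) has_derivative (\<lambda>v. R * fst v / (cos (fst p))\<^sup>2)) (at p)"
    using assms by (auto intro!: derivative_eq_intros simp: field_simps)
  have 2: "((\<lambda>p. R * cos (snd p) / cos (fst p)) has_derivative
      (\<lambda>v. R * cos (snd p) * sin (fst p) * fst v / (cos (fst p))\<^sup>2 - R * sin (snd p) * snd v / cos (fst p))) (at p)"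
    using assms by (auto intro!: derivative_eq_intros simp: field_simps power2_eq_square)
  have 3: "((\<lambda>p. R * sin (snd p) / cos (fst p)) has_derivative
      (\<lambda>v. R * sin (snd p) * sin (fst p) * fst v / (cos (fst p))\<^sup>2 + R * cos (snd p) * snd v / cos (fst p))) (at p)"
    using assms by (auto intro!: derivative_eq_intros simp: field_simps power2_eq_square)
  \<comment> \<open>Written as a combination of axis vectors, the map can be differentiated
    component by component.\<close>
  have vec: "vector [a, b, c] = a *\<^sub>R axis 1 1 + b *\<^sub>R axis 2 1 + c *\<^sub>R (axis 3 1 :: real ^ 3)"
    for a b c :: real
    by (simp add: vec_eq_iff forall_3 axis_def)
  show ?thesis
    unfolding param_def[abs_def] vec
    by (intro has_derivative_add has_derivative_scaleR_left 1 2 3)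
qed

lemma pdiff_param:
  fixes R :: real
  assumes "p \<in> chart_dom"
  shows "pdiff 1 (param R) p = vector [R / (cos (fst p))\<^sup>2, R * cos (snd p) * sin (fst p) / (cos (fst p))\<^sup>2,
            R * sin (snd p) * sin (fst p) / (cos (fst p))\<^sup>2]"
    and "pdiff 2 (param R) p = vector [0, - (R * sin (snd p) / cos (fst p)), R * cos (snd p) / cos (fst p)]"
proof -
  have c: "cos (fst p) \<noteq> 0" using cos_chart_dom[OF assms] by simp
  show "pdiff 1 (param R) p = vector [R / (cos (fst p))\<^sup>2, R * cos (snd p) * sin (fst p) / (cos (fst p))\<^sup>2,
            R * sin (snd p) * sin (fst p) / (cos (fst p))\<^sup>2]"
    by (subst pdiff_eqI[OF param_has_derivative[OF c]]) (simp add: unit_vec_def)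
  show "pdiff 2 (param R) p = vector [0, - (R * sin (snd p) / cos (fst p)), R * cos (snd p) / cos (fst p)]"
    by (subst pdiff_eqI[OF param_has_derivative[OF c]]) (simp add: unit_vec_def)
qed

text \<open>The metric is \<open>R\<^sup>2 / (cos \<tau>)\<^sup>2\<close> times the flat one, which
  is what makes the chart conformal. Below, \<open>K\<close> and \<open>L\<close> hide the
  divisions, so that \<open>algebra\<close> meets polynomials.\<close>

lemma metric_chart:
  assumes p: "p \<in> chart_dom"
  shows "metric R p $ 1 $ 1 = R\<^sup>2 / (cos (fst p))\<^sup>2" "metric R p $ 2 $ 2 = - (R\<^sup>2 / (cos (fst p))\<^sup>2)"
    "metric R p $ 1 $ 2 = 0" "metric R p $ 2 $ 1 = 0"
proof -
  have c: "cos (fst p) \<noteq> 0" using cos_chart_dom[OF p] by simp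
  define K where "K = R / (cos (fst p))\<^sup>2"
  define L where "L = R / cos (fst p)"
  show "metric R p $ 1 $ 1 = R\<^sup>2 / (cos (fst p))\<^sup>2"
  proof -
    have e: "R * x * y / (cos (fst p))\<^sup>2 = K * x * y" for x y by (simp add: K_def)
    have "metric R p $ 1 $ 1 = K * K - (K * cos (snd p) * sin (fst p)) * (K * cos (snd p) * sin (fst p))
        - (K * sin (snd p) * sin (fst p)) * (K * sin (snd p) * sin (fst p))"
      unfolding metric_def vec_lambda_beta mink_def pdiff_param[OF p] vector_3 e by (simp only: K_def)
    also have "\<dots> = K\<^sup>2 * (1 - ((cos (snd p))\<^sup>2 + (sin (snd p))\<^sup>2) * (sin (fst p))\<^sup>2)"
      by algebra
    also have "\<dots> = K\<^sup>2 * (cos (fst p))\<^sup>2" by (simp add: cos_squared_eq)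
    also have "\<dots> = R\<^sup>2 / (cos (fst p))\<^sup>2"
      using c by (simp add: K_def power2_eq_square)
    finally show ?thesis .
  qed
  show "metric R p $ 2 $ 2 = - (R\<^sup>2 / (cos (fst p))\<^sup>2)"
  proof -
    have e: "R * x / cos (fst p) = L * x" for x by (simp add: L_def)
    have "metric R p $ 2 $ 2 = 0 * 0 - (- (L * sin (snd p))) * (- (L * sin (snd p)))
        - (L * cos (snd p)) * (L * cos (snd p))"
      unfolding metric_def vec_lambda_beta mink_def pdiff_param[OF p] vector_3 e by (rule refl)
    also have "\<dots> = - (L\<^sup>2 * ((cos (snd p))\<^sup>2 + (sin (snd p))\<^sup>2))"
      by algebra
    finally show ?thesis by (simp add: L_def power_divide)
  qed
  show "metric R p $ 1 $ 2 = 0" "metric R p $ 2 $ 1 = 0"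
    unfolding metric_def vec_lambda_beta mink_def pdiff_param[OF p] vector_3 by simp_all
qed

lemma vol_density_chart:
  assumes p: "p \<in> chart_dom"
  shows "vol_density R p = R\<^sup>2 / (cos (fst p))\<^sup>2"
proof -
  have "\<bar>det (metric R p)\<bar> = (R\<^sup>2 / (cos (fst p))\<^sup>2)\<^sup>2"
    by (simp add: det_2 metric_chart[OF p] power2_eq_square)
  then show ?thesis by (simp add: vol_density_def)
qed

lemma matrix_inv_metric_chart:
  assumes R: "R > 0" and p: "p \<in> chart_dom"
  shows "matrix_inv (metric R p) =
    (\<chi> i j. if i = j then (if i = 1 then (cos (fst p))\<^sup>2 / R\<^sup>2 else - ((cos (fst p))\<^sup>2 / R\<^sup>2)) else 0)" (is "_ = ?D")
proof -
  have c: "cos (fst p) \<noteq> 0" using cos_chart_dom[OF p] by simp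
  have 1: "metric R p ** ?D = mat 1"
    using R c by (simp add: vec_eq_iff forall_2 matrix_matrix_mult_def sum_2 metric_chart[OF p] mat_def)
  have 2: "?D ** metric R p = mat 1"
    using R c by (simp add: vec_eq_iff forall_2 matrix_matrix_mult_def sum_2 metric_chart[OF p] mat_def)
  \<comment> \<open>\<open>matrix_inv\<close> is a Hilbert choice: the explicit inverse shows that
    the choice succeeds, and uniqueness of inverses then identifies it.\<close>
  have inv: "metric R p ** matrix_inv (metric R p) = mat 1 \<and> matrix_inv (metric R p) ** metric R p = mat 1"
    unfolding matrix_inv_def by (rule someI[of _ ?D]) (intro conjI 1 2)
  have "matrix_inv (metric R p) = matrix_inv (metric R p) ** (metric R p ** ?D)"
    unfolding 1 by simp
  also have "\<dots> = ?D"
    unfolding matrix_mul_assoc inv[THEN conjunct2] by simp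
  finally show ?thesis .
qed

definition wave :: "(real \<times> real \<Rightarrow> complex) \<Rightarrow> real \<times> real \<Rightarrow> complex" where
  "wave F p = pdiff 1 (pdiff 1 F) p - pdiff 2 (pdiff 2 F) p"

lemma smooth_on_wave:
  assumes "open S" "smooth_on S F" shows "smooth_on S (wave F)"
proof -
  have "smooth_on S (\<lambda>p. pdiff 1 (pdiff 1 F) p + (-1) * pdiff 2 (pdiff 2 F) p)"
    by (intro smooth_on_add smooth_on_bilinear[OF _ bounded_bilinear_mult] smooth_on_const
        smooth_on_pdiff assms)
  then show ?thesis by (simp add: wave_def[abs_def])
qed

lemma continuous_on_param: "continuous_on chart_dom (param R)" for R :: real
proof -
  have "isCont (param R) p" if "p \<in> chart_dom" for p
    using cos_chart_dom[OF that] by (intro has_derivative_continuous[OF param_has_derivative]) simp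
  then show ?thesis by (simp add: continuous_at_imp_continuous_on)
qed

lemma param_eq_iff:
  fixes R :: real
  assumes "R > 0" "p \<in> chart_dom" "q \<in> chart_dom"
  shows "param R p = param R q \<longleftrightarrow> fst p = fst q \<and> (\<exists>n::int. snd p = snd q + 2 * pi * n)"
proof
  assume eq: "param R p = param R q"
  have "tan (fst p) = tan (fst q)"
    using arg_cong[OF eq, of "\<lambda>x. x $ 1"] assms by (simp add: param_def)
  moreover have "arctan (tan (fst x)) = fst x" if "x \<in> chart_dom" for x
    using that by (intro arctan_tan) (auto simp: chart_dom_iff)
  ultimately have 1: "fst p = fst q" using assms(2,3) by metis
  have "cos (snd p) = cos (snd q)" "sin (snd p) = sin (snd q)"
    using arg_cong[OF eq, of "\<lambda>x. x $ 2"] arg_cong[OF eq, of "\<lambda>x. x $ 3"] assms(1) cos_chart_dom[OF assms(3)]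
    by (simp_all add: param_def 1)
  then show "fst p = fst q \<and> (\<exists>n::int. snd p = snd q + 2 * pi * n)"
    using 1 sin_cos_eq_iff[THEN iffD1, OF conjI] by blast
next
  assume "fst p = fst q \<and> (\<exists>n::int. snd p = snd q + 2 * pi * n)"
  moreover then have "sin (snd p) = sin (snd q)" "cos (snd p) = cos (snd q)"
    using sin_cos_eq_iff[of "snd p" "snd q"] by blast+
  ultimately show "param R p = param R q" by (simp add: param_def)
qed

lemma param_periodic:
  fixes R :: real shows "param R (x + (0, 2 * pi * of_int n)) = param R x"
proof -
  have "sin (snd x + 2 * pi * n) = sin (snd x) \<and> cos (snd x + 2 * pi * n) = cos (snd x)"
    unfolding sin_cos_eq_iff by blast
  then show ?thesis by (simp add: param_def)
qed

lemma pdiff_periodic: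
  assumes "\<And>q. F (q + c) = F q"
  shows "pdiff i F (p + c) = pdiff i F p"
proof -
  have "(F has_derivative D) (at (p + c)) \<longleftrightarrow> (F has_derivative D) (at p)" for D
  proof -
    have "(F has_derivative D) (at (p + c)) \<longleftrightarrow> ((\<lambda>q. F (q + c)) has_derivative D) (at p)"
    proof
      assume "(F has_derivative D) (at (p + c))"
      then have "(F \<circ> (\<lambda>q. q + c) has_derivative D \<circ> (\<lambda>v. v)) (at p)"
        by (intro diff_chain_at) (auto intro!: derivative_eq_intros)
      then show "((\<lambda>q. F (q + c)) has_derivative D) (at p)" by (simp add: o_def)
    next
      assume "((\<lambda>q. F (q + c)) has_derivative D) (at p)"
      then have "((\<lambda>q. F (q + c)) \<circ> (\<lambda>q. q - c) has_derivative D \<circ> (\<lambda>v. v)) (at (p + c))"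
        by (intro diff_chain_at) (auto intro!: derivative_eq_intros)
      then show "(F has_derivative D) (at (p + c))" by (simp add: o_def)
    qed
    then show ?thesis by (simp add: assms)
  qed
  then show ?thesis by (simp add: pdiff_def frechet_derivative_def)
qed

lemma pdiff_scaleR:
  assumes "F differentiable at p"
  shows "pdiff i (\<lambda>q. c *\<^sub>R F q) p = c *\<^sub>R pdiff i F p"
proof -
  have "(F has_derivative frechet_derivative F (at p)) (at p)"
    using assms by (simp add: frechet_derivative_works)
  from has_derivative_scaleR_right[OF this, of c] show ?thesis
    by (simp add: pdiff_eqI) (simp add: pdiff_def)
qed

lemma wave_periodic:
  assumes "\<And>q. F (q + c) = F q"
  shows "wave F (p + c) = wave F p"
  unfolding wave_def by (simp add: pdiff_periodic assms)

text \<open>In dimension two the density cancels the conformal factor of the inverse metric, and the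
  flat wave operator divided by the density remains. The preimage chosen in
  \<open>dAlembertian\<close> may differ from \<open>p\<close> by a multiple of 2 pi in \<theta>,
  which periodicity absorbs.\<close>

lemma dAlembertian_param:
  assumes R: "R > 0" and F: "smooth_on chart_dom (\<lambda>q. f (param R q))" and p: "p \<in> chart_dom"
  shows "dAlembertian R f (param R p) = ((cos (fst p))\<^sup>2 / R\<^sup>2) *\<^sub>R wave (\<lambda>q. f (param R q)) p"
proof -
  let ?F = "\<lambda>q. f (param R q)"
  define q where "q = inv_into chart_dom (param R) (param R p)"
  have q: "q \<in> chart_dom" and eq: "param R q = param R p"
    unfolding q_def using p by (auto intro: inv_into_into f_inv_into_f)
  obtain n :: int where n: "fst p = fst q" "snd p = snd q + 2 * pi * n"
    using eq param_eq_iff[OF R p q] by auto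
  have pq: "p = q + (0, 2 * pi * n)" using n by (simp add: prod_eq_iff)
  have per: "?F (x + (0, 2 * pi * n)) = ?F x" for x
    by (simp add: param_periodic)
  have wq: "wave ?F p = wave ?F q"
    unfolding pq by (rule wave_periodic[of ?F, OF per])
  have c: "cos (fst x) \<noteq> 0" if "x \<in> chart_dom" for x using cos_chart_dom[OF that] by simp
  have coef: "vol_density R x * matrix_inv (metric R x) $ i $ j = (if i = j then (if i = 1 then 1 else -1) else 0)"
    if "x \<in> chart_dom" for x i j
    using R c[OF that] by (simp add: vol_density_chart[OF that] matrix_inv_metric_chart[OF R that])
  have summand: "pdiff i (\<lambda>q. (vol_density R q * matrix_inv (metric R q) $ i $ j) *\<^sub>R pdiff j ?F q) q =
    (if i = j then (if i = 1 then 1 else -1) else 0) *\<^sub>R pdiff i (pdiff j ?F) q" for i j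
  proof -
    have "pdiff i (\<lambda>q. (vol_density R q * matrix_inv (metric R q) $ i $ j) *\<^sub>R pdiff j ?F q) q
      = pdiff i (\<lambda>q. (if i = j then (if i = 1 then 1 else -1) else 0) *\<^sub>R pdiff j ?F q) q"
      by (rule pdiff_cong_open[OF open_chart_dom q]) (simp only: coef)
    also have "\<dots> = (if i = j then (if i = 1 then 1 else -1) else 0) *\<^sub>R pdiff i (pdiff j ?F) q"
      using smooth_on_has_derivative[OF smooth_on_pdiff[OF F] q]
      by (intro pdiff_scaleR) (auto simp: differentiable_def)
    finally show ?thesis .
  qed
  have "param R p \<in> dS R" using param_image[OF R] p by auto
  then have "dAlembertian R f (param R p) = wave ?F q /\<^sub>R vol_density R q"
    unfolding dAlembertian_def Let_def q_def[symmetric] summand by (simp add: sum_2 wave_def)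
  then show ?thesis
    using R n(1) by (simp add: wq vol_density_chart[OF q] inverse_eq_divide)
qed

subsection \<open>Test functions\<close>

lemma test_function_smooth: "f \<in> test_functions R \<Longrightarrow> smooth_on chart_dom (\<lambda>p. f (param R p))"
  by (simp add: test_functions_def smooth_on_def)

lemma test_functions_iff:
  "f \<in> test_functions R \<longleftrightarrow> smooth_on chart_dom (\<lambda>p. f (param R p)) \<and>
     (\<exists>K. compact K \<and> K \<subseteq> dS R \<and> (\<forall>x. x \<notin> K \<longrightarrow> f x = 0))"
  by (simp add: test_functions_def smooth_on_def)

lemma test_functions_add:
  assumes "f \<in> test_functions R" "g \<in> test_functions R"
  shows "(\<lambda>x. f x + g x) \<in> test_functions R"
proof -
  obtain K L where "compact K" "K \<subseteq> dS R" "\<forall>x. x \<notin> K \<longrightarrow> f x = 0"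
    "compact L" "L \<subseteq> dS R" "\<forall>x. x \<notin> L \<longrightarrow> g x = 0"
    using assms unfolding test_functions_iff by blast
  then show ?thesis
    using assms unfolding test_functions_iff
    by (auto intro!: smooth_on_add open_chart_dom exI[of _ "K \<union> L"] compact_Un)
qed

lemma test_functions_scale:
  assumes "f \<in> test_functions R"
  shows "(\<lambda>x. c * f x) \<in> test_functions R"
  using assms unfolding test_functions_iff
  by (auto intro!: smooth_on_bilinear[OF open_chart_dom bounded_bilinear_mult] smooth_on_const open_chart_dom)

lemma test_functions_dAlembertian:
  assumes R: "R > 0" and f: "f \<in> test_functions R"
  shows "dAlembertian R f \<in> test_functions R"
proof -
  let ?F = "\<lambda>q. f (param R q)"
  have F: "smooth_on chart_dom ?F" using f by (rule test_function_smooth)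
  obtain K where K: "compact K" "K \<subseteq> dS R" "\<And>x. x \<notin> K \<Longrightarrow> f x = 0"
    using f unfolding test_functions_iff by blast
  have "smooth_on chart_dom (\<lambda>p. (1 / R\<^sup>2 * (cos (fst p) * cos (fst p))) *\<^sub>R wave ?F p)"
    using C_k_on_cos_sin[OF open_chart_dom]
    by (intro smooth_on_bilinear[OF _ bounded_bilinear_scaleR] smooth_on_bilinear[OF _ bounded_bilinear_mult]
        smooth_on_const smooth_on_wave F open_chart_dom) (auto simp: smooth_on_def)
  then have "smooth_on chart_dom (\<lambda>p. dAlembertian R f (param R p))"
    by (rule smooth_on_cong[OF open_chart_dom, rotated])
      (simp add: dAlembertian_param[OF R F] power2_eq_square)
  moreover have "dAlembertian R f x = 0" if x: "x \<notin> K" for x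
  proof (cases "x \<in> dS R")
    case True
    then obtain p where p: "p \<in> chart_dom" "x = param R p"
      unfolding param_image[OF R, symmetric] by (rule imageE)
    \<comment> \<open>The complement of \<open>K\<close> is open, so \<open>f\<close> vanishes on a
      whole neighbourhood of \<open>p\<close> in the chart, and all derivatives vanish with
      it.\<close>
    define S where "S = chart_dom \<inter> param R -` (- K)"
    have S: "open S" unfolding S_def
      using K(1) by (intro continuous_open_preimage continuous_on_param open_chart_dom) (simp add: compact_imp_closed open_Compl)
    have pS: "p \<in> S" using p x by (simp add: S_def)
    have z: "pdiff i (\<lambda>q. 0) q = (0::complex)" for i q
      using pdiff_eqI[OF has_derivative_const] .
    have 1: "pdiff i ?F q = 0" if "q \<in> S" for i q
    proof -
      have "pdiff i ?F q = pdiff i (\<lambda>q. 0) q"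
        by (rule pdiff_cong_open[OF S that]) (auto simp: S_def K)
      then show ?thesis by (simp add: z)
    qed
    have 2: "pdiff i (pdiff j ?F) p = 0" for i j
    proof -
      have "pdiff i (pdiff j ?F) p = pdiff i (\<lambda>q. 0) p"
        by (rule pdiff_cong_open[OF S pS]) (rule 1)
      then show ?thesis by (simp add: z)
    qed
    show ?thesis
      unfolding p(2) dAlembertian_param[OF R F p(1)] by (simp add: wave_def 2)
  qed (simp add: dAlembertian_def)
  ultimately show ?thesis
    unfolding test_functions_iff using K by blast
qed

text \<open>A compact set bounds the time component \<open>R * tan \<tau>\<close>, which keeps
  \<tau> away from both edges of the chart.\<close>

lemma test_function_support:
  assumes R: "R > 0" and f: "f \<in> test_functions R"
  obtains a where "0 < a" "a < pi / 2" "\<And>p. p \<in> chart_dom \<Longrightarrow> a \<le> \<bar>fst p\<bar> \<Longrightarrow> f (param R p) = 0"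
proof -
  obtain K where K: "compact K" "K \<subseteq> dS R" "\<And>x. x \<notin> K \<Longrightarrow> f x = 0"
    using f unfolding test_functions_iff by blast
  obtain M where M: "M > 0" "\<And>x. x \<in> K \<Longrightarrow> norm x \<le> M"
    using compact_imp_bounded[OF K(1)] bounded_pos by blast
  \<comment> \<open>With \<open>M + 1\<close> in place of \<open>M\<close>, a point of
    \<open>K\<close> beyond \<open>a\<close> would have a time component of at least
    \<open>M + 1\<close>, contradicting the bound \<open>M\<close>.\<close>
  define a where "a = arctan ((M + 1) / R)"
  have a: "0 < a" "a < pi / 2" "tan a = (M + 1) / R"
    using arctan[of "(M + 1) / R"] R M by (auto simp: a_def zero_less_arctan_iff)
  have "f (param R p) = 0" if p: "p \<in> chart_dom" "a \<le> \<bar>fst p\<bar>" for p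
  proof (rule K(3), rule notI)
    assume "param R p \<in> K"
    then have "\<bar>param R p $ 1\<bar> \<le> M"
      using M(2) component_le_norm_cart[of "param R p" 1] by fastforce
    then have "R * \<bar>tan (fst p)\<bar> \<le> M" using R by (simp add: param_def abs_mult)
    moreover have "tan a \<le> tan \<bar>fst p\<bar>"
      using a p by (intro tan_mono_le) (auto simp: chart_dom_iff)
    moreover have "tan \<bar>fst p\<bar> \<le> \<bar>tan (fst p)\<bar>" by (simp add: abs_if)
    ultimately have "R * ((M + 1) / R) \<le> M" using R a(3) by (smt (verit) mult_left_mono)
    then show False using R by simp
  qed
  then show thesis using that a by blast
qed

subsection \<open>Integration over de Sitter space\<close>

abbreviation (input) fund_dom :: "(real \<times> real) set" where
  "fund_dom \<equiv> {- (pi / 2) <..< pi / 2} \<times> {0 ..< 2 * pi}"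

text \<open>The compact domain for calculus. On the support of an integrand it differs from the
  half-open fundamental domain only by the null line \<theta> = 2 pi.\<close>

abbreviation (input) rectangle :: "real \<Rightarrow> (real \<times> real) set" where
  "rectangle a \<equiv> cbox (- a, 0) (a, 2 * pi)"

lemma fund_dom_sets: "fund_dom \<in> sets borel"
proof -
  have "open ({- (pi / 2) <..< pi / 2} \<times> (UNIV :: real set))"
    "closed ((UNIV :: real set) \<times> {0 :: real..})" "closed ((UNIV :: real set) \<times> {2 * pi..})"
    by (simp_all add: open_Times closed_Times)
  then have "({- (pi / 2) <..< pi / 2} \<times> UNIV) \<inter> (UNIV \<times> {0..}) - UNIV \<times> {2 * pi..} \<in> sets borel"
    by (intro sets.Diff sets.Int) (simp_all add: borel_open borel_closed)
  also have "({- (pi / 2) <..< pi / 2} \<times> UNIV) \<inter> (UNIV \<times> {0..}) - UNIV \<times> {2 * pi..} = fund_dom"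
    by auto
  finally show ?thesis .
qed

lemma fund_dom_subset: "fund_dom \<subseteq> chart_dom"
  by (auto simp: chart_dom_def)

lemma space_dsigma: "space (dsigma R) = fund_dom"
  by (simp add: dsigma_def space_restrict_space)

lemma space_dsigma_chart: "p \<in> space (dsigma R) \<Longrightarrow> p \<in> chart_dom"
  using fund_dom_subset unfolding space_dsigma by blast

lemma measurable_chart:
  assumes "continuous_on chart_dom \<phi>"
  shows "\<phi> \<in> borel_measurable (restrict_space lborel fund_dom)"
proof -
  have "\<phi> \<in> borel_measurable (restrict_space borel fund_dom)"
    by (intro borel_measurable_continuous_on_restrict continuous_on_subset[OF assms fund_dom_subset])
  moreover have "sets (restrict_space lborel fund_dom) = sets (restrict_space borel fund_dom)"
    by (rule sets_restrict_space_cong) simp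
  ultimately show ?thesis using measurable_cong_sets[OF _ refl] by blast
qed

lemma measurable_dsigma:
  assumes "continuous_on chart_dom \<phi>"
  shows "\<phi> \<in> borel_measurable (dsigma R)"
  using measurable_chart[OF assms] by (simp add: dsigma_def)

lemma continuous_on_vol_density: "continuous_on chart_dom (vol_density R)"
proof -
  have "continuous_on chart_dom (\<lambda>p. R\<^sup>2 / (cos (fst p))\<^sup>2)"
    using cos_chart_dom by (intro continuous_intros) fastforce
  then show ?thesis by (simp add: vol_density_chart cong: continuous_on_cong)
qed

lemma sigma_finite_dsigma: "sigma_finite_measure (dsigma R)"
proof -
  interpret sigma_finite_measure "restrict_space lborel fund_dom"
    by (rule sigma_finite_measure_restrict_space)
      (use fund_dom_sets sigma_finite_lborel in auto)
  have "(\<lambda>p. ennreal (vol_density R p)) \<in> borel_measurable (restrict_space lborel fund_dom)"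
    using measurable_chart[OF continuous_on_vol_density] by measurable
  then show ?thesis
    unfolding dsigma_def by (subst sigma_finite_iff_density_finite) auto
qed

lemma AE_snd_neq: "AE p in lborel. snd (p :: real \<times> real) \<noteq> c"
proof -
  have "{p :: real \<times> real. snd p = c} = {p. p \<bullet> (0, 1) = c}" by (simp add: inner_prod_def)
  moreover have "negligible {p :: real \<times> real. p \<bullet> (0, 1) = c}"
    by (intro negligible_standard_hyperplane) (simp add: Basis_prod_def)
  ultimately have n: "negligible {p :: real \<times> real. snd p = c}" by simp
  have "closed {p :: real \<times> real. snd p = c}"
    by (intro closed_Collect_eq continuous_intros)
  then have "{p :: real \<times> real. snd p = c} \<in> null_sets lborel"
    using n unfolding negligible_iff_null_sets by (subst (asm) null_sets_completion_iff) auto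
  then show ?thesis by (intro AE_I'[where N = "{p. snd p = c}"]) auto
qed

lemma rectangle_subset: "a < pi / 2 \<Longrightarrow> rectangle a \<subseteq> chart_dom"
  by (auto simp: chart_dom_def)

text \<open>The bridge from the Lebesgue integral to the gauge integral: the density moves into the
  integrand, and the two domains agree almost everywhere on the support of \<open>G\<close>.\<close>

lemma dsigma_integral:
  fixes G :: "real \<times> real \<Rightarrow> 'b::euclidean_space"
  assumes G: "continuous_on chart_dom G" and a: "a < pi / 2"
    and supp: "\<And>p. p \<in> chart_dom \<Longrightarrow> a \<le> \<bar>fst p\<bar> \<Longrightarrow> G p = 0"
  shows "integrable (dsigma R) G"
    and "(LINT p|dsigma R. G p) = integral (rectangle a) (\<lambda>p. vol_density R p *\<^sub>R G p)"
proof -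
  define w where "w p = vol_density R p *\<^sub>R G p" for p
  have w: "continuous_on chart_dom w"
    unfolding w_def by (intro continuous_intros continuous_on_vol_density G)
  have vpos: "vol_density R p \<ge> 0" for p by (simp add: vol_density_def)
  have fs: "fund_dom \<inter> space lborel \<in> sets lborel" using fund_dom_sets by simp
  have iw: "integrable lborel (\<lambda>p. indicator (rectangle a) p *\<^sub>R w p)"
    by (intro borel_integrable_compact continuous_on_subset[OF w rectangle_subset[OF a]]) simp
  have mw: "(\<lambda>p. indicator fund_dom p *\<^sub>R w p) \<in> borel_measurable lborel"
    using measurable_chart[OF w] borel_measurable_restrict_space_iff[OF fs, of w]
    by (simp add: scaleR_conv_of_real mult.commute)
  have ae: "AE p in lborel. indicator fund_dom p *\<^sub>R w p = indicator (rectangle a) p *\<^sub>R w p"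
    using AE_snd_neq[of "2 * pi"]
  proof eventually_elim
    case (elim p)
    have "w p = 0" if "p \<in> fund_dom" "p \<notin> rectangle a"
    proof -
      have "p \<in> chart_dom" using that(1) fund_dom_subset by blast
      moreover have "a \<le> \<bar>fst p\<bar>" using that by (cases p) auto
      ultimately show ?thesis by (simp add: w_def supp)
    qed
    moreover have "p \<in> fund_dom" if "p \<in> rectangle a"
      using that a elim by (cases p) auto
    ultimately show ?case by (auto simp: indicator_def)
  qed
  have "integrable lborel (\<lambda>p. indicator fund_dom p *\<^sub>R w p)"
    using iw ae mw by (subst integrable_cong_AE[of _ _ "\<lambda>p. indicator (rectangle a) p *\<^sub>R w p"]) auto
  then have ir: "integrable (restrict_space lborel fund_dom) w"
    by (subst integrable_restrict_space[OF fs])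
  then show "integrable (dsigma R) G"
    unfolding dsigma_def
    by (subst integrable_density) (use measurable_chart[OF G] measurable_chart[OF continuous_on_vol_density] vpos
        in \<open>auto simp: w_def[abs_def]\<close>)
  have "(LINT p|dsigma R. G p) = (LINT p|restrict_space lborel fund_dom. w p)"
    unfolding dsigma_def w_def
    by (subst integral_density) (use measurable_chart[OF G] measurable_chart[OF continuous_on_vol_density] vpos in auto)
  also have "\<dots> = (LINT p|lborel. indicator fund_dom p *\<^sub>R w p)"
    by (rule integral_restrict_space[OF fs])
  also have "\<dots> = (LINT p|lborel. indicator (rectangle a) p *\<^sub>R w p)"
    using iw ae mw by (intro integral_cong_AE) auto
  also have "\<dots> = integral (rectangle a) w"
    using set_borel_integral_eq_integral(2)[of "rectangle a" w] iw
    by (simp add: set_integrable_def set_lebesgue_integral_def)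
  finally show "(LINT p|dsigma R. G p) = integral (rectangle a) (\<lambda>p. vol_density R p *\<^sub>R G p)"
    by (simp add: w_def[abs_def])
qed

section \<open>Integration by parts on the coordinate rectangle and Green's formula\<close>

lemma integral_rectangle_dt:
  fixes g :: "real \<times> real \<Rightarrow> complex"
  assumes "0 \<le> a" "continuous_on (rectangle a) g"
    and deriv: "\<And>t s. \<bar>t\<bar> \<le> a \<Longrightarrow> ((\<lambda>t. G (t, s)) has_vector_derivative g (t, s)) (at t)"
    and bdry: "\<And>s. G (a, s) = G (- a, s)"
  shows "integral (rectangle a) g = 0"
proof -
  have "integral (rectangle a) g = integral {- a..a} (\<lambda>t. integral {0..2 * pi} (\<lambda>s. g (t, s)))"
    unfolding integral_prod_continuous[OF assms(2)] box_real ..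
  \<comment> \<open>The order is swapped so that the inner integral runs over \<tau>, where the
    fundamental theorem applies.\<close>
  also have "\<dots> = integral {0..2 * pi} (\<lambda>s. integral {- a..a} (\<lambda>t. g (t, s)))"
    using integral_swap_continuous[of "- a" 0 a "2 * pi" "\<lambda>t s. g (t, s)", unfolded box_real] assms(2)
    unfolding split_def prod.collapse by blast
  also have "(\<lambda>s. integral {- a..a} (\<lambda>t. g (t, s))) = (\<lambda>s. 0)"
  proof
    fix s
    have "((\<lambda>t. g (t, s)) has_integral (G (a, s) - G (- a, s))) {- a..a}"
      using assms(1) fundamental_theorem_of_calculus[of "- a" a "\<lambda>t. G (t, s)" "\<lambda>t. g (t, s)",
          OF _ has_vector_derivative_at_within[OF deriv]] by (simp add: abs_le_iff)
    then show "integral {- a..a} (\<lambda>t. g (t, s)) = 0" by (simp add: bdry integral_unique)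
  qed
  finally show ?thesis by simp
qed

lemma integral_rectangle_ds:
  fixes g :: "real \<times> real \<Rightarrow> complex"
  assumes "0 \<le> a" "continuous_on (rectangle a) g"
    and deriv: "\<And>t s. \<bar>t\<bar> \<le> a \<Longrightarrow> ((\<lambda>s. G (t, s)) has_vector_derivative g (t, s)) (at s)"
    and bdry: "\<And>t. \<bar>t\<bar> \<le> a \<Longrightarrow> G (t, 2 * pi) = G (t, 0)"
  shows "integral (rectangle a) g = 0"
proof -
  have "integral (rectangle a) g = integral {- a..a} (\<lambda>t. integral {0..2 * pi} (\<lambda>s. g (t, s)))"
    unfolding integral_prod_continuous[OF assms(2)] box_real ..
  also have "\<dots> = integral {- a..a} (\<lambda>t. 0)"
  proof (rule integral_cong)
    fix t assume "t \<in> {- a..a}"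
    then have t: "\<bar>t\<bar> \<le> a" by auto
    then have "((\<lambda>s. g (t, s)) has_integral (G (t, 2 * pi) - G (t, 0))) {0..2 * pi}"
      using fundamental_theorem_of_calculus[of 0 "2 * pi" "\<lambda>s. G (t, s)" "\<lambda>s. g (t, s)",
          OF _ has_vector_derivative_at_within[OF deriv]] by auto
    then show "integral {0..2 * pi} (\<lambda>s. g (t, s)) = 0" by (simp add: bdry[OF t] integral_unique)
  qed
  finally show ?thesis by simp
qed

lemma smooth_on_partial_derivatives:
  assumes "smooth_on chart_dom F" "(t, s) \<in> chart_dom"
  shows "((\<lambda>t. F (t, s)) has_vector_derivative pdiff 1 F (t, s)) (at t)"
    and "((\<lambda>s. F (t, s)) has_vector_derivative pdiff 2 F (t, s)) (at s)"
proof -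
  define D where "D = frechet_derivative F (at (t, s))"
  have D: "(F has_derivative D) (at (t, s))"
    unfolding D_def by (rule smooth_on_has_derivative[OF assms])
  then interpret D: bounded_linear D by (rule has_derivative_bounded_linear)
  have "(F \<circ> (\<lambda>t. (t, s)) has_derivative D \<circ> (\<lambda>x. (x, 0))) (at t)"
    using D by (intro diff_chain_at has_derivative_Pair has_derivative_ident has_derivative_const)
  moreover have "D (x, 0) = x *\<^sub>R pdiff 1 F (t, s)" for x
    using D.scaleR[of x "(1, 0)"] by (simp add: pdiff_def D_def unit_vec_def)
  ultimately show "((\<lambda>t. F (t, s)) has_vector_derivative pdiff 1 F (t, s)) (at t)"
    by (simp add: has_vector_derivative_def o_def)
  have "(F \<circ> (\<lambda>s. (t, s)) has_derivative D \<circ> (\<lambda>x. (0, x))) (at s)"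
    using D by (intro diff_chain_at has_derivative_Pair has_derivative_ident has_derivative_const)
  moreover have "D (0, x) = x *\<^sub>R pdiff 2 F (t, s)" for x
    using D.scaleR[of x "(0, 1)"] by (simp add: pdiff_def D_def unit_vec_def)
  ultimately show "((\<lambda>s. F (t, s)) has_vector_derivative pdiff 2 F (t, s)) (at s)"
    by (simp add: has_vector_derivative_def o_def)
qed

lemma pdiff_zero: "pdiff i (\<lambda>q. 0) p = 0"
  by (rule pdiff_eqI[OF has_derivative_const])

lemma pdiff_outside_support:
  assumes supp: "\<And>p. p \<in> chart_dom \<Longrightarrow> a < \<bar>fst p\<bar> \<Longrightarrow> F p = 0" and p: "p \<in> chart_dom" "a < \<bar>fst p\<bar>"
  shows "pdiff i F p = 0"
proof -
  have "open (chart_dom \<inter> {p. a < \<bar>fst p\<bar>})"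
    by (intro open_Int open_chart_dom open_Collect_less continuous_intros)
  then have "pdiff i F p = pdiff i (\<lambda>q. 0) p"
    by (rule pdiff_cong_open) (use p supp in auto)
  then show ?thesis by (simp add: pdiff_zero)
qed

lemma test_function_integrable:
  assumes "R > 0" "f \<in> test_functions R" "continuous_on chart_dom \<phi>"
  shows "integrable (dsigma R) (\<lambda>p. f (param R p) * \<phi> p)"
proof -
  obtain a where a: "0 < a" "a < pi / 2" "\<And>p. p \<in> chart_dom \<Longrightarrow> a \<le> \<bar>fst p\<bar> \<Longrightarrow> f (param R p) = 0"
    using test_function_support[OF assms(1,2)] by metis
  show ?thesis
    using a smooth_on_continuous[OF test_function_smooth[OF assms(2)]] assms(3)
    by (intro dsigma_integral(1)[of _ a] continuous_on_mult) auto
qed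

text \<open>After the density has cancelled the conformal factor, this is symmetry of the flat wave
  operator: the boundary terms vanish in \<tau> by the support of \<open>f\<close> and in \<theta>
  by periodicity.\<close>

lemma dAlembertian_Green:
  assumes R: "R > 0" and f: "f \<in> test_functions R"
    and cont: "continuous_on chart_dom \<phi>" "continuous_on chart_dom \<phi>tt" "continuous_on chart_dom \<phi>ss"
    and dt: "\<And>t s. (t, s) \<in> chart_dom \<Longrightarrow> ((\<lambda>t. \<phi> (t, s)) has_vector_derivative \<phi>t (t, s)) (at t)"
      "\<And>t s. (t, s) \<in> chart_dom \<Longrightarrow> ((\<lambda>t. \<phi>t (t, s)) has_vector_derivative \<phi>tt (t, s)) (at t)"
    and ds: "\<And>t s. (t, s) \<in> chart_dom \<Longrightarrow> ((\<lambda>s. \<phi> (t, s)) has_vector_derivative \<phi>s (t, s)) (at s)"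
      "\<And>t s. (t, s) \<in> chart_dom \<Longrightarrow> ((\<lambda>s. \<phi>s (t, s)) has_vector_derivative \<phi>ss (t, s)) (at s)"
    and per: "\<And>t. (t, 0) \<in> chart_dom \<Longrightarrow> \<phi> (t, 2 * pi) = \<phi> (t, 0)"
      "\<And>t. (t, 0) \<in> chart_dom \<Longrightarrow> \<phi>s (t, 2 * pi) = \<phi>s (t, 0)"
  shows "(LINT p|dsigma R. dAlembertian R f (param R p) * \<phi> p) =
    (LINT p|dsigma R. f (param R p) * (complex_of_real ((cos (fst p))\<^sup>2 / R\<^sup>2) * (\<phi>tt p - \<phi>ss p)))"
proof -
  define F where "F p = f (param R p)" for p
  have F: "smooth_on chart_dom F"
    unfolding F_def by (rule test_function_smooth[OF f])
  obtain a where a: "0 < a" "a < pi / 2" "\<And>p. p \<in> chart_dom \<Longrightarrow> a \<le> \<bar>fst p\<bar> \<Longrightarrow> F p = 0"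
    unfolding F_def using test_function_support[OF R f] by metis
  \<comment> \<open>The derivatives of \<open>F\<close> are known to vanish only where the absolute
    value of \<tau> exceeds \<open>a\<close>, an open condition, so the rectangle is made slightly
    larger; the midpoint keeps it inside the chart.\<close>
  define b where "b = (a + pi / 2) / 2"
  have b: "0 < b" "a < b" "b < pi / 2" using a(1,2) by (auto simp: b_def field_simps)
  have rect: "rectangle b \<subseteq> chart_dom" by (rule rectangle_subset[OF b(3)])
  have chart: "(t, s) \<in> chart_dom" if "\<bar>t\<bar> \<le> b" for t s
    using that b by (simp add: chart_dom_iff)
  have z: "F p = 0" if "p \<in> chart_dom" "b \<le> \<bar>fst p\<bar>" for p using a(3)[OF that(1)] that(2) b(2) by simp
  have z1: "pdiff i F p = 0" if "p \<in> chart_dom" "a < \<bar>fst p\<bar>" for i p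
    using that a(3) by (intro pdiff_outside_support[of a]) auto
  have z2: "pdiff i (pdiff j F) p = 0" if "p \<in> chart_dom" "a < \<bar>fst p\<bar>" for i j p
    using that by (intro pdiff_outside_support[of a] z1) auto
  have contF: "continuous_on chart_dom F" "continuous_on chart_dom (pdiff i (pdiff j F))" for i j
    by (intro smooth_on_continuous smooth_on_pdiff F)+
  have vol: "vol_density R p * ((cos (fst p))\<^sup>2 / R\<^sup>2) = 1" if "p \<in> chart_dom" for p
    using cos_chart_dom[OF that] R by (simp add: vol_density_chart[OF that])
  have lhs: "(LINT p|dsigma R. dAlembertian R f (param R p) * \<phi> p) = integral (rectangle b) (\<lambda>p. wave F p * \<phi> p)"
  proof -
    have eq: "dAlembertian R f (param R p) = ((cos (fst p))\<^sup>2 / R\<^sup>2) *\<^sub>R wave F p" if "p \<in> chart_dom" for p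
      using dAlembertian_param[OF R, of f p] F that by (simp add: F_def[abs_def])
    have "(LINT p|dsigma R. dAlembertian R f (param R p) * \<phi> p) =
        integral (rectangle b) (\<lambda>p. vol_density R p *\<^sub>R (dAlembertian R f (param R p) * \<phi> p))"
    proof (rule dsigma_integral(2)[OF _ b(3)])
      show "continuous_on chart_dom (\<lambda>p. dAlembertian R f (param R p) * \<phi> p)"
        by (intro continuous_on_mult cont smooth_on_continuous test_function_smooth
            test_functions_dAlembertian R f)
      show "dAlembertian R f (param R p) * \<phi> p = 0" if "p \<in> chart_dom" "b \<le> \<bar>fst p\<bar>" for p
        using that b(2) by (simp add: eq wave_def z2)
    qed
    also have "\<dots> = integral (rectangle b) (\<lambda>p. wave F p * \<phi> p)"
    proof (rule integral_cong)
      fix p assume "p \<in> rectangle b"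
      then have p: "p \<in> chart_dom" using rect by blast
      have "vol_density R p *\<^sub>R (dAlembertian R f (param R p) * \<phi> p)
        = (vol_density R p * ((cos (fst p))\<^sup>2 / R\<^sup>2)) *\<^sub>R (wave F p * \<phi> p)"
        unfolding eq[OF p] by simp
      then show "vol_density R p *\<^sub>R (dAlembertian R f (param R p) * \<phi> p) = wave F p * \<phi> p"
        unfolding vol[OF p] by simp
    qed
    finally show ?thesis .
  qed
  have rhs: "(LINT p|dsigma R. f (param R p) * (complex_of_real ((cos (fst p))\<^sup>2 / R\<^sup>2) * (\<phi>tt p - \<phi>ss p)))
     = integral (rectangle b) (\<lambda>p. F p * (\<phi>tt p - \<phi>ss p))"
  proof -
    have "(LINT p|dsigma R. F p * (complex_of_real ((cos (fst p))\<^sup>2 / R\<^sup>2) * (\<phi>tt p - \<phi>ss p))) =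
        integral (rectangle b) (\<lambda>p. vol_density R p *\<^sub>R
          (F p * (complex_of_real ((cos (fst p))\<^sup>2 / R\<^sup>2) * (\<phi>tt p - \<phi>ss p))))"
    proof (rule dsigma_integral(2)[OF _ b(3)])
      show "continuous_on chart_dom (\<lambda>p. F p * (complex_of_real ((cos (fst p))\<^sup>2 / R\<^sup>2) * (\<phi>tt p - \<phi>ss p)))"
        using R by (intro continuous_intros cont contF) auto
    qed (simp add: z)
    also have "\<dots> = integral (rectangle b) (\<lambda>p. F p * (\<phi>tt p - \<phi>ss p))"
    proof (rule integral_cong)
      fix p assume "p \<in> rectangle b"
      then have p: "p \<in> chart_dom" using rect by blast
      have "vol_density R p *\<^sub>R (F p * (complex_of_real ((cos (fst p))\<^sup>2 / R\<^sup>2) * (\<phi>tt p - \<phi>ss p)))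
        = (vol_density R p * ((cos (fst p))\<^sup>2 / R\<^sup>2)) *\<^sub>R (F p * (\<phi>tt p - \<phi>ss p))"
        by (simp add: scaleR_conv_of_real)
      then show "vol_density R p *\<^sub>R (F p * (complex_of_real ((cos (fst p))\<^sup>2 / R\<^sup>2) * (\<phi>tt p - \<phi>ss p)))
          = F p * (\<phi>tt p - \<phi>ss p)"
        unfolding vol[OF p] by simp
    qed
    finally show ?thesis unfolding F_def .
  qed
  \<comment> \<open>Both integrands are total derivatives, of the Wronskian-type expressions passed
    as \<open>G\<close> below.\<close>
  let ?gt = "\<lambda>p. pdiff 1 (pdiff 1 F) p * \<phi> p - F p * \<phi>tt p"
  let ?gs = "\<lambda>p. pdiff 2 (pdiff 2 F) p * \<phi> p - F p * \<phi>ss p"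
  have cg: "continuous_on (rectangle b) ?gt" "continuous_on (rectangle b) ?gs"
    by (intro continuous_intros continuous_on_subset[OF _ rect] contF cont)+
  have "integral (rectangle b) ?gt = 0"
  proof (rule integral_rectangle_dt[where G = "\<lambda>p. pdiff 1 F p * \<phi> p - F p * \<phi>t p", OF _ cg(1)])
    show "0 \<le> b" using b by simp
    fix t s :: real
    show "((\<lambda>t. pdiff 1 F (t, s) * \<phi> (t, s) - F (t, s) * \<phi>t (t, s)) has_vector_derivative ?gt (t, s)) (at t)"
      if "\<bar>t\<bar> \<le> b"
    proof -
      note c = chart[OF that, of s]
      show ?thesis
        using has_vector_derivative_diff[OF
          has_vector_derivative_mult[OF smooth_on_partial_derivatives(1)[OF smooth_on_pdiff[OF F, of 1] c] dt(1)[OF c]]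
          has_vector_derivative_mult[OF smooth_on_partial_derivatives(1)[OF F c] dt(2)[OF c]]]
        by (simp add: algebra_simps)
    qed
    show "pdiff 1 F (b, s) * \<phi> (b, s) - F (b, s) * \<phi>t (b, s) =
        pdiff 1 F (- b, s) * \<phi> (- b, s) - F (- b, s) * \<phi>t (- b, s)"
      using b chart[of b s] chart[of "-b" s] by (simp add: z z1)
  qed
  moreover have "integral (rectangle b) ?gs = 0"
  proof (rule integral_rectangle_ds[where G = "\<lambda>p. pdiff 2 F p * \<phi> p - F p * \<phi>s p", OF _ cg(2)])
    show "0 \<le> b" using b by simp
    fix t s :: real assume t: "\<bar>t\<bar> \<le> b"
    show "((\<lambda>s. pdiff 2 F (t, s) * \<phi> (t, s) - F (t, s) * \<phi>s (t, s)) has_vector_derivative ?gs (t, s)) (at s)"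
    proof -
      note c = chart[OF t, of s]
      show ?thesis
        using has_vector_derivative_diff[OF
          has_vector_derivative_mult[OF smooth_on_partial_derivatives(2)[OF smooth_on_pdiff[OF F, of 2] c] ds(1)[OF c]]
          has_vector_derivative_mult[OF smooth_on_partial_derivatives(2)[OF F c] ds(2)[OF c]]]
        by (simp add: algebra_simps)
    qed
    have Fper: "F (x + (0, 2 * pi)) = F x" for x
      using param_periodic[of R x 1] by (simp add: F_def)
    have "F (t, 2 * pi) = F (t, 0)" "pdiff 2 F (t, 2 * pi) = pdiff 2 F (t, 0)"
      using Fper[of "(t, 0)"] pdiff_periodic[of F "(0, 2 * pi)" 2 "(t, 0)", OF Fper] by simp_all
    then show "pdiff 2 F (t, 2 * pi) * \<phi> (t, 2 * pi) - F (t, 2 * pi) * \<phi>s (t, 2 * pi) =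
        pdiff 2 F (t, 0) * \<phi> (t, 0) - F (t, 0) * \<phi>s (t, 0)"
      using per chart[OF t] by simp
  qed
  moreover have "integral (rectangle b) (\<lambda>p. ?gt p - ?gs p) = integral (rectangle b) ?gt - integral (rectangle b) ?gs"
    by (intro Henstock_Kurzweil_Integration.integral_diff integrable_continuous cg)
  moreover have "(\<lambda>p. ?gt p - ?gs p) = (\<lambda>p. wave F p * \<phi> p - F p * (\<phi>tt p - \<phi>ss p))"
    by (simp add: wave_def algebra_simps fun_eq_iff)
  moreover have "continuous_on (rectangle b) (\<lambda>p. wave F p * \<phi> p)"
    unfolding wave_def by (intro continuous_intros continuous_on_subset[OF _ rect] contF cont)
  moreover have "continuous_on (rectangle b) (\<lambda>p. F p * (\<phi>tt p - \<phi>ss p))"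
    by (intro continuous_intros continuous_on_subset[OF _ rect] contF cont)
  ultimately have "integral (rectangle b) (\<lambda>p. wave F p * \<phi> p) - integral (rectangle b) (\<lambda>p. F p * (\<phi>tt p - \<phi>ss p)) = 0"
    by (subst Henstock_Kurzweil_Integration.integral_diff[symmetric]) (auto intro: integrable_continuous)
  then show ?thesis unfolding lhs rhs by simp
qed

subsection \<open>Linear functionals of a test function\<close>

text \<open>There is no conjugation here: the pairing is linear in \<open>f\<close>, and the
  antilinear slot of the form receives its conjugate.\<close>

definition pairing :: "real \<Rightarrow> (real \<times> real \<Rightarrow> complex) \<Rightarrow> (real ^ 3 \<Rightarrow> complex) \<Rightarrow> complex" where
  "pairing R \<phi> f = (LINT p|dsigma R. f (param R p) * \<phi> p)"

lemma pairing_add: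
  assumes "R > 0" "continuous_on chart_dom \<phi>" "f \<in> test_functions R" "g \<in> test_functions R"
  shows "pairing R \<phi> (\<lambda>x. f x + g x) = pairing R \<phi> f + pairing R \<phi> g"
  using test_function_integrable[OF assms(1,3,2)] test_function_integrable[OF assms(1,4,2)]
  by (simp add: pairing_def distrib_right)

lemma pairing_scale: "pairing R \<phi> (\<lambda>x. c * f x) = c * pairing R \<phi> f"
  by (simp add: pairing_def mult.assoc)

lemma dS_integral_pairing: "dS_integral R f = pairing R (\<lambda>p. 1) f"
  by (simp add: dS_integral_def pairing_def)

section \<open>Plane waves in the two light-cone coordinates and the logarithmic mode\<close>

definition plane_wave :: "real \<Rightarrow> nat \<Rightarrow> real \<times> real \<Rightarrow> complex" where
  "plane_wave \<epsilon> n p = exp (\<i> * of_nat n * of_real (fst p + \<epsilon> * snd p))"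

text \<open>The boundary value of \<open>Ln (1 + e\<^bsup>2i\<tau>\<^esup>)\<close> on the real axis, with \<open>1 + e\<^bsup>2i\<tau>\<^esup> = 2 cos \<tau> e\<^bsup>i\<tau>\<^esup>\<close>.\<close>

definition log_mode :: "real \<times> real \<Rightarrow> complex" where
  "log_mode p = of_real (ln (2 * cos (fst p))) + \<i> * of_real (fst p)"

lemma continuous_on_plane_wave: "continuous_on S (plane_wave \<epsilon> n)"
  unfolding plane_wave_def by (intro continuous_intros)

lemma continuous_on_log_mode: "continuous_on chart_dom log_mode"
  unfolding log_mode_def using cos_chart_dom by (intro continuous_intros) fastforce

lemma norm_plane_wave: "norm (plane_wave \<epsilon> n p) = 1"
  by (simp add: plane_wave_def norm_exp_eq_Re)

lemma plane_wave_derivatives: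
  "((\<lambda>t. plane_wave \<epsilon> n (t, s)) has_vector_derivative \<i> * of_nat n * plane_wave \<epsilon> n (t, s)) (at t)"
  "((\<lambda>s. plane_wave \<epsilon> n (t, s)) has_vector_derivative \<i> * of_nat n * of_real \<epsilon> * plane_wave \<epsilon> n (t, s)) (at s)"
proof -
  have "((\<lambda>z. exp (\<i> * of_nat n * (z + of_real (\<epsilon> * s)))) has_field_derivative
      \<i> * of_nat n * exp (\<i> * of_nat n * (of_real t + of_real (\<epsilon> * s)))) (at (of_real t))"
    by (auto intro!: derivative_eq_intros)
  from has_vector_derivative_real_field[OF this]
  show "((\<lambda>t. plane_wave \<epsilon> n (t, s)) has_vector_derivative \<i> * of_nat n * plane_wave \<epsilon> n (t, s)) (at t)"
    by (simp add: plane_wave_def)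
  have "((\<lambda>z. exp (\<i> * of_nat n * (of_real t + of_real \<epsilon> * z))) has_field_derivative
      \<i> * of_nat n * of_real \<epsilon> * exp (\<i> * of_nat n * (of_real t + of_real \<epsilon> * of_real s))) (at (of_real s))"
    by (auto intro!: derivative_eq_intros)
  from has_vector_derivative_real_field[OF this]
  show "((\<lambda>s. plane_wave \<epsilon> n (t, s)) has_vector_derivative \<i> * of_nat n * of_real \<epsilon> * plane_wave \<epsilon> n (t, s)) (at s)"
    by (simp add: plane_wave_def)
qed

lemma plane_wave_periodic:
  assumes "\<epsilon> = 1 \<or> \<epsilon> = - 1"
  shows "plane_wave \<epsilon> n (t, 2 * pi) = plane_wave \<epsilon> n (t, 0)"
proof -
  have "plane_wave \<epsilon> n (t, 2 * pi) = plane_wave \<epsilon> n (t, 0) * exp (of_real (2 * (\<epsilon> * real n) * pi) * \<i>)"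
    by (simp add: plane_wave_def algebra_simps flip: exp_add)
  also have "exp (of_real (2 * (\<epsilon> * real n) * pi) * \<i>) = 1"
    by (rule exp_integer_2pi) (use assms in auto)
  finally show ?thesis by simp
qed

lemma dS_integral_dAlembertian:
  assumes "R > 0" "f \<in> test_functions R"
  shows "dS_integral R (dAlembertian R f) = 0"
proof -
  have "(LINT p|dsigma R. dAlembertian R f (param R p) * 1) =
    (LINT p|dsigma R. f (param R p) * (complex_of_real ((cos (fst p))\<^sup>2 / R\<^sup>2) * (0 - 0)))"
    by (rule dAlembertian_Green[OF assms, where \<phi>t = "\<lambda>p. 0" and \<phi>s = "\<lambda>p. 0"]) (auto intro: continuous_intros)
  then show ?thesis by (simp add: dS_integral_def)
qed

lemma plane_wave_dAlembertian:
  assumes "R > 0" "f \<in> test_functions R" and \<epsilon>: "\<epsilon> = 1 \<or> \<epsilon> = - 1"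
  shows "pairing R (plane_wave \<epsilon> n) (dAlembertian R f) = 0"
proof -
  define c where "c = \<i> * of_nat n"
  define d where "d = \<i> * of_nat n * of_real \<epsilon>"
  note hv = has_vector_derivative_mult_right
  have "pairing R (plane_wave \<epsilon> n) (dAlembertian R f) =
    (LINT p|dsigma R. f (param R p) * (complex_of_real ((cos (fst p))\<^sup>2 / R\<^sup>2) *
      (c * (c * plane_wave \<epsilon> n p) - d * (d * plane_wave \<epsilon> n p))))"
    unfolding pairing_def
  proof (rule dAlembertian_Green[OF assms(1,2), where \<phi>t = "\<lambda>p. c * plane_wave \<epsilon> n p"
        and \<phi>s = "\<lambda>p. d * plane_wave \<epsilon> n p"])
    fix t s
    show "((\<lambda>t. plane_wave \<epsilon> n (t, s)) has_vector_derivative c * plane_wave \<epsilon> n (t, s)) (at t)"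
      "((\<lambda>s. plane_wave \<epsilon> n (t, s)) has_vector_derivative d * plane_wave \<epsilon> n (t, s)) (at s)"
      unfolding c_def d_def by (rule plane_wave_derivatives)+
    then show "((\<lambda>t. c * plane_wave \<epsilon> n (t, s)) has_vector_derivative c * (c * plane_wave \<epsilon> n (t, s))) (at t)"
      "((\<lambda>s. d * plane_wave \<epsilon> n (t, s)) has_vector_derivative d * (d * plane_wave \<epsilon> n (t, s))) (at s)"
      by (auto intro: hv)
  qed (simp_all add: plane_wave_periodic[OF \<epsilon>] continuous_on_plane_wave continuous_on_mult_left)
  \<comment> \<open>\<open>d\<close> is \<open>c\<close> times \<epsilon>, and \<epsilon> has square
    1: this is the wave equation.\<close>
  moreover have "c * (c * z) - d * (d * z) = 0" for z
    using \<epsilon> by (auto simp: c_def d_def)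
  ultimately show ?thesis by simp
qed

text \<open>The linear part of the mode disappears in the second derivative. The logarithm
  contributes \<open>- 1 / (cos \<tau>)\<^sup>2\<close>, and the conformal factor turns this into a
  constant.\<close>

lemma log_mode_dAlembertian:
  assumes R: "R > 0" and f: "f \<in> test_functions R"
  shows "pairing R log_mode (dAlembertian R f) = - dS_integral R f / (complex_of_real R)\<^sup>2"
proof -
  have "pairing R log_mode (dAlembertian R f) =
    (LINT p|dsigma R. f (param R p) * (complex_of_real ((cos (fst p))\<^sup>2 / R\<^sup>2) *
      (complex_of_real (- (1 / (cos (fst p))\<^sup>2)) - 0)))"
    unfolding pairing_def
  proof (rule dAlembertian_Green[OF assms, where \<phi>t = "\<lambda>p. of_real (- tan (fst p)) + \<i>" and \<phi>s = "\<lambda>p. 0"])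
    show "continuous_on chart_dom log_mode" by (rule continuous_on_log_mode)
    show "continuous_on chart_dom (\<lambda>p. complex_of_real (- (1 / (cos (fst p))\<^sup>2)))"
      using cos_chart_dom by (intro continuous_intros) fastforce
    fix t s :: real assume ts: "(t, s) \<in> chart_dom"
    have c: "cos t > 0" using cos_chart_dom[OF ts] by simp
    have "((\<lambda>t. ln (2 * cos t)) has_real_derivative - tan t) (at t)"
      using c by (auto intro!: derivative_eq_intros simp: tan_def)
    then have "((\<lambda>t. complex_of_real (ln (2 * cos t))) has_vector_derivative of_real (- tan t)) (at t)"
      by (intro has_vector_derivative_of_real) (simp add: has_real_derivative_iff_has_vector_derivative)
    moreover have "((\<lambda>t. \<i> * complex_of_real t) has_vector_derivative \<i> * of_real 1) (at t)"
      by (intro has_vector_derivative_mult_right has_vector_derivative_of_real) (rule DERIV_ident)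
    ultimately show "((\<lambda>t. log_mode (t, s)) has_vector_derivative of_real (- tan (fst (t, s))) + \<i>) (at t)"
      unfolding log_mode_def using has_vector_derivative_add by fastforce
    have "((\<lambda>t. - tan t) has_real_derivative - (1 / (cos t)\<^sup>2)) (at t)"
      using c by (auto intro!: derivative_eq_intros simp: inverse_eq_divide)
    then have "((\<lambda>t. complex_of_real (- tan t)) has_vector_derivative of_real (- (1 / (cos t)\<^sup>2))) (at t)"
      by (intro has_vector_derivative_of_real) (simp add: has_real_derivative_iff_has_vector_derivative)
    then show "((\<lambda>t. complex_of_real (- tan (fst (t, s))) + \<i>) has_vector_derivative
        of_real (- (1 / (cos (fst (t, s)))\<^sup>2))) (at t)"
      using has_vector_derivative_add[OF _ has_vector_derivative_const, of _ _ _ \<i>] by fastforce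
    show "((\<lambda>s. log_mode (t, s)) has_vector_derivative 0) (at s)"
      by (simp add: log_mode_def)
  qed (simp_all add: log_mode_def)
  also have "\<dots> = (LINT p|dsigma R. (- 1 / (complex_of_real R)\<^sup>2) * f (param R p))"
  proof (rule Bochner_Integration.integral_cong[OF refl])
    fix p assume "p \<in> space (dsigma R)"
    then have "cos (fst p) \<noteq> 0" using cos_chart_dom[OF space_dsigma_chart] by fastforce
    then have "(cos (fst p))\<^sup>2 / R\<^sup>2 * (- (1 / (cos (fst p))\<^sup>2)) = - 1 / R\<^sup>2"
      using R by (simp add: field_simps)
    then have "complex_of_real ((cos (fst p))\<^sup>2 / R\<^sup>2) * complex_of_real (- (1 / (cos (fst p))\<^sup>2)) = - 1 / (complex_of_real R)\<^sup>2"
      by (metis of_real_mult of_real_divide of_real_minus of_real_1 of_real_power)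
    then show "f (param R p) * (complex_of_real ((cos (fst p))\<^sup>2 / R\<^sup>2) *
        (complex_of_real (- (1 / (cos (fst p))\<^sup>2)) - 0)) = (- 1 / (complex_of_real R)\<^sup>2) * f (param R p)"
      by (simp only: diff_zero mult.commute)
  qed
  finally show ?thesis by (simp add: dS_integral_def)
qed

text \<open>One integration by parts in \<theta>: differentiating the wave produces a factor of
  modulus n, whereas the density does not depend on \<theta>. The bound is the integral of the
  \<theta>-derivative of \<open>f\<close>, which does not involve n.\<close>

lemma plane_wave_decay:
  assumes R: "R > 0" and f: "f \<in> test_functions R" and \<epsilon>: "\<epsilon> = 1 \<or> \<epsilon> = - 1"
  obtains C where "\<And>n. real n * norm (pairing R (plane_wave \<epsilon> n) f) \<le> C"
proof -
  define F where "F p = f (param R p)" for p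
  have F: "smooth_on chart_dom F"
    unfolding F_def by (rule test_function_smooth[OF f])
  obtain a where a: "0 < a" "a < pi / 2" "\<And>p. p \<in> chart_dom \<Longrightarrow> a \<le> \<bar>fst p\<bar> \<Longrightarrow> F p = 0"
    unfolding F_def using test_function_support[OF R f] by metis
  have rect: "rectangle a \<subseteq> chart_dom" by (rule rectangle_subset[OF a(2)])
  define V where "V p = R\<^sup>2 / (cos (fst p))\<^sup>2" for p :: "real \<times> real"
  have contV: "continuous_on chart_dom V"
    unfolding V_def using cos_chart_dom by (intro continuous_intros) fastforce
  have contF: "continuous_on chart_dom F" "continuous_on chart_dom (pdiff 2 F)"
    by (intro smooth_on_continuous smooth_on_pdiff F)+
  have Fper: "F (x + (0, 2 * pi)) = F x" for x
    using param_periodic[of R x 1] by (simp add: F_def)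
  have "real n * norm (pairing R (plane_wave \<epsilon> n) f) \<le> integral (rectangle a) (\<lambda>p. V p * norm (pdiff 2 F p))" for n
  proof -
    let ?w = "plane_wave \<epsilon> n"
    define d where "d = \<i> * of_nat n * of_real \<epsilon>"
    have c: "continuous_on (rectangle a) (\<lambda>p. V p *\<^sub>R (F p * ?w p))"
      "continuous_on (rectangle a) (\<lambda>p. V p *\<^sub>R (pdiff 2 F p * ?w p))"
      "continuous_on (rectangle a) (\<lambda>p. V p *\<^sub>R (F p * (d * ?w p) + pdiff 2 F p * ?w p))"
      "continuous_on (rectangle a) (\<lambda>p. V p * norm (pdiff 2 F p))"
      by (intro continuous_intros continuous_on_subset[OF _ rect] contF contV continuous_on_plane_wave)+
    have "integral (rectangle a) (\<lambda>p. V p *\<^sub>R (F p * (d * ?w p) + pdiff 2 F p * ?w p)) = 0"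
    proof (rule integral_rectangle_ds[where G = "\<lambda>p. V p *\<^sub>R (F p * ?w p)", OF _ c(3)])
      show "0 \<le> a" using a by simp
      fix t s :: real assume t: "\<bar>t\<bar> \<le> a"
      have ch: "(t, s) \<in> chart_dom" using t a by (simp add: chart_dom_iff)
      show "((\<lambda>s. V (t, s) *\<^sub>R (F (t, s) * ?w (t, s))) has_vector_derivative
          V (t, s) *\<^sub>R (F (t, s) * (d * ?w (t, s)) + pdiff 2 F (t, s) * ?w (t, s))) (at s)"
        unfolding V_def fst_conv d_def
        by (intro bounded_linear.has_vector_derivative[OF bounded_linear_scaleR_right] has_vector_derivative_mult
            smooth_on_partial_derivatives(2)[OF F ch] plane_wave_derivatives(2))
      show "V (t, 2 * pi) *\<^sub>R (F (t, 2 * pi) * ?w (t, 2 * pi)) = V (t, 0) *\<^sub>R (F (t, 0) * ?w (t, 0))"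
        using Fper[of "(t, 0)"] by (simp add: V_def plane_wave_periodic[OF \<epsilon>])
    qed
    also have "(\<lambda>p. V p *\<^sub>R (F p * (d * ?w p) + pdiff 2 F p * ?w p)) =
        (\<lambda>p. d * (V p *\<^sub>R (F p * ?w p)) + V p *\<^sub>R (pdiff 2 F p * ?w p))"
      by (simp add: scaleR_conv_of_real algebra_simps)
    also have "integral (rectangle a) \<dots> = d * integral (rectangle a) (\<lambda>p. V p *\<^sub>R (F p * ?w p)) +
        integral (rectangle a) (\<lambda>p. V p *\<^sub>R (pdiff 2 F p * ?w p))"
      unfolding Henstock_Kurzweil_Integration.integral_mult_right[symmetric]
      by (intro Henstock_Kurzweil_Integration.integral_add integrable_continuous c continuous_on_mult_left)
    finally have "d * integral (rectangle a) (\<lambda>p. V p *\<^sub>R (F p * ?w p)) =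
        - integral (rectangle a) (\<lambda>p. V p *\<^sub>R (pdiff 2 F p * ?w p))"
      by (simp add: eq_neg_iff_add_eq_0)
    moreover have "pairing R ?w f = integral (rectangle a) (\<lambda>p. V p *\<^sub>R (F p * ?w p))"
    proof -
      have "(LINT p|dsigma R. F p * ?w p) = integral (rectangle a) (\<lambda>p. vol_density R p *\<^sub>R (F p * ?w p))"
        by (rule dsigma_integral(2)[OF _ a(2)])
          (use a contF continuous_on_plane_wave in \<open>auto intro!: continuous_on_mult\<close>)
      also have "\<dots> = integral (rectangle a) (\<lambda>p. V p *\<^sub>R (F p * ?w p))"
        using rect vol_density_chart[of _ R] by (intro integral_cong) (auto simp: V_def subset_iff)
      finally show ?thesis by (simp add: pairing_def F_def)
    qed
    ultimately have "norm d * norm (pairing R ?w f) = norm (integral (rectangle a) (\<lambda>p. V p *\<^sub>R (pdiff 2 F p * ?w p)))"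
      by (metis norm_minus_cancel norm_mult)
    also have "\<dots> \<le> integral (rectangle a) (\<lambda>p. V p * norm (pdiff 2 F p))"
      by (intro integral_norm_bound_integral integrable_continuous c)
        (simp add: norm_mult norm_plane_wave V_def)
    also have "norm d = real n" using \<epsilon> by (auto simp: d_def norm_mult)
    finally show ?thesis .
  qed
  then show ?thesis by (rule that)
qed

subsection \<open>The tuboids in conformal coordinates\<close>

text \<open>The real part of the cosine is \<open>cos (Re z) * cosh (Im z)\<close>, positive in the
  strip; so the chart extends to complex arguments there.\<close>

lemma cos_neq_0_strip: "\<bar>Re z\<bar> < pi / 2 \<Longrightarrow> cos z \<noteq> 0"
proof
  assume "\<bar>Re z\<bar> < pi / 2" "cos z = 0"
  moreover from this have "cos (Re z) > 0" by (intro cos_gt_zero_pi) auto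
  moreover have "exp (Im z) + exp (- Im z) > 0" by (simp add: add_pos_pos)
  ultimately show False using Re_cos[of z] by (simp add: zero_complex.sel)
qed

text \<open>At equal points the right side vanishes, so the complex chart maps into the quadric; at
  complex conjugate points it yields the imaginary part through \<open>mink_Im\<close>.\<close>

lemma mink_param:
  fixes r :: complex
  assumes "cos t \<noteq> 0" "cos t' \<noteq> 0"
  shows "mink (param r (t, s)) (param r (t', s')) + r\<^sup>2 = r\<^sup>2 * (cos (t - t') - cos (s - s')) / (cos t * cos t')"
  using assms unfolding mink_def param_def vector_3 fst_conv snd_conv cos_diff tan_def
  by (simp add: field_simps power2_eq_square)

lemma param_in_dS_complex: "cos t \<noteq> 0 \<Longrightarrow> param (complex_of_real R) (t, s) \<in> dS_complex R"
  using mink_param[of t t "complex_of_real R" s s] by (simp add: dS_complex_def eq_neg_iff_add_eq_0)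

text \<open>With z = x + iy, the product of z with its conjugate is the sum of the squares of x and
  y, while membership in the quadric fixes their difference.\<close>

lemma mink_Im:
  assumes "z \<in> dS_complex R"
  shows "complex_of_real (2 * mink (\<chi> i. Im (z $ i)) (\<chi> i. Im (z $ i))) =
    mink z (\<chi> i. cnj (z $ i)) + (complex_of_real R)\<^sup>2"
proof -
  have "(complex_of_real R)\<^sup>2 = - mink z z" using assms by (simp add: dS_complex_def)
  moreover have "Im (mink z z) = 0" using assms by (simp add: dS_complex_def flip: of_real_power)
  ultimately show ?thesis
    by (simp add: mink_def complex_eq_iff algebra_simps)
qed

lemma param_cnj: "(\<chi> i. cnj (param (complex_of_real R) (t, s) $ i)) = param (complex_of_real R) (cnj t, cnj s)"
  by (simp add: vec_eq_iff forall_3 param_def tan_def cnj_sin cnj_cos)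

lemma cosh_of_real: "cosh (complex_of_real x) = complex_of_real (cosh x)"
  and sinh_of_real: "sinh (complex_of_real x) = complex_of_real (sinh x)"
  by (simp_all add: cosh_def sinh_def exp_of_real scaleR_conv_of_real flip: of_real_minus)

text \<open>The points (t, s) and their conjugates differ by imaginary amounts, which turns cosines
  into hyperbolic cosines. The base point enters only through the positive number \<open>N\<close>,
  so the signs that decide membership in a tuboid depend on \<eta> alone.\<close>

lemma mink_Im_shifted_point:
  fixes R :: real and \<eta> p :: "real \<times> real"
  assumes "\<bar>fst p\<bar> < pi / 2"
  defines "y \<equiv> \<chi> i. Im (shifted_point R \<eta> p $ i)" and "N \<equiv> (norm (cos (Complex (fst p) (fst \<eta>))))\<^sup>2"
  shows "2 * mink y y = R\<^sup>2 * (cosh (2 * fst \<eta>) - cosh (2 * snd \<eta>)) / N" and "2 * y $ 1 = R * sinh (2 * fst \<eta>) / N"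
    and "N > 0"
proof -
  define t s where "t = Complex (fst p) (fst \<eta>)" and "s = Complex (snd p) (snd \<eta>)"
  have c: "cos t \<noteq> 0" "cos (cnj t) \<noteq> 0" using assms(1) by (auto intro!: cos_neq_0_strip simp: t_def)
  have sp: "shifted_point R \<eta> p = param (complex_of_real R) (t, s)"
    by (simp add: shifted_point_def t_def s_def)
  have N: "cos t * cos (cnj t) = complex_of_real N"
    unfolding N_def t_def[symmetric] complex_norm_square cnj_cos ..
  show "N > 0" using c by (simp add: N_def flip: t_def)
  have d: "t - cnj t = \<i> * complex_of_real (2 * fst \<eta>)" "s - cnj s = \<i> * complex_of_real (2 * snd \<eta>)"
    by (simp_all add: t_def s_def complex_eq_iff)
  have "complex_of_real (2 * mink y y) = mink (param (complex_of_real R) (t, s)) (param (complex_of_real R) (cnj t, cnj s))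
      + (complex_of_real R)\<^sup>2"
    unfolding y_def sp mink_Im[OF param_in_dS_complex[OF c(1)]] param_cnj ..
  also have "\<dots> = complex_of_real (R\<^sup>2 * (cosh (2 * fst \<eta>) - cosh (2 * snd \<eta>)) / N)"
    unfolding mink_param[OF c] N d cosh_conv_cos[symmetric] by (simp flip: cosh_of_real)
  finally show "2 * mink y y = R\<^sup>2 * (cosh (2 * fst \<eta>) - cosh (2 * snd \<eta>)) / N"
    by (simp only: of_real_eq_iff)
  have "tan t - cnj (tan t) = sin (t - cnj t) / (cos t * cos (cnj t))"
    using c by (simp add: tan_def cnj_sin cnj_cos sin_diff field_simps)
  also have "sin (t - cnj t) = \<i> * complex_of_real (sinh (2 * fst \<eta>))"
    unfolding d using sinh_conv_sin[of "complex_of_real (2 * fst \<eta>)"] by (simp flip: sinh_of_real)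
  finally have "Im (tan t - cnj (tan t)) = sinh (2 * fst \<eta>) / N"
    unfolding N by (simp flip: of_real_divide add: Im_divide_of_real)
  then have "2 * Im (tan t) = sinh (2 * fst \<eta>) / N" by simp
  then show "2 * y $ 1 = R * sinh (2 * fst \<eta>) / N"
    by (simp add: y_def sp param_def) (metis mult.left_commute times_divide_eq_right)
qed

lemma cosh_diff_pos_iff: "cosh (2 * x) - cosh (2 * y) > 0 \<longleftrightarrow> \<bar>y\<bar> < \<bar>x\<bar>" for x y :: real
proof -
  have "cosh (2 * x) - cosh (2 * y) > 0 \<longleftrightarrow> \<not> cosh \<bar>2 * x\<bar> \<le> cosh \<bar>2 * y\<bar>"
    unfolding cosh_real_abs by linarith
  also have "\<dots> \<longleftrightarrow> \<bar>y\<bar> < \<bar>x\<bar>" by (subst cosh_real_nonneg_le_iff) auto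
  finally show ?thesis .
qed

lemma shifted_point_in_tuboid_iff:
  assumes R: "R > 0" and p: "\<bar>fst p\<bar> < pi / 2"
  shows "shifted_point R \<eta> p \<in> tuboid R V_plus \<longleftrightarrow> \<bar>snd \<eta>\<bar> < fst \<eta>"
    and "shifted_point R \<eta> p \<in> tuboid R V_minus \<longleftrightarrow> \<bar>snd \<eta>\<bar> < - fst \<eta>"
proof -
  define y where "y = (\<chi> i. Im (shifted_point R \<eta> p $ i))"
  note m = mink_Im_shifted_point(1,2)[OF p, of R \<eta>, folded y_def] mink_Im_shifted_point(3)[OF p, of \<eta>]
  have 1: "0 < mink y y \<longleftrightarrow> \<bar>snd \<eta>\<bar> < \<bar>fst \<eta>\<bar>"
  proof -
    have "0 < 2 * mink y y \<longleftrightarrow> \<bar>snd \<eta>\<bar> < \<bar>fst \<eta>\<bar>"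
      unfolding m(1) cosh_diff_pos_iff[symmetric] using R m(3) by (simp add: zero_less_divide_iff zero_less_mult_iff)
    then show ?thesis by simp
  qed
  have 2: "0 < y $ 1 \<longleftrightarrow> 0 < fst \<eta>" "0 < - y $ 1 \<longleftrightarrow> 0 < - fst \<eta>"
  proof -
    have "0 < 2 * y $ 1 \<longleftrightarrow> 0 < fst \<eta>" "0 > 2 * y $ 1 \<longleftrightarrow> 0 > fst \<eta>"
      unfolding m(2) using R m(3)
      by (simp_all add: zero_less_divide_iff zero_less_mult_iff divide_less_0_iff mult_less_0_iff)
    then show "0 < y $ 1 \<longleftrightarrow> 0 < fst \<eta>" "0 < - y $ 1 \<longleftrightarrow> 0 < - fst \<eta>" by simp_all
  qed
  have 3: "shifted_point R \<eta> p \<in> tuboid R V \<longleftrightarrow> y \<in> V" for V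
  proof -
    have "shifted_point R \<eta> p \<in> dS_complex R"
      unfolding shifted_point_def using p by (intro param_in_dS_complex cos_neq_0_strip) simp
    then show ?thesis by (simp add: tuboid_def y_def)
  qed
  have "y \<in> V_plus \<longleftrightarrow> \<bar>snd \<eta>\<bar> < fst \<eta>"
    unfolding V_plus_def mem_Collect_eq 1 2 by linarith
  then show "shifted_point R \<eta> p \<in> tuboid R V_plus \<longleftrightarrow> \<bar>snd \<eta>\<bar> < fst \<eta>"
    unfolding 3 .
  have "y \<in> V_minus \<longleftrightarrow> - y \<in> V_plus"
    unfolding V_minus_def by (metis add.inverse_inverse image_eqI image_iff)
  also have "\<dots> \<longleftrightarrow> 0 < mink y y \<and> 0 < - y $ 1"
    by (simp add: V_plus_def mink_def)
  also have "\<dots> \<longleftrightarrow> \<bar>snd \<eta>\<bar> < - fst \<eta>"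
    unfolding 1 2 by linarith
  finally show "shifted_point R \<eta> p \<in> tuboid R V_minus \<longleftrightarrow> \<bar>snd \<eta>\<bar> < - fst \<eta>"
    unfolding 3 .
qed

lemma approach_tuboid:
  assumes R: "R > 0"
  shows "approach R (tuboid R V_plus) = {\<eta>. \<bar>snd \<eta>\<bar> < fst \<eta>}"
    and "approach R (tuboid R V_minus) = {\<eta>. \<bar>snd \<eta>\<bar> < - fst \<eta>}"
proof -
  have "(0, 0) \<in> chart_dom" by (simp add: chart_dom_iff)
  \<comment> \<open>The condition does not depend on the base point, so over the nonempty chart the
    quantifier collapses.\<close>
  then have ball: "(\<forall>p\<in>chart_dom. P p) \<longleftrightarrow> c" if "\<And>p. p \<in> chart_dom \<Longrightarrow> P p \<longleftrightarrow> c" for P c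
    using that by blast
  show "approach R (tuboid R V_plus) = {\<eta>. \<bar>snd \<eta>\<bar> < fst \<eta>}"
    "approach R (tuboid R V_minus) = {\<eta>. \<bar>snd \<eta>\<bar> < - fst \<eta>}"
    unfolding approach_def
    by (intro Collect_cong ball shifted_point_in_tuboid_iff[OF R]; simp add: chart_dom_iff)+
qed

section \<open>Convexity of the forward cone and avoidance of the branch cut\<close>

lemma V_plus_iff: "y \<in> V_plus \<longleftrightarrow> sqrt ((y $ 2)\<^sup>2 + (y $ 3)\<^sup>2) < y $ 1"
proof -
  have "0 < mink y y \<longleftrightarrow> (y $ 2)\<^sup>2 + (y $ 3)\<^sup>2 < (y $ 1)\<^sup>2"
    by (auto simp: mink_def power2_eq_square)
  moreover have "sqrt ((y $ 2)\<^sup>2 + (y $ 3)\<^sup>2) < y $ 1 \<longleftrightarrow> (y $ 2)\<^sup>2 + (y $ 3)\<^sup>2 < (y $ 1)\<^sup>2 \<and> 0 < y $ 1"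
    by (smt (verit) real_less_lsqrt real_sqrt_ge_0_iff real_sqrt_less_iff real_sqrt_unique sum_power2_ge_zero
        real_sqrt_abs)
  ultimately show ?thesis by (auto simp: V_plus_def)
qed

text \<open>By \<open>V_plus_iff\<close> the cone lies strictly above the graph of the Euclidean
  norm, so closure under sums is the triangle inequality.\<close>

lemma V_plus_add: "x \<in> V_plus \<Longrightarrow> y \<in> V_plus \<Longrightarrow> x + y \<in> V_plus"
  using real_sqrt_sum_squares_triangle_ineq[of "x $ 2" "y $ 2" "x $ 3" "y $ 3"]
  by (simp add: V_plus_iff)

text \<open>If the square of x + iy is real, then x is orthogonal to the timelike vector y, hence
  spacelike or zero, and the square is negative.\<close>

lemma mink_tube:
  assumes "(\<chi> i. Im (w $ i)) \<in> V_plus"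
  shows "mink w w \<notin> \<real>\<^sub>\<ge>\<^sub>0"
proof
  assume "mink w w \<in> \<real>\<^sub>\<ge>\<^sub>0"
  then have re: "Re (mink w w) \<ge> 0" and im: "Im (mink w w) = 0"
    by (auto simp: complex_nonneg_Reals_iff)
  define x where "x i = Re (w $ i)" for i
  define y where "y i = Im (w $ i)" for i
  have V: "0 < y 1 * y 1 - y 2 * y 2 - y 3 * y 3" "0 < y 1"
    using assms by (auto simp: V_plus_def mink_def y_def)
  have "x 1 * y 1 = x 2 * y 2 + x 3 * y 3"
  proof -
    have "Im (mink w w) = 2 * (x 1 * y 1 - x 2 * y 2 - x 3 * y 3)"
      by (simp add: mink_def x_def y_def algebra_simps)
    then have "x 1 * y 1 - x 2 * y 2 - x 3 * y 3 = 0" using im by simp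
    then show ?thesis by (simp add: algebra_simps)
  qed
  \<comment> \<open>Cauchy-Schwarz in the two spatial components.\<close>
  then have "(x 1 * y 1)\<^sup>2 \<le> ((x 2)\<^sup>2 + (x 3)\<^sup>2) * ((y 2)\<^sup>2 + (y 3)\<^sup>2)"
    using sum_squares_bound[of "x 2 * y 3" "x 3 * y 2"] by (simp add: power2_eq_square algebra_simps)
  also have "\<dots> \<le> ((x 2)\<^sup>2 + (x 3)\<^sup>2) * (y 1)\<^sup>2"
    using V by (intro mult_left_mono) (auto simp: power2_eq_square)
  finally have "(x 1)\<^sup>2 \<le> (x 2)\<^sup>2 + (x 3)\<^sup>2" using V(2) by (simp add: power_mult_distrib)
  moreover have "Re (mink w w) = (x 1)\<^sup>2 - (x 2)\<^sup>2 - (x 3)\<^sup>2 - (y 1 * y 1 - y 2 * y 2 - y 3 * y 3)"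
    by (simp add: mink_def x_def y_def power2_eq_square)
  ultimately show False using re V by simp
qed

subsection \<open>The logarithm on the tuboids\<close>

lemma mink_diff_param:
  fixes r t t' s s' :: complex
  assumes "r \<noteq> 0" "cos t \<noteq> 0" "cos t' \<noteq> 0"
  defines "w \<equiv> param r (t, s) - param r (t', s')"
  shows "- (mink w w / r\<^sup>2) = 2 * (cos (t - t') - cos (s - s')) / (cos t * cos t')"
proof -
  define m where "m = mink (param r (t, s)) (param r (t', s'))"
  have "mink w w = mink (param r (t, s)) (param r (t, s)) + mink (param r (t', s')) (param r (t', s')) - 2 * m"
    by (simp add: w_def m_def mink_def algebra_simps)
  moreover have "mink (param r (t, s)) (param r (t, s)) = - r\<^sup>2" "mink (param r (t', s')) (param r (t', s')) = - r\<^sup>2"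
    using mink_param[OF assms(2,2), of r s s] mink_param[OF assms(3,3), of r s' s']
    by (simp_all add: eq_neg_iff_add_eq_0)
  ultimately have "mink w w = - 2 * (m + r\<^sup>2)" by simp
  then show ?thesis
    unfolding m_def mink_param[OF assms(2,3)] using assms(1) by simp
qed

text \<open>In the three exponentials \<open>e\<close>, \<open>f\<close>, \<open>x\<close> this is a
  rational identity. Nonzero cosines mean that \<open>e * e + 1\<close> and \<open>f * f + 1\<close>
  are nonzero.\<close>

lemma cos_quotient_factorization:
  fixes t t' B :: complex
  assumes "cos t \<noteq> 0" "cos t' \<noteq> 0"
  shows "2 * (cos (t - t') - cos B) / (cos t * cos t') =
    4 * ((1 - exp (- \<i> * (t - t' + B))) * (1 - exp (- \<i> * (t - t' - B)))) /
    ((1 + exp (- 2 * \<i> * t)) * (1 + exp (2 * \<i> * t')))"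
proof -
  define e f x where "e = exp (\<i> * t)" and "f = exp (\<i> * t')" and "x = exp (\<i> * B)"
  have nz: "e \<noteq> 0" "f \<noteq> 0" "x \<noteq> 0" by (simp_all add: e_def f_def x_def)
  have e': "exp (- (\<i> * t)) = 1 / e" "exp (- (\<i> * t')) = 1 / f" "exp (- (\<i> * B)) = 1 / x"
    by (simp_all add: e_def f_def x_def exp_minus inverse_eq_divide)
  have c: "cos t = (e + 1 / e) / 2" "cos t' = (f + 1 / f) / 2" "cos B = (x + 1 / x) / 2"
    by (simp_all add: cos_exp_eq e' flip: e_def f_def x_def)
  have A: "exp (\<i> * (t - t')) = e / f" "exp (- (\<i> * (t - t'))) = f / e"
    by (simp_all add: right_diff_distrib exp_diff e_def f_def)
  have cA: "cos (t - t') = (e / f + f / e) / 2"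
    by (simp add: cos_exp_eq A)
  have q1: "exp (- \<i> * (t - t' + B)) = f / e * (1 / x)"
    unfolding A(2)[symmetric] e'(3)[symmetric] exp_add[symmetric] by (simp add: algebra_simps)
  have q2: "exp (- \<i> * (t - t' - B)) = f / e * x"
    unfolding A(2)[symmetric] x_def exp_add[symmetric] by (simp add: algebra_simps)
  have w: "exp (- 2 * \<i> * t) = 1 / e * (1 / e)"
    unfolding e'(1)[symmetric] exp_add[symmetric] by (simp add: algebra_simps)
  have w': "exp (2 * \<i> * t') = f * f"
    unfolding f_def exp_add[symmetric] by (simp add: algebra_simps)
  have ne: "e * e + 1 \<noteq> 0" "f * f + 1 \<noteq> 0"
    using assms nz unfolding c by (auto simp: field_simps)
  have ce: "cos t = (e * e + 1) / (2 * e)" "cos t' = (f * f + 1) / (2 * f)"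
    unfolding c using nz by (simp_all add: field_simps)
  have we: "1 + 1 / e * (1 / e) = (e * e + 1) / (e * e)" using nz by (simp add: field_simps)
  have num: "2 * ((e / f + f / e) / 2 - (x + 1 / x) / 2) = (e / f) * ((1 - f / e * (1 / x)) * (1 - f / e * x))"
    using nz by (simp add: field_simps)
  have quot: "e / f * N / (a / (2 * e) * (b / (2 * f))) = 4 * N / (a / (e * e) * b)" for N a b :: complex
    using nz by (cases "a = 0 \<or> b = 0") (auto simp: field_simps)
  show ?thesis
    unfolding q1 q2 w w' cA c(3) num ce we quot by (simp only: add.commute)
qed

lemma one_minus_notin_nonpos_Reals: "norm q < 1 \<Longrightarrow> 1 - q \<notin> \<real>\<^sub>\<le>\<^sub>0" for q :: complex
  using complex_Re_le_cmod[of q] by (auto simp: complex_nonpos_Reals_iff)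

text \<open>Logarithms of 1 lie in the discrete set of multiples of 2 pi i, so a continuous family
  of them is constant, and one real value forces it to be zero.\<close>

lemma continuous_log_branch:
  fixes D :: "real \<Rightarrow> complex"
  assumes cont: "continuous_on {0..1} D" and exp1: "\<And>r. r \<in> {0..1} \<Longrightarrow> exp (D r) = 1" and D0: "Im (D 0) = 0"
  shows "D 1 = 0"
proof -
  have "D constant_on {0..1}"
  proof (rule continuous_discrete_range_constant[OF _ cont])
    fix x assume x: "x \<in> {0..1::real}"
    have "2 * pi \<le> norm (D y - D x)" if y: "y \<in> {0..1}" "D y \<noteq> D x" for y
    proof -
      obtain m n :: int where mn: "Re (D x) = 0" "Im (D x) = of_int (2 * m) * pi"
        "Re (D y) = 0" "Im (D y) = of_int (2 * n) * pi"
        using exp1[OF x] exp1[OF y(1)] unfolding exp_eq_1 by blast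
      have "n \<noteq> m" using mn y(2) by (auto simp: complex_eq_iff)
      then have "1 \<le> \<bar>real_of_int (n - m)\<bar>" by linarith
      then have "2 * pi * 1 \<le> 2 * pi * \<bar>real_of_int (n - m)\<bar>" by (intro mult_left_mono) auto
      also have "\<dots> = \<bar>Im (D y - D x)\<bar>"
      proof -
        have "Im (D y - D x) = 2 * pi * real_of_int (n - m)" by (simp add: mn algebra_simps)
        then show ?thesis by (simp only: abs_mult) simp
      qed
      also have "\<dots> \<le> norm (D y - D x)" by (rule abs_Im_le_cmod)
      finally show ?thesis by simp
    qed
    then show "\<exists>e>0. \<forall>y. y \<in> {0..1} \<and> D y \<noteq> D x \<longrightarrow> e \<le> norm (D y - D x)"
      by (intro exI[of _ "2 * pi"]) auto
  qed auto
  then obtain c where "\<And>r. r \<in> {0..1} \<Longrightarrow> D r = c" unfolding constant_on_def by blast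
  then have "D 1 = D 0" by simp
  moreover have "Re (D 0) = 0" using exp1[of 0] unfolding exp_eq_1 by simp
  then have "D 0 = 0" using D0 by (simp add: complex_eq_iff)
  ultimately show ?thesis by simp
qed

text \<open>For \<epsilon> = 1 and \<epsilon> = -1 these are the exponentials called q in the
  overview, taken at displaced points; \<open>light_gap\<close> is minus the logarithm of their
  modulus.\<close>

definition light_mode :: "real \<Rightarrow> real \<times> real \<Rightarrow> real \<times> real \<Rightarrow> real \<times> real \<Rightarrow> real \<times> real \<Rightarrow> complex" where
  "light_mode \<epsilon> \<eta> \<eta>' p p' = exp (- \<i> * ((Complex (fst p) (fst \<eta>) - Complex (fst p') (fst \<eta>')) +
     of_real \<epsilon> * (Complex (snd p) (snd \<eta>) - Complex (snd p') (snd \<eta>'))))"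

definition light_gap :: "real \<Rightarrow> real \<times> real \<Rightarrow> real \<times> real \<Rightarrow> real" where
  "light_gap \<epsilon> \<eta> \<eta>' = (fst \<eta>' + \<epsilon> * snd \<eta>') - (fst \<eta> + \<epsilon> * snd \<eta>)"

lemma norm_light_mode: "norm (light_mode \<epsilon> \<eta> \<eta>' p p') = exp (- light_gap \<epsilon> \<eta> \<eta>')"
  by (simp add: light_mode_def light_gap_def norm_exp_eq_Re algebra_simps)

lemma light_gap_pos:
  "\<bar>snd \<eta>\<bar> < - fst \<eta> \<Longrightarrow> \<bar>snd \<eta>'\<bar> < fst \<eta>' \<Longrightarrow> \<epsilon> = 1 \<or> \<epsilon> = - 1 \<Longrightarrow> light_gap \<epsilon> \<eta> \<eta>' > 0"
  by (auto simp: light_gap_def)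

text \<open>The logarithm of a factor in the denominator of the factorized argument, at \<tau> = x +
  ib. As b tends to 0 it becomes singular exactly at the edges of the chart.\<close>

definition edge_log :: "real \<Rightarrow> real \<Rightarrow> complex" where
  "edge_log b x = Ln (1 + exp (2 * \<i> * Complex x b))"

lemma cnj_edge_log: "b > 0 \<Longrightarrow> cnj (edge_log b x) = Ln (1 + exp (- 2 * \<i> * Complex x (- b)))"
proof -
  assume b: "b > 0"
  have "1 - (- exp (2 * \<i> * Complex x b)) \<notin> \<real>\<^sub>\<le>\<^sub>0"
    by (rule one_minus_notin_nonpos_Reals) (use b in \<open>simp add: norm_exp_eq_Re\<close>)
  then have "cnj (edge_log b x) = Ln (cnj (1 + exp (2 * \<i> * Complex x b)))"
    unfolding edge_log_def by (intro cnj_Ln) simp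
  also have "cnj (1 + exp (2 * \<i> * Complex x b)) = 1 + exp (- 2 * \<i> * Complex x (- b))"
  proof -
    have "cnj (2 * \<i> * Complex x b) = - 2 * \<i> * Complex x (- b)" by (simp add: complex_eq_iff)
    then show ?thesis by (metis complex_cnj_add complex_cnj_one exp_cnj)
  qed
  finally show ?thesis .
qed

text \<open>Exponentiation matches the two sides only modulo multiples of 2 pi i.
  \<open>continuous_log_branch\<close> removes the ambiguity, provided the product \<open>Q\<close>
  never meets the branch cut along the path.\<close>

lemma W0_shifted_points:
  assumes R: "R > 0" and p: "p \<in> chart_dom" "p' \<in> chart_dom"
    and \<eta>: "\<bar>snd \<eta>\<bar> < - fst \<eta>" "\<bar>snd \<eta>'\<bar> < fst \<eta>'"
  shows "W0 R (shifted_point R \<eta> p) (shifted_point R \<eta>' p') = 1 / (4 * of_real pi) *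
    (cnj (edge_log (- fst \<eta>) (fst p)) + edge_log (fst \<eta>') (fst p') - of_real (ln 4)
      - Ln (1 - light_mode 1 \<eta> \<eta>' p p') - Ln (1 - light_mode (-1) \<eta> \<eta>' p p'))"
proof -
  \<comment> \<open>Only the real parts are scaled. The imaginary displacements are kept, so the
    points stay in their tuboids.\<close>
  define P where "P r = (r * fst p, r * snd p)" for r
  define P' where "P' r = (r * fst p', r * snd p')" for r
  define w where "w r = exp (- 2 * \<i> * Complex (fst (P r)) (fst \<eta>))" for r
  define w' where "w' r = exp (2 * \<i> * Complex (fst (P' r)) (fst \<eta>'))" for r
  define q where "q \<epsilon> r = light_mode \<epsilon> \<eta> \<eta>' (P r) (P' r)" for \<epsilon> r
  define S where "S r = of_real (ln 4) + Ln (1 - q 1 r) + Ln (1 - q (-1) r) - Ln (1 + w r) - Ln (1 + w' r)" for r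
  define Q where "Q r = 4 * ((1 - q 1 r) * (1 - q (-1) r)) / ((1 + w r) * (1 + w' r))" for r
  define Z where "Z r = shifted_point R \<eta> (P r) - shifted_point R \<eta>' (P' r)" for r
  have dom: "P r \<in> chart_dom" "P' r \<in> chart_dom" if "r \<in> {0..1}" for r
  proof -
    have "\<bar>r * x\<bar> \<le> \<bar>x\<bar>" for x using that mult_right_mono[of "\<bar>r\<bar>" 1 "\<bar>x\<bar>"] by (simp add: abs_mult)
    then show "P r \<in> chart_dom" "P' r \<in> chart_dom"
      using p unfolding chart_dom_iff P_def P'_def fst_conv by (meson le_less_trans)+
  qed
  have cP: "Complex (fst (P r)) b = of_real (r * fst p) + \<i> * of_real b"
    "Complex (snd (P r)) b = of_real (r * snd p) + \<i> * of_real b"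
    "Complex (fst (P' r)) b = of_real (r * fst p') + \<i> * of_real b"
    "Complex (snd (P' r)) b = of_real (r * snd p') + \<i> * of_real b" for r b
    by (simp_all add: P_def P'_def complex_eq_iff)
  have n: "norm (q 1 r) < 1" "norm (q (-1) r) < 1" "norm (- w r) < 1" "norm (- w' r) < 1" for r
    using \<eta> light_gap_pos[OF \<eta>] by (simp_all add: q_def norm_light_mode w_def w'_def norm_exp_eq_Re)
  have slit: "1 - q 1 r \<notin> \<real>\<^sub>\<le>\<^sub>0" "1 - q (-1) r \<notin> \<real>\<^sub>\<le>\<^sub>0" "1 + w r \<notin> \<real>\<^sub>\<le>\<^sub>0" "1 + w' r \<notin> \<real>\<^sub>\<le>\<^sub>0" for r
    using n[of r, THEN one_minus_notin_nonpos_Reals] by simp_all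
  have nz: "1 - q 1 r \<noteq> 0" "1 - q (-1) r \<noteq> 0" "1 + w r \<noteq> 0" "1 + w' r \<noteq> 0" for r
    using slit[of r] by (metis complex_nonpos_Reals_iff order_refl zero_complex.sel)+
  have contq: "continuous_on {0..1} (q 1)" "continuous_on {0..1} (q (-1))"
    "continuous_on {0..1} w" "continuous_on {0..1} w'"
    unfolding q_def[abs_def] w_def[abs_def] w'_def[abs_def] light_mode_def cP by (intro continuous_intros)+
  have argQ: "- (mink (Z r) (Z r) / (complex_of_real R)\<^sup>2) = Q r" if r: "r \<in> {0..1}" for r
  proof -
    have c: "cos (Complex (fst (P r)) (fst \<eta>)) \<noteq> 0" "cos (Complex (fst (P' r)) (fst \<eta>')) \<noteq> 0"
      using dom[OF r] by (auto intro!: cos_neq_0_strip simp: chart_dom_iff)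
    have "- (mink (Z r) (Z r) / (complex_of_real R)\<^sup>2) =
      2 * (cos (Complex (fst (P r)) (fst \<eta>) - Complex (fst (P' r)) (fst \<eta>')) -
           cos (Complex (snd (P r)) (snd \<eta>) - Complex (snd (P' r)) (snd \<eta>')))
        / (cos (Complex (fst (P r)) (fst \<eta>)) * cos (Complex (fst (P' r)) (fst \<eta>')))"
      unfolding Z_def shifted_point_def using R by (intro mink_diff_param c) simp
    also have "\<dots> = Q r"
    proof -
      let ?A = "Complex (fst (P r)) (fst \<eta>) - Complex (fst (P' r)) (fst \<eta>')"
      let ?B = "Complex (snd (P r)) (snd \<eta>) - Complex (snd (P' r)) (snd \<eta>')"
      have "q 1 r = exp (- \<i> * (?A + ?B))" "q (-1) r = exp (- \<i> * (?A - ?B))"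
        unfolding q_def light_mode_def by (rule arg_cong[where f = exp], simp add: algebra_simps)+
      then show ?thesis
        unfolding cos_quotient_factorization[OF c] Q_def w_def w'_def by (simp only:)
    qed
    finally show ?thesis .
  qed
  \<comment> \<open>The difference of the two points has its imaginary part in the forward cone, up
    to sign, by convexity of the cone; \<open>mink_tube\<close> then excludes the cut.\<close>
  have slitQ: "Q r \<notin> \<real>\<^sub>\<le>\<^sub>0" if r: "r \<in> {0..1}" for r
  proof
    define y where "y = (\<chi> i. Im (shifted_point R \<eta> (P r) $ i))"
    define y' where "y' = (\<chi> i. Im (shifted_point R \<eta>' (P' r) $ i))"
    have "y \<in> V_minus" "y' \<in> V_plus"
      using shifted_point_in_tuboid_iff[OF R, of "P r" \<eta>] shifted_point_in_tuboid_iff[OF R, of "P' r" \<eta>'] dom[OF r] \<eta>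
      by (auto simp: chart_dom_iff tuboid_def y_def y'_def)
    then have "y' + (- y) \<in> V_plus" by (intro V_plus_add) (auto simp: V_minus_def)
    moreover have "y' + (- y) = (\<chi> i. Im ((- Z r) $ i))"
      by (simp add: vec_eq_iff Z_def y_def y'_def)
    ultimately have "mink (- Z r) (- Z r) \<notin> \<real>\<^sub>\<ge>\<^sub>0" using mink_tube by metis
    moreover have "mink (- Z r) (- Z r) = mink (Z r) (Z r)" by (simp add: mink_def)
    moreover assume "Q r \<in> \<real>\<^sub>\<le>\<^sub>0"
    then obtain x where x: "x \<le> 0" "Q r = complex_of_real x" by (elim nonpos_Reals_cases)
    have "- mink (Z r) (Z r) = complex_of_real (x * R\<^sup>2)"
      using argQ[OF r] R x(2) by (simp add: field_simps)
    then have "mink (Z r) (Z r) = complex_of_real (- x * R\<^sup>2)"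
      by (metis minus_minus mult_minus_left of_real_minus)
    moreover have "- x * R\<^sup>2 \<ge> 0" using x by (simp add: mult_nonpos_nonneg)
    ultimately show False by (metis nonneg_Reals_of_real_iff)
  qed
  have expS: "exp (S r) = Q r" for r
    using nz[of r] by (simp add: S_def Q_def exp_add exp_diff exp_of_real)
  have Q0: "Q r \<noteq> 0" for r using nz[of r] by (simp add: Q_def)
  txt \<open>The branch is fixed by scaling the real parts of the coordinates to zero, where all logarithms
    are taken of positive numbers.\<close>
  have "S 1 - Ln (Q 1) = 0"
  proof (rule continuous_log_branch[of "\<lambda>r. S r - Ln (Q r)"])
    show "continuous_on {0..1} (\<lambda>r. S r - Ln (Q r))"
      unfolding S_def Q_def[abs_def]
      by (intro continuous_intros contq slit; (use slitQ nz in \<open>simp add: Q_def\<close>)?)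
    show "exp (S r - Ln (Q r)) = 1" if "r \<in> {0..1}" for r
      using Q0[of r] by (simp add: exp_diff expS)
    have real: "q \<epsilon> 0 = of_real (exp (- light_gap \<epsilon> \<eta> \<eta>'))" "w 0 = of_real (exp (2 * fst \<eta>))"
      "w' 0 = of_real (exp (- 2 * fst \<eta>'))" for \<epsilon>
      unfolding q_def w_def w'_def light_mode_def cP exp_of_real[symmetric]
      by (rule arg_cong[where f = exp], simp add: complex_eq_iff light_gap_def algebra_simps)+
    have pos: "1 - exp (- light_gap 1 \<eta> \<eta>') > 0" "1 - exp (- light_gap (-1) \<eta> \<eta>') > 0"
      using light_gap_pos[OF \<eta>] by simp_all
    have ps: "0 < 1 + exp (2 * fst \<eta>)" "0 < 1 + exp (- 2 * fst \<eta>')" by (simp_all add: add_pos_pos)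
    have Im_Ln: "Im (Ln (of_real x)) = 0" if "x > 0" for x using that by (simp add: Ln_of_real)
    have "1 - q \<epsilon> 0 = of_real (1 - exp (- light_gap \<epsilon> \<eta> \<eta>'))" "1 + w 0 = of_real (1 + exp (2 * fst \<eta>))"
      "1 + w' 0 = of_real (1 + exp (- 2 * fst \<eta>'))" for \<epsilon> unfolding real by simp_all
    note r1 = this
    have "Q 0 = of_real (4 * ((1 - exp (- light_gap 1 \<eta> \<eta>')) * (1 - exp (- light_gap (-1) \<eta> \<eta>'))) /
        ((1 + exp (2 * fst \<eta>)) * (1 + exp (- 2 * fst \<eta>'))))"
      unfolding Q_def r1 by simp
    then have "Im (Ln (Q 0)) = 0"
      using pos ps by (simp only: Im_Ln divide_pos_pos mult_pos_pos zero_less_numeral)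
    moreover have "Im (S 0) = 0"
      unfolding S_def r1 using pos ps by (simp only: plus_complex.sel minus_complex.sel Im_Ln Im_complex_of_real)
    ultimately show "Im (S 0 - Ln (Q 0)) = 0" by simp
  qed
  then have "Ln (Q 1) = S 1" by simp
  moreover have "P 1 = p" "P' 1 = p'" by (simp_all add: P_def P'_def)
  moreover have "Ln (1 + w 1) = cnj (edge_log (- fst \<eta>) (fst p))"
    using \<eta>(1) by (subst cnj_edge_log) (auto simp: w_def P_def)
  ultimately have "Ln (Q 1) = of_real (ln 4) + Ln (1 - light_mode 1 \<eta> \<eta>' p p') + Ln (1 - light_mode (-1) \<eta> \<eta>' p p')
      - cnj (edge_log (- fst \<eta>) (fst p)) - edge_log (fst \<eta>') (fst p')"
    by (simp add: S_def q_def w'_def edge_log_def)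
  moreover have "W0 R (shifted_point R \<eta> p) (shifted_point R \<eta>' p') = - (1 / (4 * of_real pi)) * Ln (Q 1)"
    using argQ[of 1] by (simp add: W0_def Z_def P_def P'_def)
  ultimately show ?thesis by (simp only:) (simp add: algebra_simps)
qed

subsection \<open>The regularized two-point integral\<close>

text \<open>Every term of the expansion is a function of one point times a function of the other and
  is evaluated by this.\<close>

lemma (in pair_sigma_finite) tensor_integral:
  fixes a :: "'a \<Rightarrow> 'c::{real_normed_algebra, banach, second_countable_topology}"
  assumes a: "integrable M1 a" and b: "integrable M2 b"
  shows "integrable (M1 \<Otimes>\<^sub>M M2) (\<lambda>z. a (fst z) * b (snd z))"
    and "(LINT z|(M1 \<Otimes>\<^sub>M M2). a (fst z) * b (snd z)) = integral\<^sup>L M1 a * integral\<^sup>L M2 b"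
proof -
  have meas [measurable]: "a \<in> borel_measurable M1" "b \<in> borel_measurable M2"
    using a b by auto
  show int: "integrable (M1 \<Otimes>\<^sub>M M2) (\<lambda>z. a (fst z) * b (snd z))"
  proof (rule Fubini_integrable)
    show "(\<lambda>z. a (fst z) * b (snd z)) \<in> borel_measurable (M1 \<Otimes>\<^sub>M M2)" by measurable
    show "integrable M1 (\<lambda>x. LINT y|M2. norm (a (fst (x, y)) * b (snd (x, y))))"
    proof (rule Bochner_Integration.integrable_bound)
      show "integrable M1 (\<lambda>x. norm (a x) * (LINT y|M2. norm (b y)))"
        using a by (intro integrable_mult_left integrable_norm)
      show "(\<lambda>x. LINT y|M2. norm (a (fst (x, y)) * b (snd (x, y)))) \<in> borel_measurable M1"
        by measurable
      show "AE x in M1. norm (LINT y|M2. norm (a (fst (x, y)) * b (snd (x, y)))) \<le> norm (norm (a x) * (LINT y|M2. norm (b y)))"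
      proof (rule AE_I2)
        fix x
        have "(LINT y|M2. norm (a x * b y)) \<le> (LINT y|M2. norm (a x) * norm (b y))"
          using b by (intro integral_mono integrable_norm integrable_mult_right norm_mult_ineq)
        moreover have "0 \<le> (LINT y|M2. norm (a x * b y))" "0 \<le> (LINT y|M2. norm (b y))" by simp_all
        ultimately show "norm (LINT y|M2. norm (a (fst (x, y)) * b (snd (x, y)))) \<le> norm (norm (a x) * (LINT y|M2. norm (b y)))"
          by simp
      qed
    qed
    show "AE x in M1. integrable M2 (\<lambda>y. a (fst (x, y)) * b (snd (x, y)))"
      using b by (intro AE_I2) simp
  qed
  show "(LINT z|(M1 \<Otimes>\<^sub>M M2). a (fst z) * b (snd z)) = integral\<^sup>L M1 a * integral\<^sup>L M2 b"
    unfolding integral_fst'[OF int, symmetric] using a b by simp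
qed

lemma pair_sigma_finite_dsigma: "pair_sigma_finite (dsigma R) (dsigma R)"
  unfolding pair_sigma_finite_def using sigma_finite_dsigma by auto

text \<open>Powers separate the two points into a conjugated wave at \<open>p\<close> and the same
  wave at \<open>p'\<close>. This is the source of positivity.\<close>

lemma light_mode_power:
  "light_mode \<epsilon> \<eta> \<eta>' p p' ^ n =
    of_real (exp (- (real n * light_gap \<epsilon> \<eta> \<eta>'))) * (cnj (plane_wave \<epsilon> n p) * plane_wave \<epsilon> n p')"
proof -
  have "light_mode \<epsilon> \<eta> \<eta>' p p' ^ n = exp (of_nat n * (- \<i> * ((Complex (fst p) (fst \<eta>) - Complex (fst p') (fst \<eta>')) +
     of_real \<epsilon> * (Complex (snd p) (snd \<eta>) - Complex (snd p') (snd \<eta>')))))"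
    unfolding light_mode_def exp_of_nat_mult ..
  moreover have "cnj (plane_wave \<epsilon> n p) = exp (- (\<i> * of_nat n * of_real (fst p + \<epsilon> * snd p)))"
    unfolding plane_wave_def exp_cnj by simp
  moreover have "of_nat n * (- \<i> * ((Complex (fst p) (fst \<eta>) - Complex (fst p') (fst \<eta>')) +
     of_real \<epsilon> * (Complex (snd p) (snd \<eta>) - Complex (snd p') (snd \<eta>')))) =
     of_real (- (real n * light_gap \<epsilon> \<eta> \<eta>')) +
       (- (\<i> * of_nat n * of_real (fst p + \<epsilon> * snd p)) + \<i> * of_nat n * of_real (fst p' + \<epsilon> * snd p'))"
    by (simp add: complex_eq_iff light_gap_def algebra_simps)
  ultimately show ?thesis
    by (simp only: exp_add exp_of_real plane_wave_def)
qed

lemma light_mode_log_sums: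
  assumes "light_gap \<epsilon> \<eta> \<eta>' > 0"
  shows "(\<lambda>n. of_real (exp (- (real n * light_gap \<epsilon> \<eta> \<eta>')) / n) * (cnj (plane_wave \<epsilon> n p) * plane_wave \<epsilon> n p'))
    sums - Ln (1 - light_mode \<epsilon> \<eta> \<eta>' p p')"
proof -
  have "norm (- light_mode \<epsilon> \<eta> \<eta>' p p') < 1" using assms by (simp add: norm_light_mode)
  from sums_minus[OF Ln_series'[OF this]] show ?thesis
    by (simp add: light_mode_power)
qed

text \<open>Multiplication by the unimodular factor exp(-ix) makes the real part equal to
  \<open>cos x + r * cos x\<close> with r = exp(-2b). The resulting bounds do not depend on b, as
  dominated convergence requires.\<close>

lemma edge_log_slit:
  assumes "\<bar>x\<bar> < pi / 2" "b \<ge> 0"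
  shows "1 + exp (2 * \<i> * Complex x b) \<notin> \<real>\<^sub>\<le>\<^sub>0" and "cos x \<le> norm (1 + exp (2 * \<i> * Complex x b))"
    and "norm (1 + exp (2 * \<i> * Complex x b)) \<le> 2"
proof -
  define r where "r = exp (- 2 * b)"
  have r: "0 < r" "r \<le> 1" using assms(2) by (simp_all add: r_def)
  have e: "exp (2 * \<i> * Complex x b) = of_real r * exp (\<i> * of_real (2 * x))"
  proof -
    have "2 * \<i> * Complex x b = of_real (- 2 * b) + \<i> * of_real (2 * x)" by (simp add: complex_eq_iff)
    then show ?thesis by (simp only: exp_add exp_of_real r_def)
  qed
  have c: "cos x > 0" using assms(1) by (intro cos_gt_zero_pi) auto
  have "exp (- (\<i> * of_real x)) * (1 + exp (2 * \<i> * Complex x b)) =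
      exp (- (\<i> * of_real x)) + of_real r * exp (\<i> * of_real x)"
    unfolding e distrib_left by (simp add: mult.left_commute flip: exp_add)
  then have "norm (1 + exp (2 * \<i> * Complex x b)) = norm (exp (- (\<i> * of_real x)) + of_real r * exp (\<i> * of_real x))"
    by (metis norm_mult norm_exp_eq_Re norm_minus_cancel norm_exp_i_times mult_1 mult_minus_right of_real_minus)
  also have "\<dots> \<ge> Re (exp (- (\<i> * of_real x)) + of_real r * exp (\<i> * of_real x))"
    by (rule complex_Re_le_cmod)
  also have "Re (exp (- (\<i> * of_real x)) + of_real r * exp (\<i> * of_real x)) = cos x + r * cos x"
    by (simp add: Re_exp)
  finally have lower: "cos x + r * cos x \<le> norm (1 + exp (2 * \<i> * Complex x b))" .
  then show "cos x \<le> norm (1 + exp (2 * \<i> * Complex x b))" using mult_pos_pos[OF r(1) c] by linarith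
  have "norm (1 + exp (2 * \<i> * Complex x b)) \<le> 1 + norm (exp (2 * \<i> * Complex x b))"
    by (metis norm_one norm_triangle_ineq)
  moreover have "norm (exp (2 * \<i> * Complex x b)) = r" by (simp add: norm_exp_eq_Re r_def)
  ultimately show "norm (1 + exp (2 * \<i> * Complex x b)) \<le> 2"
    using r by linarith
  show "1 + exp (2 * \<i> * Complex x b) \<notin> \<real>\<^sub>\<le>\<^sub>0"
  proof
    assume "1 + exp (2 * \<i> * Complex x b) \<in> \<real>\<^sub>\<le>\<^sub>0"
    then have le: "Re (1 + exp (2 * \<i> * Complex x b)) \<le> 0" by (simp add: complex_nonpos_Reals_iff)
    have "Re (1 + exp (2 * \<i> * Complex x b)) = 1 + r * cos (2 * x)"
      unfolding e by (simp add: Re_exp)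
    also have "\<dots> = (1 - r) + r * (2 * (cos x)\<^sup>2)"
      unfolding cos_double_cos by (simp add: algebra_simps)
    also have "\<dots> > 0" using r c by (intro add_nonneg_pos) auto
    finally show False using le by simp
  qed
qed

lemma continuous_on_edge_log: "b \<ge> 0 \<Longrightarrow> continuous_on chart_dom (\<lambda>p. edge_log b (fst p))"
proof -
  assume b: "b \<ge> 0"
  have "continuous_on chart_dom (\<lambda>p. Ln (1 + exp (2 * \<i> * (of_real (fst p) + \<i> * of_real b))))"
    using edge_log_slit(1)[OF _ b] by (intro continuous_intros) (auto simp: chart_dom_iff Complex_eq)
  then show ?thesis by (simp add: edge_log_def Complex_eq)
qed

text \<open>The imaginary part \<tau> of the mode lies in the principal range, so \<open>Ln\<close>
  inverts \<open>exp\<close> here.\<close>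

lemma edge_log_0: "p \<in> chart_dom \<Longrightarrow> edge_log 0 (fst p) = log_mode p"
proof -
  assume p: "p \<in> chart_dom"
  have c: "cos (fst p) > 0" by (rule cos_chart_dom[OF p])
  have "exp (log_mode p) = of_real (2 * cos (fst p)) * exp (\<i> * of_real (fst p))"
  proof -
    have "exp (complex_of_real (ln (2 * cos (fst p)))) = of_real (2 * cos (fst p))"
      using c by (simp only: exp_of_real exp_ln mult_pos_pos zero_less_numeral)
    then show ?thesis by (simp add: log_mode_def exp_add)
  qed
  also have "\<dots> = (exp (\<i> * of_real (fst p)) + exp (- (\<i> * of_real (fst p)))) * exp (\<i> * of_real (fst p))"
    using cos_exp_eq[of "of_real (fst p) :: complex"] by (simp add: cos_of_real mult.commute)
  also have "\<dots> = 1 + exp (2 * \<i> * Complex (fst p) 0)"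
    by (simp add: distrib_right Complex_eq add.commute mult.assoc flip: exp_add)
  finally have "edge_log 0 (fst p) = Ln (exp (log_mode p))" by (simp add: edge_log_def)
  also have "\<dots> = log_mode p"
    using p by (intro Ln_exp) (auto simp: log_mode_def chart_dom_iff abs_less_iff)
  finally show ?thesis .
qed

text \<open>The modulus inside the logarithm lies between \<open>cos a\<close> and 2, and the
  principal argument is at most pi in absolute value.\<close>

lemma norm_edge_log_le:
  assumes x: "\<bar>x\<bar> < a" and a: "a < pi / 2" and b: "b \<ge> 0"
  shows "norm (edge_log b x) \<le> ln 2 - ln (cos a) + pi"
proof -
  let ?z = "1 + exp (2 * \<i> * Complex x b)"
  have x2: "\<bar>x\<bar> < pi / 2" using x a by simp
  have ca: "0 < cos a" using x a by (intro cos_gt_zero_pi) auto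
  have "cos a \<le> cos \<bar>x\<bar>" using x a by (intro cos_monotone_0_pi_le) auto
  then have "cos a \<le> norm ?z" using edge_log_slit(2)[OF x2 b] by (simp add: abs_if split: if_splits)
  then have nz: "norm ?z > 0" and l: "ln (cos a) \<le> ln (norm ?z)" using ca by (auto intro!: ln_mono)
  have u: "ln (norm ?z) \<le> ln 2" using nz edge_log_slit(3)[OF x2 b] by simp
  have "ln (cos a) \<le> 0" using ca by simp
  moreover have "0 \<le> ln (2::real)" by simp
  ultimately have "\<bar>ln (norm ?z)\<bar> \<le> ln 2 - ln (cos a)" using l u by linarith
  moreover have "Re (Ln ?z) = ln (norm ?z)" "\<bar>Im (Ln ?z)\<bar> \<le> pi"
    using nz mpi_less_Im_Ln[of ?z] Im_Ln_le_pi[of ?z] by (auto simp: abs_le_iff)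
  ultimately show ?thesis
    unfolding edge_log_def using cmod_le[of "Ln ?z"] by linarith
qed

lemma tendsto_edge_log:
  assumes "\<bar>x\<bar> < pi / 2"
  shows "((\<lambda>b. edge_log b x) \<longlongrightarrow> edge_log 0 x) (at_right 0)"
proof -
  have "((\<lambda>b. Ln (1 + exp (2 * \<i> * (of_real x + \<i> * of_real b)))) \<longlongrightarrow>
      Ln (1 + exp (2 * \<i> * (of_real x + \<i> * of_real 0)))) (at_right 0)"
    using edge_log_slit(1)[OF assms order_refl] by (intro tendsto_intros) (auto simp: Complex_eq)
  then show ?thesis by (simp add: edge_log_def Complex_eq)
qed

lemma tendsto_pairing_edge_log:
  assumes R: "R > 0" and f: "f \<in> test_functions R"
  shows "((\<lambda>b. pairing R (\<lambda>p. edge_log b (fst p)) f) \<longlongrightarrow> pairing R log_mode f) (at_right 0)"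
proof -
  obtain a where a: "0 < a" "a < pi / 2" "\<And>p. p \<in> chart_dom \<Longrightarrow> a \<le> \<bar>fst p\<bar> \<Longrightarrow> f (param R p) = 0"
    using test_function_support[OF R f] by metis
  define C where "C = ln 2 - ln (cos a) + pi"
  have cf: "continuous_on chart_dom (\<lambda>p. f (param R p))"
    by (intro smooth_on_continuous test_function_smooth[OF f])
  \<comment> \<open>The convergence theorem runs along \<open>at_top\<close>, hence b = 1/t; the
    absolute value keeps b nonnegative for every t.\<close>
  have "((\<lambda>t. LINT p|dsigma R. f (param R p) * edge_log \<bar>inverse t\<bar> (fst p)) \<longlongrightarrow>
      (LINT p|dsigma R. f (param R p) * log_mode p)) at_top"
  proof (rule integral_dominated_convergence_at_top[where w = "\<lambda>p. norm (f (param R p)) * C"])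
    show "(\<lambda>p. f (param R p) * log_mode p) \<in> borel_measurable (dsigma R)"
      by (intro measurable_dsigma continuous_on_mult cf continuous_on_log_mode)
    show "(\<lambda>p. f (param R p) * edge_log \<bar>inverse t\<bar> (fst p)) \<in> borel_measurable (dsigma R)" for t
      by (intro measurable_dsigma continuous_on_mult cf continuous_on_edge_log) simp
    show "integrable (dsigma R) (\<lambda>p. norm (f (param R p)) * C)"
      using test_function_integrable[OF R f continuous_on_const, of 1]
      by (intro integrable_mult_left integrable_norm) simp
    show "AE p in dsigma R. ((\<lambda>t. f (param R p) * edge_log \<bar>inverse t\<bar> (fst p)) \<longlongrightarrow> f (param R p) * log_mode p) at_top"
    proof (rule AE_I2)
      fix p assume "p \<in> space (dsigma R)"
      then have p: "p \<in> chart_dom" by (rule space_dsigma_chart)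
      have "((\<lambda>b. edge_log b (fst p)) \<longlongrightarrow> edge_log 0 (fst p)) (at_right 0)"
        using p by (intro tendsto_edge_log) (simp add: chart_dom_iff)
      then have "((\<lambda>t. edge_log (inverse t) (fst p)) \<longlongrightarrow> log_mode p) at_top"
        unfolding filterlim_at_right_to_top edge_log_0[OF p] .
      then have "((\<lambda>t. edge_log \<bar>inverse t\<bar> (fst p)) \<longlongrightarrow> log_mode p) at_top"
        by (rule Lim_transform_eventually) (use eventually_gt_at_top[of 0] in \<open>eventually_elim, simp\<close>)
      then show "((\<lambda>t. f (param R p) * edge_log \<bar>inverse t\<bar> (fst p)) \<longlongrightarrow> f (param R p) * log_mode p) at_top"
        by (intro tendsto_mult tendsto_const)
    qed
    show "\<forall>\<^sub>F t in at_top. AE p in dsigma R. norm (f (param R p) * edge_log \<bar>inverse t\<bar> (fst p)) \<le> norm (f (param R p)) * C"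
    proof (rule always_eventually, rule allI, rule AE_I2)
      fix t :: real and p assume "p \<in> space (dsigma R)"
      then have p: "p \<in> chart_dom" by (rule space_dsigma_chart)
      show "norm (f (param R p) * edge_log \<bar>inverse t\<bar> (fst p)) \<le> norm (f (param R p)) * C"
      proof (cases "\<bar>fst p\<bar> < a")
        case True
        have "norm (edge_log \<bar>inverse t\<bar> (fst p)) \<le> C"
          unfolding C_def by (rule norm_edge_log_le[OF True a(2)]) simp
        then show ?thesis unfolding norm_mult by (intro mult_left_mono) auto
      qed (use a(3)[OF p] in simp)
    qed
  qed
  then have "((\<lambda>t. pairing R (\<lambda>p. edge_log (inverse t) (fst p)) f) \<longlongrightarrow> pairing R log_mode f) at_top"
    unfolding pairing_def
    by (rule Lim_transform_eventually) (use eventually_gt_at_top[of 0] in \<open>eventually_elim, simp\<close>)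
  then show ?thesis unfolding filterlim_at_right_to_top .
qed

text \<open>The term with \<open>n = 0\<close> vanishes, because \<open>x / 0 = 0\<close>.\<close>

definition mode_sum :: "real \<Rightarrow> real \<Rightarrow> real \<Rightarrow> (real ^ 3 \<Rightarrow> complex) \<Rightarrow> (real ^ 3 \<Rightarrow> complex) \<Rightarrow> complex" where
  "mode_sum R \<epsilon> d f g = (\<Sum>n. of_real (exp (- (real n * d)) / n) *
     (cnj (pairing R (plane_wave \<epsilon> n) f) * pairing R (plane_wave \<epsilon> n) g))"

text \<open>For positive damping the coefficients are dominated by a geometric series and the waves
  have modulus 1, so sum and integral may be exchanged. Decay of the pairings enters only when
  \<open>d\<close> tends to 0.\<close>

lemma mode_sum_integral:
  fixes \<epsilon> :: real
  assumes R: "R > 0" and f: "f \<in> test_functions R" and g: "g \<in> test_functions R" and d: "d > 0"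
  defines "T \<equiv> \<lambda>n z. of_real (exp (- (real n * d)) / n) *
      (cnj (f (param R (fst z)) * plane_wave \<epsilon> n (fst z)) * (g (param R (snd z)) * plane_wave \<epsilon> n (snd z)))"
  shows "integrable (dsigma R \<Otimes>\<^sub>M dsigma R) (\<lambda>z. \<Sum>n. T n z)"
    and "(LINT z|(dsigma R \<Otimes>\<^sub>M dsigma R). (\<Sum>n. T n z)) = mode_sum R \<epsilon> d f g"
proof -
  interpret pair_sigma_finite "dsigma R" "dsigma R" by (rule pair_sigma_finite_dsigma)
  define c where "c n = exp (- (real n * d)) / n" for n :: nat
  have c0: "c n \<ge> 0" for n by (simp add: c_def)
  have sc: "summable c"
  proof (rule summable_comparison_test')
    show "summable (\<lambda>n. exp (- d) ^ n)" using d by (intro summable_geometric) simp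
    show "norm (c n) \<le> exp (- d) ^ n" if "n \<ge> 0" for n
    proof (cases "n = 0")
      case False
      have "c n = exp (- d) ^ n / real n"
        using exp_of_nat_mult[of n "- d"] by (simp add: c_def)
      also have "\<dots> \<le> exp (- d) ^ n / 1"
        using False by (intro frac_le) auto
      finally show ?thesis using c0[of n] by simp
    qed (simp add: c_def)
  qed
  have int: "integrable (dsigma R) (\<lambda>p. cnj (f (param R p) * plane_wave \<epsilon> n p))"
    "integrable (dsigma R) (\<lambda>p. g (param R p) * plane_wave \<epsilon> n p)" for n
    by (intro integrable_cnj test_function_integrable R f g continuous_on_plane_wave)+
  have int0: "integrable (dsigma R) (\<lambda>p. norm (f (param R p)))" "integrable (dsigma R) (\<lambda>p. norm (g (param R p)))"
    using test_function_integrable[OF R f continuous_on_const, of 1]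
      test_function_integrable[OF R g continuous_on_const, of 1] by (simp_all add: integrable_norm)
  have T: "integrable (dsigma R \<Otimes>\<^sub>M dsigma R) (T n)"
    "(LINT z|(dsigma R \<Otimes>\<^sub>M dsigma R). T n z) =
      of_real (c n) * (cnj (pairing R (plane_wave \<epsilon> n) f) * pairing R (plane_wave \<epsilon> n) g)" for n
  proof -
    note t = tensor_integral[OF int(1) int(2), of n n]
    show "integrable (dsigma R \<Otimes>\<^sub>M dsigma R) (T n)"
      unfolding T_def by (intro integrable_mult_right t)
    show "(LINT z|(dsigma R \<Otimes>\<^sub>M dsigma R). T n z) =
      of_real (c n) * (cnj (pairing R (plane_wave \<epsilon> n) f) * pairing R (plane_wave \<epsilon> n) g)"
      unfolding T_def c_def[symmetric] integral_mult_right_zero t(2) Bochner_Integration.integral_cnj pairing_def ..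
  qed
  have nT: "norm (T n z) = c n * (norm (f (param R (fst z))) * norm (g (param R (snd z))))" for n z
    using c0[of n] unfolding T_def c_def[symmetric] by (simp add: norm_mult norm_plane_wave)
  have 1: "AE z in dsigma R \<Otimes>\<^sub>M dsigma R. summable (\<lambda>n. norm (T n z))"
    unfolding nT using sc by (intro AE_I2 summable_mult2)
  have 2: "summable (\<lambda>n. LINT z|(dsigma R \<Otimes>\<^sub>M dsigma R). norm (T n z))"
    unfolding nT integral_mult_right_zero using sc by (intro summable_mult2)
  show "integrable (dsigma R \<Otimes>\<^sub>M dsigma R) (\<lambda>z. \<Sum>n. T n z)"
    by (rule integrable_suminf[OF T(1) 1 2])
  show "(LINT z|(dsigma R \<Otimes>\<^sub>M dsigma R). (\<Sum>n. T n z)) = mode_sum R \<epsilon> d f g"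
    unfolding integral_suminf[OF T(1) 1 2] T(2) mode_sum_def c_def ..
qed

text \<open>An edge logarithm depends on one point only, so the other variable contributes a plain
  integral. This is where the terms with the integrals of \<open>f\<close> and \<open>g\<close> come
  from.\<close>

lemma regularized_bracket:
  assumes R: "R > 0" and f: "f \<in> test_functions R" and g: "g \<in> test_functions R"
    and \<eta>: "\<bar>snd \<eta>\<bar> < - fst \<eta>" "\<bar>snd \<eta>'\<bar> < fst \<eta>'"
  shows "(LINT (p, p')|(dsigma R \<Otimes>\<^sub>M dsigma R). W0 R (shifted_point R \<eta> p) (shifted_point R \<eta>' p') *
            cnj (f (param R p)) * g (param R p')) =
    1 / (4 * of_real pi) *
     (cnj (pairing R (\<lambda>p. edge_log (- fst \<eta>) (fst p)) f) * dS_integral R g +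
      cnj (dS_integral R f) * pairing R (\<lambda>p. edge_log (fst \<eta>') (fst p)) g -
      of_real (ln 4) * (cnj (dS_integral R f) * dS_integral R g) +
      mode_sum R 1 (light_gap 1 \<eta> \<eta>') f g + mode_sum R (-1) (light_gap (-1) \<eta> \<eta>') f g)"
proof -
  interpret pair_sigma_finite "dsigma R" "dsigma R" by (rule pair_sigma_finite_dsigma)
  let ?M = "dsigma R \<Otimes>\<^sub>M dsigma R"
  define F where "F p = f (param R p)" for p
  define G where "G p = g (param R p)" for p
  define T where "T \<epsilon> n z = of_real (exp (- (real n * light_gap \<epsilon> \<eta> \<eta>')) / n) *
      (cnj (F (fst z) * plane_wave \<epsilon> n (fst z)) * (G (snd z) * plane_wave \<epsilon> n (snd z)))" for \<epsilon> n z
  define A1 where "A1 z = cnj (F (fst z) * edge_log (- fst \<eta>) (fst (fst z))) * G (snd z)" for z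
  define A2 where "A2 z = cnj (F (fst z)) * (G (snd z) * edge_log (fst \<eta>') (fst (snd z)))" for z
  define A3 where "A3 z = of_real (ln 4) * (cnj (F (fst z)) * G (snd z))" for z
  have gap: "light_gap 1 \<eta> \<eta>' > 0" "light_gap (-1) \<eta> \<eta>' > 0"
    using light_gap_pos[OF \<eta>] by simp_all
  have pos: "0 \<le> - fst \<eta>" "0 \<le> fst \<eta>'" using \<eta> by linarith+
  have i0: "integrable (dsigma R) F" "integrable (dsigma R) G"
    using test_function_integrable[OF R f continuous_on_const, of 1]
      test_function_integrable[OF R g continuous_on_const, of 1] by (simp_all add: F_def[abs_def] G_def[abs_def])
  have iE: "integrable (dsigma R) (\<lambda>p. F p * edge_log (- fst \<eta>) (fst p))"
    "integrable (dsigma R) (\<lambda>p. G p * edge_log (fst \<eta>') (fst p))"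
    unfolding F_def G_def by (intro test_function_integrable R f g continuous_on_edge_log pos)+
  have S: "integrable ?M (\<lambda>z. \<Sum>n. T 1 n z)" "integrable ?M (\<lambda>z. \<Sum>n. T (-1) n z)"
    "(LINT z|?M. (\<Sum>n. T 1 n z)) = mode_sum R 1 (light_gap 1 \<eta> \<eta>') f g"
    "(LINT z|?M. (\<Sum>n. T (-1) n z)) = mode_sum R (-1) (light_gap (-1) \<eta> \<eta>') f g"
    unfolding T_def F_def G_def by (intro mode_sum_integral R f g gap)+
  note t1 = tensor_integral[OF integrable_cnj[OF iE(1)] i0(2)]
  note t2 = tensor_integral[OF integrable_cnj[OF i0(1)] iE(2)]
  note t3 = tensor_integral[OF integrable_cnj[OF i0(1)] i0(2)]
  have A: "integrable ?M A1" "integrable ?M A2" "integrable ?M A3"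
    unfolding A1_def A2_def A3_def by (intro t1 t2 t3 integrable_mult_right)+
  have B: "(LINT z|?M. A1 z) = cnj (pairing R (\<lambda>p. edge_log (- fst \<eta>) (fst p)) f) * dS_integral R g"
    "(LINT z|?M. A2 z) = cnj (dS_integral R f) * pairing R (\<lambda>p. edge_log (fst \<eta>') (fst p)) g"
    "(LINT z|?M. A3 z) = of_real (ln 4) * (cnj (dS_integral R f) * dS_integral R g)"
    unfolding A1_def A2_def A3_def integral_mult_right_zero t1(2) t2(2) t3(2) Bochner_Integration.integral_cnj
    by (simp_all add: pairing_def dS_integral_def F_def[abs_def] G_def[abs_def])
  have "(LINT z|?M. (case z of (p, p') \<Rightarrow> W0 R (shifted_point R \<eta> p) (shifted_point R \<eta>' p') *
            cnj (f (param R p)) * g (param R p'))) =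
    (LINT z|?M. 1 / (4 * of_real pi) * (A1 z + A2 z - A3 z + (\<Sum>n. T 1 n z) + (\<Sum>n. T (-1) n z)))"
  proof (rule Bochner_Integration.integral_cong[OF refl])
    fix z assume z: "z \<in> space ?M"
    obtain p p' where zp: "z = (p, p')" by (cases z)
    have p: "p \<in> chart_dom" "p' \<in> chart_dom"
      using z zp by (auto simp: space_pair_measure intro: space_dsigma_chart)
    have sT: "(\<Sum>n. T \<epsilon> n z) = - Ln (1 - light_mode \<epsilon> \<eta> \<eta>' p p') * (cnj (F p) * G p')"
      if "light_gap \<epsilon> \<eta> \<eta>' > 0" for \<epsilon>
    proof -
      have "(\<lambda>n. T \<epsilon> n z) sums (- Ln (1 - light_mode \<epsilon> \<eta> \<eta>' p p') * (cnj (F p) * G p'))"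
        using sums_mult2[OF light_mode_log_sums[OF that], of p p' "cnj (F p) * G p'"]
        by (simp add: T_def zp mult_ac)
      then show ?thesis by (rule sums_unique[symmetric])
    qed
    show "(case z of (p, p') \<Rightarrow> W0 R (shifted_point R \<eta> p) (shifted_point R \<eta>' p') *
            cnj (f (param R p)) * g (param R p')) =
        1 / (4 * of_real pi) * (A1 z + A2 z - A3 z + (\<Sum>n. T 1 n z) + (\<Sum>n. T (-1) n z))"
      unfolding sT[OF gap(1)] sT[OF gap(2)] unfolding zp prod.case W0_shifted_points[OF R p \<eta>] A1_def A2_def A3_def
        F_def[symmetric] G_def[symmetric] fst_conv snd_conv complex_cnj_mult
      by (simp add: algebra_simps)
  qed
  also have "\<dots> = 1 / (4 * of_real pi) *
      (LINT z|?M. A1 z + A2 z - A3 z + (\<Sum>n. T 1 n z) + (\<Sum>n. T (-1) n z))"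
    by (rule integral_mult_right_zero)
  also have "(LINT z|?M. A1 z + A2 z - A3 z + (\<Sum>n. T 1 n z) + (\<Sum>n. T (-1) n z)) =
      (LINT z|?M. A1 z) + (LINT z|?M. A2 z) - (LINT z|?M. A3 z) + (LINT z|?M. (\<Sum>n. T 1 n z)) + (LINT z|?M. (\<Sum>n. T (-1) n z))"
    using A S(1,2) by simp
  finally show ?thesis unfolding B S(3,4) .
qed

lemma mode_terms_summable:
  assumes R: "R > 0" and f: "f \<in> test_functions R" and g: "g \<in> test_functions R" and \<epsilon>: "\<epsilon> = 1 \<or> \<epsilon> = - 1"
  shows "summable (\<lambda>n. norm (pairing R (plane_wave \<epsilon> n) f) * norm (pairing R (plane_wave \<epsilon> n) g) / real n)"
proof -
  obtain C where C: "\<And>n. real n * norm (pairing R (plane_wave \<epsilon> n) f) \<le> C"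
    by (rule plane_wave_decay[OF R f \<epsilon>]) blast
  obtain D where D: "\<And>n. real n * norm (pairing R (plane_wave \<epsilon> n) g) \<le> D"
    by (rule plane_wave_decay[OF R g \<epsilon>]) blast
  show ?thesis
  proof (rule summable_comparison_test')
    \<comment> \<open>Two decay estimates and the weight 1/n give the third power.\<close>
    show "summable (\<lambda>n. C * D * inverse (real n ^ 3))"
      by (intro summable_mult inverse_power_summable) simp
    fix n :: nat assume "n \<ge> 1"
    then have n: "real n > 0" by simp
    have "(real n * norm (pairing R (plane_wave \<epsilon> n) f)) * (real n * norm (pairing R (plane_wave \<epsilon> n) g)) \<le> C * D"
      using C[of n] D[of n] n order_trans[OF _ C[of n], of 0] by (intro mult_mono) auto
    then have "norm (pairing R (plane_wave \<epsilon> n) f) * norm (pairing R (plane_wave \<epsilon> n) g) / real n \<le> C * D / real n ^ 3"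
      using n by (simp add: field_simps power3_eq_cube)
    then show "norm (norm (pairing R (plane_wave \<epsilon> n) f) * norm (pairing R (plane_wave \<epsilon> n) g) / real n)
        \<le> C * D * inverse (real n ^ 3)"
      by (simp add: divide_inverse)
  qed
qed

lemma tendsto_mode_sum:
  assumes R: "R > 0" and f: "f \<in> test_functions R" and g: "g \<in> test_functions R" and \<epsilon>: "\<epsilon> = 1 \<or> \<epsilon> = - 1"
  shows "((\<lambda>d. mode_sum R \<epsilon> d f g) \<longlongrightarrow> mode_sum R \<epsilon> 0 f g) (at_right 0)"
proof -
  let ?x = "\<lambda>n. cnj (pairing R (plane_wave \<epsilon> n) f) * pairing R (plane_wave \<epsilon> n) g"
  have "((\<lambda>d. \<Sum>n. of_real (exp (- (real n * d)) / n) * ?x n) \<longlongrightarrow> (\<Sum>n. of_real (exp (- (real n * 0)) / n) * ?x n)) (at_right 0)"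
  \<comment> \<open>Dominated convergence for series, with the undamped moduli as majorant.\<close>
  proof (rule tannerys_theorem[THEN conjunct2, THEN conjunct2])
    show "((\<lambda>d. of_real (exp (- (real n * d)) / n) * ?x n) \<longlongrightarrow> of_real (exp (- (real n * 0)) / n) * ?x n) (at_right 0)" for n
    proof (cases "n = 0")
      case False
      then show ?thesis by (intro tendsto_intros) simp
    qed simp
    have "\<forall>\<^sub>F (n :: nat, d) in at_top \<times>\<^sub>F at_right (0::real). d > 0"
      by (subst eventually_prod2) (simp_all add: eventually_at_right_less)
    then show "\<forall>\<^sub>F (n, d) in at_top \<times>\<^sub>F at_right 0. norm (of_real (exp (- (real n * d)) / n) * ?x n)
        \<le> norm (pairing R (plane_wave \<epsilon> n) f) * norm (pairing R (plane_wave \<epsilon> n) g) / real n"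
    proof (rule eventually_mono)
      fix z :: "nat \<times> real" assume "case z of (n, d) \<Rightarrow> d > 0"
      moreover obtain n d where "z = (n, d)" by (cases z)
      ultimately have z: "z = (n, d)" "d > 0" by simp_all
      have "norm (of_real (exp (- (real n * d)) / n) * ?x n) =
          exp (- (real n * d)) * (norm (pairing R (plane_wave \<epsilon> n) f) * norm (pairing R (plane_wave \<epsilon> n) g) / real n)"
        by (simp add: norm_mult norm_divide)
      also have "\<dots> \<le> norm (pairing R (plane_wave \<epsilon> n) f) * norm (pairing R (plane_wave \<epsilon> n) g) / real n"
        using z(2) by (intro mult_left_le_one_le) auto
      finally show "case z of (n, d) \<Rightarrow> norm (of_real (exp (- (real n * d)) / n) * ?x n)
        \<le> norm (pairing R (plane_wave \<epsilon> n) f) * norm (pairing R (plane_wave \<epsilon> n) g) / real n"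
        by (simp add: z(1))
    qed
  qed (use mode_terms_summable[OF assms] in simp_all)
  then show ?thesis unfolding mode_sum_def by simp
qed

subsection \<open>The indefinite form as a sum over modes\<close>

text \<open>Positivity on the cone turns the joint limit into a one-sided one, which composes with
  limits along \<open>at_right 0\<close>.\<close>

lemma filterlim_cone:
  fixes H :: "(real \<times> real) \<times> (real \<times> real) \<Rightarrow> real"
  assumes "isCont H 0" "H 0 = 0" "\<And>z. z \<in> S \<Longrightarrow> H z > 0"
  shows "filterlim H (at_right 0) (at 0 within S)"
proof (rule tendsto_imp_filterlim_at_right)
  show "(H \<longlongrightarrow> 0) (at 0 within S)"
    using assms(1,2) by (metis continuous_at_imp_continuous_at_within continuous_within)
  show "\<forall>\<^sub>F z in at 0 within S. 0 < H z"
    unfolding eventually_at_filter using assms(3) by (intro always_eventually) simp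
qed

lemma bracket_formula:
  assumes R: "R > 0" and f: "f \<in> test_functions R" and g: "g \<in> test_functions R"
  shows "bracket R f g = 1 / (4 * of_real pi) *
     (cnj (pairing R log_mode f) * dS_integral R g + cnj (dS_integral R f) * pairing R log_mode g -
      of_real (ln 4) * (cnj (dS_integral R f) * dS_integral R g) +
      mode_sum R 1 0 f g + mode_sum R (-1) 0 f g)"
proof -
  define S where "S = {\<eta> :: real \<times> real. \<bar>snd \<eta>\<bar> < - fst \<eta>} \<times> {\<eta> :: real \<times> real. \<bar>snd \<eta>\<bar> < fst \<eta>}"
  have S: "S = approach R (tuboid R V_minus) \<times> approach R (tuboid R V_plus)"
    by (simp only: S_def approach_tuboid[OF R])
  \<comment> \<open>A sequence inside both cones that tends to their common apex. The filter is thus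
    nontrivial, so convergence determines the value of \<open>Lim\<close>.\<close>
  let ?X = "\<lambda>n. ((- inverse (real (Suc n)), 0), (inverse (real (Suc n)), 0)) :: (real \<times> real) \<times> (real \<times> real)"
  have "?X \<longlonglongrightarrow> ((- 0, 0), (0, 0))"
    by (intro tendsto_intros LIMSEQ_inverse_real_of_nat)
  then have "?X \<longlonglongrightarrow> 0" by (simp add: zero_prod_def)
  moreover have "?X n \<in> S - {0}" for n
    by (simp add: S_def zero_prod_def)
  ultimately have "0 islimpt S" unfolding islimpt_sequential by (intro exI[of _ ?X]) blast
  then have nb: "at 0 within S \<noteq> bot" by (simp add: trivial_limit_within)
  define J where "J z = (LINT (p, p')|(dsigma R \<Otimes>\<^sub>M dsigma R).
      W0 R (shifted_point R (fst z) p) (shifted_point R (snd z) p') * cnj (f (param R p)) * g (param R p'))" for z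
  define K where "K z = 1 / (4 * of_real pi) *
     (cnj (pairing R (\<lambda>p. edge_log (- fst (fst z)) (fst p)) f) * dS_integral R g +
      cnj (dS_integral R f) * pairing R (\<lambda>p. edge_log (fst (snd z)) (fst p)) g -
      of_real (ln 4) * (cnj (dS_integral R f) * dS_integral R g) +
      mode_sum R 1 (light_gap 1 (fst z) (snd z)) f g + mode_sum R (-1) (light_gap (-1) (fst z) (snd z)) f g)" for z
  have JK: "J z = K z" if "z \<in> S" for z
    using that unfolding J_def K_def S_def by (intro regularized_bracket R f g) auto
  have lims: "filterlim (\<lambda>z. - fst (fst z)) (at_right 0) (at 0 within S)"
    "filterlim (\<lambda>z. fst (snd z)) (at_right 0) (at 0 within S)"
    "filterlim (\<lambda>z. light_gap 1 (fst z) (snd z)) (at_right 0) (at 0 within S)"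
    "filterlim (\<lambda>z. light_gap (-1) (fst z) (snd z)) (at_right 0) (at 0 within S)"
    unfolding light_gap_def
    by (rule filterlim_cone; (intro continuous_intros | force simp: S_def)?)+
  note c = filterlim_compose[OF tendsto_pairing_edge_log[OF R f] lims(1)]
    filterlim_compose[OF tendsto_pairing_edge_log[OF R g] lims(2)]
    filterlim_compose[OF tendsto_mode_sum[OF R f g, of 1, simplified] lims(3)]
    filterlim_compose[OF tendsto_mode_sum[OF R f g, of "-1", simplified] lims(4)]
  let ?B = "1 / (4 * of_real pi) *
     (cnj (pairing R log_mode f) * dS_integral R g + cnj (dS_integral R f) * pairing R log_mode g -
      of_real (ln 4) * (cnj (dS_integral R f) * dS_integral R g) +
      mode_sum R 1 0 f g + mode_sum R (-1) 0 f g)"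
  have "(K \<longlongrightarrow> ?B) (at 0 within S)"
    unfolding K_def by (intro tendsto_intros c)
  then have "(J \<longlongrightarrow> ?B) (at 0 within S)"
    by (rule Lim_transform_eventually) (simp add: eventually_at_filter JK always_eventually)
  then have "Lim (at 0 within S) J = ?B" by (rule tendsto_Lim[OF nb])
  moreover have "J = (\<lambda>(\<eta>, \<eta>'). LINT (p, p')|(dsigma R \<Otimes>\<^sub>M dsigma R).
      W0 R (shifted_point R \<eta> p) (shifted_point R \<eta>' p') * cnj (f (param R p)) * g (param R p'))"
    by (simp add: J_def fun_eq_iff)
  ultimately show ?thesis unfolding bracket_def S by simp
qed

lemma mode_sum_summable:
  assumes "R > 0" "f \<in> test_functions R" "g \<in> test_functions R" "\<epsilon> = 1 \<or> \<epsilon> = - 1"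
  shows "summable (\<lambda>n. of_real (exp (- (real n * 0)) / n) *
     (cnj (pairing R (plane_wave \<epsilon> n) f) * pairing R (plane_wave \<epsilon> n) g))"
  by (rule summable_norm_cancel) (use mode_terms_summable[OF assms] in \<open>simp add: norm_mult norm_divide\<close>)

lemma mode_sum_properties:
  assumes R: "R > 0" and f: "f \<in> test_functions R" and g: "g \<in> test_functions R" and \<epsilon>: "\<epsilon> = 1 \<or> \<epsilon> = - 1"
  shows mode_sum_cnj: "mode_sum R \<epsilon> 0 f g = cnj (mode_sum R \<epsilon> 0 g f)"
    and mode_sum_add: "k \<in> test_functions R \<Longrightarrow> mode_sum R \<epsilon> 0 f (\<lambda>x. g x + k x) = mode_sum R \<epsilon> 0 f g + mode_sum R \<epsilon> 0 f k"
    and mode_sum_scale: "mode_sum R \<epsilon> 0 f (\<lambda>x. c * g x) = c * mode_sum R \<epsilon> 0 f g"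
    and mode_sum_nonneg: "0 \<le> Re (mode_sum R \<epsilon> 0 f f)"
proof -
  note s = mode_sum_summable[OF R _ _ \<epsilon>]
  show "mode_sum R \<epsilon> 0 f g = cnj (mode_sum R \<epsilon> 0 g f)"
    unfolding mode_sum_def bounded_linear.suminf[OF bounded_linear_cnj s[OF g f]]
    by (simp add: mult.commute)
  show "mode_sum R \<epsilon> 0 f (\<lambda>x. g x + k x) = mode_sum R \<epsilon> 0 f g + mode_sum R \<epsilon> 0 f k" if k: "k \<in> test_functions R"
    unfolding mode_sum_def suminf_add[OF s[OF f g] s[OF f k]]
    by (simp add: pairing_add[OF R continuous_on_plane_wave g k] algebra_simps)
  show "mode_sum R \<epsilon> 0 f (\<lambda>x. c * g x) = c * mode_sum R \<epsilon> 0 f g"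
    unfolding mode_sum_def pairing_scale by (subst suminf_mult[OF s[OF f g], symmetric]) (simp only: mult_ac)
  have "Re (mode_sum R \<epsilon> 0 f f) = (\<Sum>n. Re (of_real (exp (- (real n * 0)) / n) *
     (cnj (pairing R (plane_wave \<epsilon> n) f) * pairing R (plane_wave \<epsilon> n) f)))"
    unfolding mode_sum_def by (rule bounded_linear.suminf[OF bounded_linear_Re s[OF f f]])
  also have "\<dots> \<ge> 0"
  proof (rule suminf_nonneg)
    show "summable (\<lambda>n. Re (of_real (exp (- (real n * 0)) / n) *
     (cnj (pairing R (plane_wave \<epsilon> n) f) * pairing R (plane_wave \<epsilon> n) f)))"
      by (rule bounded_linear.summable[OF bounded_linear_Re s[OF f f]])
    show "0 \<le> Re (of_real (exp (- (real n * 0)) / n) *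
     (cnj (pairing R (plane_wave \<epsilon> n) f) * pairing R (plane_wave \<epsilon> n) f))" for n
    proof -
      have sq: "cnj z * z = of_real ((norm z)\<^sup>2)" for z by (simp only: complex_norm_square mult.commute)
      show ?thesis unfolding sq of_real_mult[symmetric] Re_complex_of_real by simp
    qed
  qed
  finally show "0 \<le> Re (mode_sum R \<epsilon> 0 f f)" .
qed

lemma dS_integral_cnj: "dS_integral R (\<lambda>x. cnj (f x)) = cnj (dS_integral R f)"
  by (simp add: dS_integral_def)

text \<open>The plane waves and the integral annihilate \<open>v0 R h\<close>, so a single
  logarithmic term survives. Its pairing is the product of -4 pi R^2 and -1/R^2, that is 4 pi, which
  cancels the prefactor of the form; this explains the constant in \<open>v0\<close>.\<close>

lemma bracket_v0:
  assumes R: "R > 0" and h: "h \<in> test_functions R" "dS_integral R h = 1" and g: "g \<in> test_functions R"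
  shows "v0 R h \<in> test_functions R" "dS_integral R (v0 R h) = 0" "bracket R (v0 R h) g = dS_integral R g"
proof -
  define c where "c = - 4 * complex_of_real pi * (complex_of_real R)\<^sup>2"
  have v: "v0 R h = (\<lambda>x. c * dAlembertian R h x)" by (simp add: v0_def c_def)
  show v0: "v0 R h \<in> test_functions R"
    unfolding v by (intro test_functions_scale test_functions_dAlembertian R h)
  show s: "dS_integral R (v0 R h) = 0"
    unfolding v dS_integral_pairing pairing_scale
    using dS_integral_dAlembertian[OF R h(1)] by (simp add: dS_integral_pairing)
  have "pairing R (plane_wave \<epsilon> n) (v0 R h) = 0" if "\<epsilon> = 1 \<or> \<epsilon> = - 1" for \<epsilon> n
    unfolding v pairing_scale plane_wave_dAlembertian[OF R h(1) that] by simp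
  then have m: "mode_sum R 1 0 (v0 R h) g = 0" "mode_sum R (-1) 0 (v0 R h) g = 0"
    by (simp_all add: mode_sum_def)
  have "pairing R log_mode (v0 R h) = 4 * of_real pi"
    unfolding v pairing_scale log_mode_dAlembertian[OF R h(1)] h(2) using R by (simp add: c_def)
  then show "bracket R (v0 R h) g = dS_integral R g"
    unfolding bracket_formula[OF R v0 g] m s by simp
qed

lemma krein_data_dS:
  assumes R: "R > 0" and h: "h \<in> test_functions R" "dS_integral R h = 1" "bracket R h h = 0"
  shows "krein_data (test_functions R) (bracket R) (dS_integral R) h (v0 R h)"
proof
  fix f g k :: "real ^ 3 \<Rightarrow> complex" and c :: complex
  assume f: "f \<in> test_functions R"
  show "(\<lambda>x. c * f x) \<in> test_functions R" by (rule test_functions_scale[OF f])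
  show "dS_integral R (\<lambda>x. c * f x) = c * dS_integral R f"
    unfolding dS_integral_pairing by (rule pairing_scale)
  show "bracket R (v0 R h) f = dS_integral R f" by (rule bracket_v0(3)[OF R h(1,2) f])
  \<comment> \<open>With zero integral the logarithmic terms and the \<open>ln 4\<close> term drop,
    leaving two sums of weighted squared moduli.\<close>
  show "0 \<le> Re (bracket R f f)" if "dS_integral R f = 0"
    unfolding bracket_formula[OF R f f] that
    using mode_sum_nonneg[OF R f f, of 1] mode_sum_nonneg[OF R f f, of "-1"] by simp
  assume g: "g \<in> test_functions R"
  show "(\<lambda>x. f x + g x) \<in> test_functions R" by (rule test_functions_add[OF f g])
  show "dS_integral R (\<lambda>x. f x + g x) = dS_integral R f + dS_integral R g"
    unfolding dS_integral_pairing by (rule pairing_add[OF R continuous_on_const f g])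
  have "cnj (mode_sum R 1 0 g f) = mode_sum R 1 0 f g" "cnj (mode_sum R (-1) 0 g f) = mode_sum R (-1) 0 f g"
    by (rule mode_sum_cnj[OF R f g, symmetric], simp)+
  then show "bracket R f g = cnj (bracket R g f)"
    unfolding bracket_formula[OF R f g] bracket_formula[OF R g f] by (simp add: algebra_simps)
  show "bracket R f (\<lambda>x. c * g x) = c * bracket R f g"
    unfolding bracket_formula[OF R f g] bracket_formula[OF R f test_functions_scale[OF g]]
      mode_sum_scale[OF R f g, of 1, simplified] mode_sum_scale[OF R f g, of "-1", simplified]
      dS_integral_pairing pairing_scale
    by (simp add: algebra_simps)
  assume k: "k \<in> test_functions R"
  show "bracket R f (\<lambda>x. g x + k x) = bracket R f g + bracket R f k"
    unfolding bracket_formula[OF R f g] bracket_formula[OF R f k] bracket_formula[OF R f test_functions_add[OF g k]]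
      mode_sum_add[OF R f g _ k, of 1, simplified] mode_sum_add[OF R f g _ k, of "-1", simplified]
      dS_integral_pairing pairing_add[OF R continuous_on_const g k] pairing_add[OF R continuous_on_log_mode g k]
    by (simp add: algebra_simps)
qed (use bracket_v0[OF R h(1,2) h(1)] h in auto)

theorem proposition3p1:
  fixes R :: real and h :: "real ^ 3 \<Rightarrow> complex"
  assumes "R > 0"
    and "h \<in> test_functions R" and "\<forall>x. h x \<in> \<real>"
    and "dS_integral R h = 1" and "bracket R h h = 0"
  shows "(\<forall>f \<in> test_functions R.
            krein_inner R h f f \<in> \<real> \<and> 0 \<le> Re (krein_inner R h f f) \<and>
            (krein_inner R h f f = 0 \<longleftrightarrow> f \<in> I_null R h)) \<and>
         v0 R h \<in> test_functions R \<and>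
         I_null R h \<subseteq> D0_perp R h \<and>
         (\<forall>cls :: (real ^ 3 \<Rightarrow> complex) \<Rightarrow> 'k::chilbert_space.
            hilbert_completion (test_functions R) (krein_inner R h) (I_null R h) UNIV cinner cls \<longrightarrow>
            (\<exists>!B. extends_bracket R cls B) \<and>
            (\<forall>B. extends_bracket R cls B \<longrightarrow> (\<exists>N \<eta>.
               krein_metric B \<eta> \<and>
               hilbert_completion (D0_perp R h) (bracket R) (I_null R h) N B cls \<and>
               orthogonal_direct_sum3 N (cls ` line_plus (v0 R h) (I_null R h))
                                        (cls ` line_plus h (I_null R h)) \<and>
               (\<forall>x \<in> N. \<eta> x = x) \<and>
               \<eta> (cls h) = cls (v0 R h) \<and>
               \<eta> (cls (v0 R h)) = cls h)))"
proof -
  interpret krein_data "test_functions R" "bracket R" "dS_integral R" h "v0 R h"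
    by (rule krein_data_dS) fact+
  \<comment> \<open>The concrete definitions agree with the abstract ones because integration
    commutes with conjugation.\<close>
  have kr_eq: "krein_inner R h = kr"
    unfolding krein_inner_def kr_def pr_def proj0_def dS_integral_cnj fun_eq_iff by simp
  have null_eq: "I_null R h = null"
    unfolding I_null_def null_def D0_def by auto
  have perp_eq': "D0_perp R h = perp"
    unfolding D0_perp_def perp_def D0_def kr_eq by auto
  show ?thesis
    unfolding kr_eq null_eq perp_eq' line_plus_def extends_bracket_def
  proof (intro conjI ballI allI impI)
    fix f assume "f \<in> test_functions R"
    then show "kr f f \<in> \<real>" "0 \<le> Re (kr f f)" "kr f f = 0 \<longleftrightarrow> f \<in> null"
      by (rule kr_properties)+
  qed (fact v_E null_subset_perp | erule krein_completion | assumption)+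
qed

end
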